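(* Let $X$ be a Polish space, let $(\Omega,\mathcal{F},\mathbb{P},\{\theta_t\}_{t\in\mathbb{R}})$ be a metric dynamical system, let $\bar X=X\cup\{\partial\}$ and $\Delta=\{(s,t)\in\mathbb{R}^2: 0\le s\le t\}$. Assume that $\phi:\Delta\times\bar X\times\Omega\to\bar X$, $(s,t,x,\omega)\mapsto\phi_{s,t}(x,\omega)$, is a measurable map satisfying: (i) $\partial$ is an absorbing state, i.e. $\phi_{s,t}(\partial,\omega)=\partial$ for all $0\le s\le t$, $\omega\in\Omega$; (ii) $\phi_{s,u}(x,\omega)=\phi_{t,u}(\phi_{s,t}(x,\omega),\omega)$ for all $x\in\bar X$, $\omega\in\Omega$, $0\le s\le t\le u$; (iii) for every $s\ge 0$ there exists a $\mathbb{P}$-null set $N_s$ such that $\phi_{s,t}(x,\omega)=\phi_{0,t-s}(x,\theta_s\omega)$ for all $x\in\bar X$, $\omega\notin N_s$ and $t\ge s$; (iv) for every $t>0$, $\omega\in\Omega$, $x\in X$ and $s_0\in[0,t)$, the map $s\mapsto\phi_{s,t}(x,\omega)$ is right continuous at $s_0$ if $\phi_{s_0,t}(x,\omega)\in X$; (v) $t\mapsto\phi_{s,t}(x,\omega)$ is right continuous on $[s,\infty)$ for every $s\ge0$, $\omega\in\Omega$, $x\in\bar X$. Then there exists a measurable map $\tilde\phi:\Delta\times\bar X\times\Omega\to\bar X$ which satisfies (i), (ii), (iv), (v) (with $\tilde\phi$ in place of $\phi$) and moreover: (iii') $\tilde\phi_{s,t}(x,\omega)=\tilde\phi_{0,t-s}(x,\theta_s\omega)$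 for all $x\in\bar X$, $\omega\in\Omega$ and $t\ge s\ge0$. (vi) For each $s\ge0$, the processes $\tilde\phi_{s,\cdot}(\cdot)$ and $\phi_{s,\cdot}(\cdot)$ are indistinguishable, i.e. $\mathbb{P}_*\big(\tilde\phi_{s,t}(x)=\phi_{s,t}(x)\text{ for all }t\ge s\text{ and }x\in\bar X\big)=1$. (vii) If $\phi_{s,s}(x,\omega)=x$ for all $s\ge0$, $x\in\bar X$, $\omega\in\Omega$, then the same holds for $\tilde\phi$. (viii) If $\phi_{s,t}(x,\omega)\in X$ for all $(s,t)\in\Delta$, $x\in X$, $\omega\in\Omega$, then the same holds for $\tilde\phi$. (ix) If $\phi_{s,t}(x,\omega)$ is continuous in $s$ for every choice of the other variables, then the same holds for $\tilde\phi$; if it is continuous in $t$ for every choice of the other variables, then the same holds for $\tilde\phi$; and likewise if it is continuous in both $s$ and $t$. (x) If, for some $x_0\in X$, the map $x\mapsto\phi_{s,t}(x,\omega)$ is continuous at $x_0$ for every $(s,t)\in\Delta$, $\omega\in\Omega$, then the same holds for $\tilde\phi$.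
   Context: A Polish space is a separable completely metrizable topological space; it carries its Borel $\sigma$-field. For a Polish space $X$, $\bar X:=X\cup\{\partial\}$ is the (topological) disjoint union of $X$ and one additional point $\partial$ (so $\partial$ is isolated), again a Polish space. A metric dynamical system $(\Omega,\mathcal{F},\mathbb{P},\{\theta_t\}_{t\in\mathbb{R}})$ is a probability space $(\Omega,\mathcal{F},\mathbb{P})$ with a family of maps $\theta_t:\Omega\to\Omega$, $t\in\mathbb{R}$, such that $\theta_0=\mathrm{id}$, $\theta_{t+s}=\theta_t\circ\theta_s$ for all $s,t\in\mathbb{R}$, the map $(t,\omega)\mapsto\theta_t\omega$ is measurable, and $\theta_t\mathbb{P}=\mathbb{P}$ for all $t\in\mathbb{R}$. $\mathbb{P}_*$ denotes the inner measure on $\Omega$ associated with $\mathbb{P}$. *)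

theory Defs
  imports "HOL-Probability.Probability"
begin

(* For a space X, given as a type 'a, the extended space X Un {partial} is 'a option:
   None is the additional point partial, range Some is X.
   It carries the disjoint-union topology, in which None is isolated. *)

instantiation option :: (topological_space) topological_space
begin

definition open_option :: "'a option set \<Rightarrow> bool" where
  "open_option U \<longleftrightarrow> open (Some -` U)"

instance proof
  show "open (UNIV :: 'a option set)"
    by (simp add: open_option_def)
  show "open (S \<inter> T)" if "open S" "open T" for S T :: "'a option set"
    using that by (simp add: open_option_def open_Int)
  show "open (\<Union>K)" if "\<forall>S\<in>K. open S" for K :: "'a option set set"
    using that unfolding open_option_def vimage_Union by (rule open_UN)
qed

end

lemma open_None: "open {None :: 'a::topological_space option}"
  by (simp add: open_option_def vimage_def)

lemma open_Some_image_iff: "open (Some ` U) \<longleftrightarrow> open (U :: 'a::topological_space set)"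
  by (simp add: open_option_def inj_vimage_image_eq)

(* Needed to speak of isCont at points of the extended space. *)
instance option :: (t2_space) t2_space
proof
  have *: "\<exists>U V. open U \<and> open V \<and> None \<in> U \<and> Some b \<in> V \<and> U \<inter> V = {}" for b :: 'a
    by (rule exI[of _ "{None}"], rule exI[of _ "range Some"])
      (simp add: open_None open_Some_image_iff)
  fix x y :: "'a option"
  assume "x \<noteq> y"
  show "\<exists>U V. open U \<and> open V \<and> x \<in> U \<and> y \<in> V \<and> U \<inter> V = {}"
  proof (cases x)
    case None
    with \<open>x \<noteq> y\<close> * show ?thesis by (cases y) simp_all
  next
    case x: (Some a)
    show ?thesis
    proof (cases y)
      case None
      from *[of a] x None show ?thesis by (metis Int_commute)
    next
      case (Some b)
      with x \<open>x \<noteq> y\<close> have "a \<noteq> b" by simp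
      then obtain U V where UV: "open U" "open V" "a \<in> U" "b \<in> V" "U \<inter> V = {}"
        using hausdorff by metis
      have "Some ` U \<inter> Some ` V = {}" using UV(5) by blast
      with UV x Some show ?thesis
        by (intro exI[of _ "Some ` U"] exI[of _ "Some ` V"])
          (simp add: open_Some_image_iff)
    qed
  qed
qed

(* The sample space is space M, the sigma-field is sets M. *)
locale metric_dynamical_system = prob_space M
  for M :: "'w measure" and \<theta> :: "real \<Rightarrow> 'w \<Rightarrow> 'w" +
  assumes theta_zero: "\<And>\<omega>. \<omega> \<in> space M \<Longrightarrow> \<theta> 0 \<omega> = \<omega>"
    and theta_add: "\<And>s t \<omega>. \<omega> \<in> space M \<Longrightarrow> \<theta> (t + s) \<omega> = \<theta> t (\<theta> s \<omega>)"
    and theta_measurable: "(\<lambda>(t, \<omega>). \<theta> t \<omega>) \<in> borel \<Otimes>\<^sub>M M \<rightarrow>\<^sub>M M"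
    and theta_preserves: "\<And>t. distr M M (\<theta> t) = M"

definition inner_measure_of :: "'w measure \<Rightarrow> 'w set \<Rightarrow> ennreal" where
  "inner_measure_of M A = (SUP B \<in> {B \<in> sets M. B \<subseteq> A}. emeasure M B)"

definition Delta :: "(real \<times> real) set" where
  "Delta = {(s, t). 0 \<le> s \<and> s \<le> t}"

(* Maps Delta * (X Un {partial}) * Omega -> X Un {partial} are represented by total functions
   phi s t x omega, whose values for (s, t) outside Delta or omega outside space M are
   irrelevant to all of the following notions. *)

type_synonym ('a, 'w) two_param_map = "real \<Rightarrow> real \<Rightarrow> 'a option \<Rightarrow> 'w \<Rightarrow> 'a option"

definition jointly_measurable ::
  "'w measure \<Rightarrow> ('a::topological_space, 'w) two_param_map \<Rightarrow> bool" where
  "jointly_measurable M \<phi> \<longleftrightarrow>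
     (\<lambda>((s, t), x, \<omega>). \<phi> s t x \<omega>)
       \<in> restrict_space borel Delta \<Otimes>\<^sub>M (borel \<Otimes>\<^sub>M M) \<rightarrow>\<^sub>M borel"

definition absorbing :: "'w measure \<Rightarrow> ('a, 'w) two_param_map \<Rightarrow> bool" where
  "absorbing M \<phi> \<longleftrightarrow>
     (\<forall>s t. \<forall>\<omega>\<in>space M. 0 \<le> s \<and> s \<le> t \<longrightarrow> \<phi> s t None \<omega> = None)"

definition flow_property :: "'w measure \<Rightarrow> ('a, 'w) two_param_map \<Rightarrow> bool" where
  "flow_property M \<phi> \<longleftrightarrow>
     (\<forall>x. \<forall>\<omega>\<in>space M. \<forall>s t u. 0 \<le> s \<and> s \<le> t \<and> t \<le> u \<longrightarrow>
        \<phi> s u x \<omega> = \<phi> t u (\<phi> s t x \<omega>) \<omega>)"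

(* at_right s0 only sees s close to s0, hence s0 < s < t. *)
definition right_continuous_start ::
  "'w measure \<Rightarrow> ('a::topological_space, 'w) two_param_map \<Rightarrow> bool" where
  "right_continuous_start M \<phi> \<longleftrightarrow>
     (\<forall>t>0. \<forall>\<omega>\<in>space M. \<forall>x\<in>range Some. \<forall>s0\<in>{0..<t}.
        \<phi> s0 t x \<omega> \<in> range Some \<longrightarrow> continuous (at_right s0) (\<lambda>s. \<phi> s t x \<omega>))"

definition right_continuous_end ::
  "'w measure \<Rightarrow> ('a::topological_space, 'w) two_param_map \<Rightarrow> bool" where
  "right_continuous_end M \<phi> \<longleftrightarrow>
     (\<forall>s\<ge>0. \<forall>\<omega>\<in>space M. \<forall>x. \<forall>t0\<in>{s..}. continuous (at_right t0) (\<lambda>t. \<phi> s t x \<omega>))"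

definition crude_cocycle ::
  "'w measure \<Rightarrow> (real \<Rightarrow> 'w \<Rightarrow> 'w) \<Rightarrow> ('a, 'w) two_param_map \<Rightarrow> bool" where
  "crude_cocycle M \<theta> \<phi> \<longleftrightarrow>
     (\<forall>s\<ge>0. \<exists>N\<in>null_sets M. \<forall>x. \<forall>\<omega>\<in>space M - N. \<forall>t\<ge>s.
        \<phi> s t x \<omega> = \<phi> 0 (t - s) x (\<theta> s \<omega>))"

definition perfect_cocycle ::
  "'w measure \<Rightarrow> (real \<Rightarrow> 'w \<Rightarrow> 'w) \<Rightarrow> ('a, 'w) two_param_map \<Rightarrow> bool" where
  "perfect_cocycle M \<theta> \<phi> \<longleftrightarrow>
     (\<forall>x. \<forall>\<omega>\<in>space M. \<forall>s\<ge>0. \<forall>t\<ge>s. \<phi> s t x \<omega> = \<phi> 0 (t - s) x (\<theta> s \<omega>))"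

definition indistinguishable ::
  "'w measure \<Rightarrow> ('a, 'w) two_param_map \<Rightarrow> ('a, 'w) two_param_map \<Rightarrow> bool" where
  "indistinguishable M \<psi> \<phi> \<longleftrightarrow>
     (\<forall>s\<ge>0. inner_measure_of M {\<omega> \<in> space M. \<forall>t\<ge>s. \<forall>x. \<psi> s t x \<omega> = \<phi> s t x \<omega>} = 1)"

definition identity_on_diagonal :: "'w measure \<Rightarrow> ('a, 'w) two_param_map \<Rightarrow> bool" where
  "identity_on_diagonal M \<phi> \<longleftrightarrow> (\<forall>s\<ge>0. \<forall>x. \<forall>\<omega>\<in>space M. \<phi> s s x \<omega> = x)"

definition stays_in_X :: "'w measure \<Rightarrow> ('a, 'w) two_param_map \<Rightarrow> bool" where
  "stays_in_X M \<phi> \<longleftrightarrow>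
     (\<forall>(s, t)\<in>Delta. \<forall>x\<in>range Some. \<forall>\<omega>\<in>space M. \<phi> s t x \<omega> \<in> range Some)"

definition continuous_start ::
  "'w measure \<Rightarrow> ('a::topological_space, 'w) two_param_map \<Rightarrow> bool" where
  "continuous_start M \<phi> \<longleftrightarrow>
     (\<forall>t\<ge>0. \<forall>x. \<forall>\<omega>\<in>space M. continuous_on {0..t} (\<lambda>s. \<phi> s t x \<omega>))"

definition continuous_end ::
  "'w measure \<Rightarrow> ('a::topological_space, 'w) two_param_map \<Rightarrow> bool" where
  "continuous_end M \<phi> \<longleftrightarrow>
     (\<forall>s\<ge>0. \<forall>x. \<forall>\<omega>\<in>space M. continuous_on {s..} (\<lambda>t. \<phi> s t x \<omega>))"

(* Joint continuity in (s, t); preservation of separate continuity in both variables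
   is just the conjunction of the preservation of the two previous properties. *)
definition continuous_start_end ::
  "'w measure \<Rightarrow> ('a::topological_space, 'w) two_param_map \<Rightarrow> bool" where
  "continuous_start_end M \<phi> \<longleftrightarrow>
     (\<forall>x. \<forall>\<omega>\<in>space M. continuous_on Delta (\<lambda>(s, t). \<phi> s t x \<omega>))"

definition continuous_state_at ::
  "'w measure \<Rightarrow> 'a option \<Rightarrow> ('a::t2_space, 'w) two_param_map \<Rightarrow> bool" where
  "continuous_state_at M x0 \<phi> \<longleftrightarrow>
     (\<forall>(s, t)\<in>Delta. \<forall>\<omega>\<in>space M. isCont (\<lambda>x. \<phi> s t x \<omega>) x0)"

end

theory Submission
  imports Defs
begin

text \<open>
  By the measurable projection theorem the crude cocycle property, which holds for each fixed
  starting time up to a null set, holds for almost every \<open>\<omega>\<close> simultaneously for all states, all end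
  times and almost all starting times \<open>s\<close>. For almost every \<open>\<omega>\<close>, almost every base point \<open>\<theta>\<^sub>v \<omega>\<close> on
  its orbit is good in this sense, and the flows \<open>\<phi>\<^bsub>s - v, t - v\<^esub>(\<cdot>, \<theta>\<^sub>v \<omega>)\<close> seen from two good base
  points agree for almost all \<open>s\<close>. They may disagree at exceptional times \<open>s\<close>, because \<open>\<phi>\<^bsub>s, s\<^esub>\<close>
  need not be the identity and may send some states to \<open>\<partial>\<close>. The perfect version is therefore
  \<open>\<phi>\<^bsub>s - u, t - u\<^esub>(\<cdot>, \<theta>\<^sub>u \<omega>)\<close> for a good base point \<open>u = u(s, \<omega>)\<close> that is chosen equivariantly along
  the orbit and is constant on some interval to the right of each \<open>s\<close>. Then all path properties are
  inherited from \<open>\<phi>\<close>, and the flow property across different base points follows by inserting an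
  intermediate time at which both flows agree.

  The base points are read off upcrossings of smoothed indicators \<open>1\<^sub>c(\<theta>\<^sub>t \<omega>)\<close>, where \<open>c\<close> runs through
  countably many sets which determine \<open>\<phi>\<close>. By stationarity almost every orbit that has an upcrossing
  has them arbitrarily far in the past. An orbit without upcrossings has almost everywhere constant
  indicators, hence \<open>\<phi>\<close> is the same at almost all of its points, and this common flow is stationary.
\<close>

section \<open>Measurable projections\<close>

text \<open>Nothing places the start of the latest upcrossing itself among the good points: the law
  of this orbit point need not be absolutely continuous with respect to the given probability. Base
  points are therefore displaced by a constant \<open>\<xi>\<close>. Along a fixed orbit almost
  every displacement hits a good point, so by Fubini one constant works almost surely for countably
  many tests at once; taking it negative puts the base strictly before \<open>s\<close>. An
  indicator along an orbit is merely measurable in time. Its average over an exponentially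
  distributed future time is continuous, and if that average is constant in time, the indicator is
  almost everywhere constant. The new flow is defined only from time 0 at each point and transported
  by \<open>\<theta>\<close>, so that the perfect cocycle property holds by construction. The price
  is that the flow property has to be proved across base points, and that time 0 has to be regular
  as seen from its own base point for almost every \<open>\<omega>\<close>. Orbits of neither kind
  form a null set, on which the identity flow is used.\<close>

lemma finitely_bounded_branch:
  fixes P :: "nat \<Rightarrow> (nat \<Rightarrow> nat) \<Rightarrow> bool" and v :: "nat \<Rightarrow> nat"
  assumes local: "\<And>k w w'. (\<And>i. i < k \<Longrightarrow> w i = w' i) \<Longrightarrow> P k w \<Longrightarrow> P k w'"
    and ex: "\<And>k. \<exists>w. (\<forall>i<k. w i \<le> v i) \<and> (\<forall>j\<le>k. P j w)"
  shows "\<exists>w. \<forall>k. P k w"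
proof -
  \<comment> \<open>\<open>ext n p\<close> says that the prefix of length \<open>n\<close> of
    \<open>p\<close> extends to a witness at every level. Such prefixes can be prolonged forever,
    since only the finitely many values up to \<open>v n\<close> compete at position
    \<open>n\<close>: compactness of a product of finite sets.\<close>
  define ok where "ok k w \<longleftrightarrow> (\<forall>i<k. w i \<le> v i) \<and> (\<forall>j\<le>k. P j w)" for k w
  define ext where "ext n p \<longleftrightarrow> (\<forall>k. \<exists>w. (\<forall>i<n. w i = p i) \<and> ok k w)" for n p
  have ok_mono: "ok k w" if "ok l w" "k \<le> l" for k l w
    using that by (auto simp: ok_def)
  have step: "\<exists>p'. ext (Suc n) p' \<and> (\<forall>i<n. p' i = p i)" if "ext n p" for n p
  proof (rule ccontr)
    assume "\<not> ?thesis"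
    then have "\<not> ext (Suc n) (p(n := m))" for m by auto
    then have "\<forall>m. \<exists>k. \<forall>w. (\<forall>i<Suc n. w i = (p(n := m)) i) \<longrightarrow> \<not> ok k w"
      unfolding ext_def by blast
    then obtain K where K: "\<And>m w. (\<forall>i<Suc n. w i = (p(n := m)) i) \<Longrightarrow> \<not> ok (K m) w"
      by metis
    \<comment> \<open>One level refutes all candidates up to \<open>v n\<close> at once; including
      \<open>Suc n\<close> makes the bound on \<open>w n\<close> part of
      \<open>ok L w\<close>.\<close>
    define L where "L = Max (insert (Suc n) (K ` {..v n}))"
    from that have "\<exists>w. (\<forall>i<n. w i = p i) \<and> ok L w" unfolding ext_def by (rule spec)
    then obtain w where w: "\<forall>i<n. w i = p i" "ok L w" by (elim exE conjE)
    have "Suc n \<le> L" unfolding L_def by (rule Max_ge) auto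
    then have "w n \<le> v n" using w(2) by (auto simp: ok_def)
    then have "K (w n) \<le> L" unfolding L_def by (intro Max_ge) auto
    with w(2) have ok: "ok (K (w n)) w" by (rule ok_mono)
    have eq: "\<forall>i<Suc n. w i = (p(n := w n)) i" using w(1) by (auto simp: less_Suc_eq)
    show False using K[OF eq] ok by (rule notE)
  qed
  have "\<exists>p. \<forall>n. ext n (p n) \<and> (\<forall>i<n. p (Suc n) i = p n i)"
  proof (rule dependent_nat_choice)
    show "\<exists>p. ext 0 p" using ex by (auto simp: ext_def ok_def)
  qed (use step in blast)
  then obtain p where p: "\<And>n. ext n (p n)" "\<And>n i. i < n \<Longrightarrow> p (Suc n) i = p n i"
    by blast
  define w where "w i = p (Suc i) i" for i
  have agree: "p n i = w i" if "i < n" for n i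
    using that
  proof (induction n)
    case (Suc n)
    show ?case
    proof (cases "i = n")
      case False
      with Suc p(2)[of i n] show ?thesis by simp
    qed (simp add: w_def)
  qed simp
  have "P k w" for k
  proof -
    from p(1)[of k] have "\<exists>w. (\<forall>i<k. w i = p k i) \<and> ok k w" unfolding ext_def by (rule spec)
    then obtain w' where "\<forall>i<k. w' i = p k i" "ok k w'" by (elim exE conjE)
    then show ?thesis
      using local[of k w' w] agree by (auto simp: ok_def)
  qed
  then show ?thesis by blast
qed

text \<open>Only the first \<open>k\<close> entries matter, so lists padded with zeros replace
  sequences and the union becomes countable.\<close>

lemma ex_finite_prefix_UN:
  fixes R :: "nat \<Rightarrow> (nat \<Rightarrow> nat) \<Rightarrow> 'e set"
  assumes R: "\<And>k w. R k w \<in> sets N"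
    and local: "\<And>k w w'. (\<And>i. i < k \<Longrightarrow> w i = w' i) \<Longrightarrow> R k w = R k w'"
  shows "{e. \<exists>w. (\<forall>i<k. w i \<le> v i) \<and> (\<forall>j\<le>k. e \<in> R j w)} \<in> sets N" (is "?A \<in> _")
proof -
  define g where "g l i = (if i < k then l ! i else 0)" for l :: "nat list" and i
  have "?A = (\<Union>l\<in>{l. \<forall>i<k. g l i \<le> v i}. \<Inter>j\<in>{..k}. R j (g l))"
  proof (intro equalityI subsetI)
    fix e assume "e \<in> ?A"
    then obtain w where w: "\<forall>i<k. w i \<le> v i" "\<forall>j\<le>k. e \<in> R j w" by blast
    have g: "g (map w [0..<k]) i = w i" if "i < k" for i using that by (simp add: g_def)
    have "R j (g (map w [0..<k])) = R j w" if "j \<le> k" for j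
      by (rule local) (use that g in auto)
    with w g show "e \<in> (\<Union>l\<in>{l. \<forall>i<k. g l i \<le> v i}. \<Inter>j\<in>{..k}. R j (g l))"
      by (auto intro!: exI[of _ "map w [0..<k]"])
  qed auto
  also have "\<dots> \<in> sets N"
    using R by (intro sets.countable_UN'' sets.finite_INT) auto
  finally show ?thesis .
qed

text \<open>Outer measure is continuous along increasing sequences of arbitrary sets. Bounding the
  entries of \<open>w\<close> one after the other by \<open>v\<close> therefore keeps the outer
  measure above any given \<open>c\<close> below the full value. The bounded part is captured by a
  decreasing sequence of measurable sets whose intersection stays inside the set, so inner and outer
  measure agree.\<close>

theorem souslin_operation_measurable:
  fixes R :: "nat \<Rightarrow> (nat \<Rightarrow> nat) \<Rightarrow> 'e set"
  assumes "finite_measure N"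
    and R: "\<And>k w. R k w \<in> sets N"
    and local: "\<And>k w w'. (\<And>i. i < k \<Longrightarrow> w i = w' i) \<Longrightarrow> R k w = R k w'"
  shows "{e. \<exists>w. \<forall>k. e \<in> R k w} \<in> sets (completion N)" (is "?S \<in> _")
proof -
  interpret finite_measure N by fact
  have into: "e \<in> space N" if "e \<in> R k w" for e k w
    using R sets.sets_into_space that by blast
  define T where "T n v = {e. \<exists>w. (\<forall>i<n. w i \<le> v i) \<and> (\<forall>k. e \<in> R k w)}" for n v
  have T_space: "T n v \<subseteq> space N" for n v
    unfolding T_def using into by blast
  have S_T: "?S = T 0 v" for v by (simp add: T_def)
  have inner: "\<exists>A\<in>sets N. A \<subseteq> ?S \<and> c \<le> emeasure N A" if c: "c < outer_measure_of N ?S" for c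
  proof -
    have step: "\<exists>v'. c < outer_measure_of N (T (Suc n) v') \<and> (\<forall>i<n. v' i = v i)"
      if "c < outer_measure_of N (T n v)" for n v
    proof -
      have "T n v = (\<Union>m. T (Suc n) (v(n := m)))"
      proof (intro equalityI subsetI)
        fix e assume "e \<in> T n v"
        then obtain w where "\<forall>i<n. w i \<le> v i" "\<forall>k. e \<in> R k w" by (auto simp: T_def)
        then have "e \<in> T (Suc n) (v(n := w n))"
          unfolding T_def by (auto intro!: exI[of _ w] simp: less_Suc_eq)
        then show "e \<in> (\<Union>m. T (Suc n) (v(n := m)))" by blast
      next
        fix e assume "e \<in> (\<Union>m. T (Suc n) (v(n := m)))"
        then obtain m where "e \<in> T (Suc n) (v(n := m))" by blast
        then obtain w where w: "\<forall>i<Suc n. w i \<le> (v(n := m)) i" "\<forall>k. e \<in> R k w"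
          unfolding T_def by blast
        have "\<forall>i<n. w i \<le> v i"
        proof (intro allI impI)
          fix i assume "i < n"
          then show "w i \<le> v i" using w(1)[rule_format, of i] by simp
        qed
        with w(2) show "e \<in> T n v" unfolding T_def by blast
      qed
      moreover have "incseq (\<lambda>m. T (Suc n) (v(n := m)))"
      proof (intro monoI subsetI)
        fix a b e assume "a \<le> (b::nat)" "e \<in> T (Suc n) (v(n := a))"
        then obtain w where w: "\<And>i. i < Suc n \<Longrightarrow> w i \<le> (v(n := a)) i" "\<forall>k. e \<in> R k w"
          unfolding T_def by blast
        have "w i \<le> (v(n := b)) i" if "i < Suc n" for i
          using w(1)[OF that] \<open>a \<le> b\<close> by (auto split: if_splits)
        with w(2) show "e \<in> T (Suc n) (v(n := b))" unfolding T_def by blast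
      qed
      ultimately have "outer_measure_of N (T n v) = (SUP m. outer_measure_of N (T (Suc n) (v(n := m))))"
        by (simp add: SUP_outer_measure_of_incseq[OF T_space])
      with that obtain m where "c < outer_measure_of N (T (Suc n) (v(n := m)))"
        by (auto simp: less_SUP_iff)
      then show ?thesis by (intro exI[of _ "v(n := m)"]) auto
    qed
    have "\<exists>p. \<forall>n. c < outer_measure_of N (T n (p n)) \<and> (\<forall>i<n. p (Suc n) i = p n i)"
    proof (rule dependent_nat_choice)
      show "\<exists>v. c < outer_measure_of N (T 0 v)" using c S_T by metis
    qed (use step in blast)
    then obtain p where p: "\<And>n. c < outer_measure_of N (T n (p n))"
      "\<And>n i. i < n \<Longrightarrow> p (Suc n) i = p n i" by blast
    define v where "v i = p (Suc i) i" for i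
    have agree: "p n i = v i" if "i < n" for n i
      using that
    proof (induction n)
      case (Suc n)
      show ?case
      proof (cases "i = n")
        case False
        with Suc p(2)[of i n] show ?thesis by simp
      qed (simp add: v_def)
    qed simp
    \<comment> \<open>Asking only for the first levels of a bounded branch gives a measurable set
      that contains \<open>T k (p k)\<close>; in the intersection over \<open>k\<close>, compactness
      recovers full branches.\<close>
    define B where "B k = {e. \<exists>w. (\<forall>i<k. w i \<le> v i) \<and> (\<forall>j\<le>k. e \<in> R j w)}" for k
    have B: "B k \<in> sets N" for k
      unfolding B_def by (rule ex_finite_prefix_UN[OF R local])
    have "T k (p k) \<subseteq> B k" for k
      unfolding T_def B_def using agree by auto
    then have "outer_measure_of N (T k (p k)) \<le> emeasure N (B k)" for k
      using outer_measure_of_mono[of "T k (p k)" "B k" N] B by simp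
    with p(1) have cB: "c \<le> emeasure N (B k)" for k
      by (meson less_imp_le less_le_trans)
    have dec: "decseq B"
      unfolding decseq_def B_def by (auto intro: less_le_trans order_trans)
    have "(\<Inter>k. B k) \<subseteq> ?S"
    proof
      fix e assume "e \<in> (\<Inter>k. B k)"
      then have *: "\<exists>w. (\<forall>i<k. w i \<le> v i) \<and> (\<forall>j\<le>k. e \<in> R j w)" for k by (auto simp: B_def)
      have "\<exists>w. \<forall>k. e \<in> R k w"
      proof (rule finitely_bounded_branch[where v = v])
        fix k w w' assume "\<And>i. i < k \<Longrightarrow> w i = w' i" "e \<in> R k w"
        moreover from this(1) have "R k w = R k w'" by (rule local)
        ultimately show "e \<in> R k w'" by simp
      qed (rule *)
      then show "e \<in> ?S" by blast
    qed
    moreover have "c \<le> emeasure N (\<Inter>k. B k)"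
      using cB B by (subst INF_emeasure_decseq[symmetric, OF _ dec]) (auto intro: INF_greatest)
    moreover have "(\<Inter>k. B k) \<in> sets N" using B by auto
    ultimately show ?thesis by blast
  qed
  obtain E where E: "E \<in> sets N" "?S \<subseteq> E" "outer_measure_of N ?S = emeasure N E"
    using outer_measure_of_attain[of ?S N] into by blast
  show ?thesis
  proof (cases "outer_measure_of N ?S = 0")
    case True
    with E have "E \<in> null_sets N" by auto
    then show ?thesis using E(2) by (intro sets_completionI[of ?S "{}" ?S E]) simp_all
  next
    case False
    define I where "I = emeasure N ` {A \<in> sets N. A \<subseteq> ?S}"
    have "outer_measure_of N ?S \<le> Sup I"
    proof (rule dense_le)
      fix c assume "c < outer_measure_of N ?S"
      from inner[OF this] obtain A where A: "A \<in> sets N" "A \<subseteq> ?S" "c \<le> emeasure N A" by blast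
      then have "emeasure N A \<in> I" unfolding I_def by blast
      with A(3) show "c \<le> Sup I" by (rule order_trans[OF _ Sup_upper])
    qed
    moreover have "I \<noteq> {}" unfolding I_def by blast
    then obtain c :: "nat \<Rightarrow> ennreal" where c: "range c \<subseteq> I" "Sup I = (SUP n. c n)"
      using ennreal_Sup_countable_SUP[of I] by blast
    have "\<exists>A. A \<in> sets N \<and> A \<subseteq> ?S \<and> c n = emeasure N A" for n
    proof -
      have "c n \<in> I" using c(1) by blast
      then show ?thesis unfolding I_def by blast
    qed
    then obtain A where A: "\<And>n. A n \<in> sets N" "\<And>n. A n \<subseteq> ?S" "\<And>n. c n = emeasure N (A n)"
      by metis
    define A' where "A' = (\<Union>n. A n)"
    have A': "A' \<in> sets N" "A' \<subseteq> ?S" unfolding A'_def using A(1,2) by blast+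
    have "c n \<le> emeasure N A'" for n
      unfolding A(3) using A'(1) by (rule emeasure_mono[rotated]) (auto simp: A'_def)
    then have "(SUP n. c n) \<le> emeasure N A'" by (rule SUP_least)
    ultimately have "emeasure N E \<le> emeasure N A'"
      unfolding E(3)[symmetric] c(2) by (rule order_trans)
    moreover have "A' \<subseteq> E" using A'(2) E(2) by (rule order_trans)
    ultimately have "emeasure N (E - A') = 0"
      using A'(1) E(1) by (subst emeasure_Diff) (simp_all add: diff_eq_0_iff_ennreal less_top[symmetric])
    then have null: "E - A' \<in> null_sets N" using A'(1) E(1) by blast
    have "?S = A' \<union> (?S - A')" "?S - A' \<subseteq> E - A'" using A'(2) E(2) by blast+
    then show ?thesis using null A'(1) by (rule sets_completionI)
  qed
qed

section \<open>The Souslin operation on rectangles with a measurable and a closed side\<close>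

definition souslin_scheme ::
  "'e measure \<Rightarrow> (nat \<Rightarrow> (nat \<Rightarrow> nat) \<Rightarrow> 'e set) \<Rightarrow> (nat \<Rightarrow> (nat \<Rightarrow> nat) \<Rightarrow> 'y::topological_space set) \<Rightarrow> bool" where
  "souslin_scheme N A F \<longleftrightarrow>
     (\<forall>k w. A k w \<in> sets N \<and> closed (F k w)) \<and>
     (\<forall>k w w'. (\<forall>i<k. w i = w' i) \<longrightarrow> A k w = A k w' \<and> F k w = F k w')"

definition souslin_kernel ::
  "(nat \<Rightarrow> (nat \<Rightarrow> nat) \<Rightarrow> 'e set) \<Rightarrow> (nat \<Rightarrow> (nat \<Rightarrow> nat) \<Rightarrow> 'y set) \<Rightarrow> ('e \<times> 'y) set" where
  "souslin_kernel A F = {(e, y). \<exists>w. \<forall>k. e \<in> A k w \<and> y \<in> F k w}"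

text \<open>Families indexed by finite sequences are written as functions of infinite sequences that
  read only the first \<open>k\<close> entries. The second sides are closed so that nested ones of
  vanishing diameter meet in a complete space when the projection is taken.\<close>

definition souslin_projective :: "'e measure \<Rightarrow> ('e \<times> 'y::topological_space) set \<Rightarrow> bool" where
  "souslin_projective N D \<longleftrightarrow> (\<exists>A F. souslin_scheme N A F \<and> D = souslin_kernel A F)"

lemma souslin_schemeD:
  assumes "souslin_scheme N A F"
  shows "A k w \<in> sets N" "closed (F k w)"
    "(\<forall>i<k. w i = w' i) \<Longrightarrow> A k w = A k w' \<and> F k w = F k w'"
  using assms unfolding souslin_scheme_def by blast+

lemma souslin_schemeI:
  assumes "\<And>k w. A k w \<in> sets N" "\<And>k w. closed (F k w)"
    "\<And>k w w'. (\<forall>i<k. w i = w' i) \<Longrightarrow> A k w = A k w' \<and> F k w = F k w'"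
  shows "souslin_scheme N A F"
  using assms unfolding souslin_scheme_def by blast

lemma mem_souslin_kernel_iff:
  "(e, y) \<in> souslin_kernel A F \<longleftrightarrow> (\<exists>w. \<forall>k. e \<in> A k w \<and> y \<in> F k w)"
  by (simp add: souslin_kernel_def)

lemma souslin_projective_rectangle:
  assumes "A \<in> sets N" "closed F"
  shows "souslin_projective N (A \<times> F)"
proof -
  have "souslin_scheme N (\<lambda>_ _. A) (\<lambda>_ _. F)"
    using assms by (simp add: souslin_scheme_def)
  moreover have "A \<times> F = souslin_kernel (\<lambda>_ _. A) (\<lambda>_ _. F)"
    by (intro set_eqI) (simp add: souslin_kernel_def split_def mem_Times_iff)
  ultimately show ?thesis unfolding souslin_projective_def by blast
qed

text \<open>The first entry of \<open>w\<close> selects a member of the union and the remaining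
  entries run its scheme. Level 0 may not read any entry, hence its sides are the whole
  spaces.\<close>

lemma souslin_projective_UN:
  fixes D :: "nat \<Rightarrow> ('e \<times> 'y::topological_space) set"
  assumes "\<And>n. souslin_projective N (D n)"
  shows "souslin_projective N (\<Union>n. D n)"
proof -
  obtain A F where AF: "\<And>n. souslin_scheme N (A n) (F n)" and D: "\<And>n. D n = souslin_kernel (A n) (F n)"
    using assms unfolding souslin_projective_def by metis
  define A' where "A' k w = (case k of 0 \<Rightarrow> space N | Suc j \<Rightarrow> A (w 0) j (\<lambda>i. w (Suc i)))" for k and w :: "nat \<Rightarrow> nat"
  define F' where "F' k w = (case k of 0 \<Rightarrow> UNIV | Suc j \<Rightarrow> F (w 0) j (\<lambda>i. w (Suc i)))" for k and w :: "nat \<Rightarrow> nat"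
  have sp: "e \<in> space N" if "e \<in> A n k w" for e n k w
    using sets.sets_into_space[OF souslin_schemeD(1)[OF AF]] that by blast
  have "(\<Union>n. D n) = souslin_kernel A' F'"
  proof (intro equalityI subsetI)
    fix z assume "z \<in> (\<Union>n. D n)"
    then obtain n where n: "z \<in> D n" by blast
    obtain e y where z1: "z = (e, y)" by (cases z)
    from n obtain w where w: "\<forall>k. e \<in> A n k w \<and> y \<in> F n k w"
      unfolding D z1 mem_souslin_kernel_iff by (elim exE)
    have "e \<in> A' k (case_nat n w) \<and> y \<in> F' k (case_nat n w)" for k
      using w sp[of e n 0 w] by (simp add: A'_def F'_def split: nat.split)
    then show "z \<in> souslin_kernel A' F'" unfolding z1 mem_souslin_kernel_iff by blast
  next
    fix z assume "z \<in> souslin_kernel A' F'"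
    then obtain e y w where z: "z = (e, y)" "\<And>k. e \<in> A' k w \<and> y \<in> F' k w"
      by (auto simp: souslin_kernel_def)
    have "e \<in> A (w 0) k (\<lambda>i. w (Suc i)) \<and> y \<in> F (w 0) k (\<lambda>i. w (Suc i))" for k
      using z(2)[of "Suc k"] by (simp add: A'_def F'_def)
    then have "z \<in> D (w 0)" unfolding D z(1) mem_souslin_kernel_iff by blast
    then show "z \<in> (\<Union>n. D n)" by blast
  qed
  moreover have "A' k w \<in> sets N" "closed (F' k w)" for k w
    using souslin_schemeD[OF AF] by (simp_all add: A'_def F'_def split: nat.split)
  moreover have "A' k w = A' k w' \<and> F' k w = F' k w'" if "\<forall>i<k. w i = w' i" for k w w'
  proof (cases k)
    case (Suc j)
    then have "w 0 = w' 0" "\<forall>i<j. w (Suc i) = w' (Suc i)" using that by auto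
    with souslin_schemeD(3)[OF AF, of j "\<lambda>i. w (Suc i)" "\<lambda>i. w' (Suc i)"] Suc show ?thesis by (simp add: A'_def F'_def)
  qed (simp add: A'_def F'_def)
  ultimately show ?thesis unfolding souslin_projective_def
    by (intro exI[of _ A'] exI[of _ F'] conjI[OF souslin_schemeI])
qed

text \<open>A single sequence carries one branch for every \<open>n\<close>, stored as row
  \<open>n\<close> under the pairing of natural numbers. Level \<open>prod_encode (n, j)\<close>
  checks level \<open>j\<close> of scheme \<open>n\<close>.\<close>

lemma souslin_projective_INT:
  fixes D :: "nat \<Rightarrow> ('e \<times> 'y::topological_space) set"
  assumes "\<And>n. souslin_projective N (D n)"
  shows "souslin_projective N (\<Inter>n. D n)"
proof -
  obtain A F where AF: "\<And>n. souslin_scheme N (A n) (F n)" and D: "\<And>n. D n = souslin_kernel (A n) (F n)"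
    using assms unfolding souslin_projective_def by metis
  define row where "row w n = (\<lambda>i. w (prod_encode (n, i)))" for w :: "nat \<Rightarrow> nat" and n
  define A' where "A' k w = (case prod_decode k of (n, j) \<Rightarrow> A n j (row w n))" for k w
  define F' where "F' k w = (case prod_decode k of (n, j) \<Rightarrow> F n j (row w n))" for k w
  have A': "A' (prod_encode (n, j)) w = A n j (row w n)" 
    and F': "F' (prod_encode (n, j)) w = F n j (row w n)" for n j w
    by (simp_all add: A'_def F'_def)
  have "(\<Inter>n. D n) = souslin_kernel A' F'"
  proof (intro equalityI subsetI)
    fix z assume z: "z \<in> (\<Inter>n. D n)"
    obtain e y where ey: "z = (e, y)" by (cases z)
    have "\<exists>w. \<forall>k. e \<in> A n k w \<and> y \<in> F n k w" for n
    proof -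
      have "z \<in> D n" using z by blast
      then show ?thesis unfolding D ey mem_souslin_kernel_iff .
    qed
    then obtain W where W: "\<And>n k. e \<in> A n k (W n) \<and> y \<in> F n k (W n)" by metis
    define w where "w k = (case prod_decode k of (n, i) \<Rightarrow> W n i)" for k
    have "row w n = W n" for n by (simp add: row_def w_def)
    with W have "e \<in> A' k w \<and> y \<in> F' k w" for k
      by (simp add: A'_def F'_def split: prod.split)
    then show "z \<in> souslin_kernel A' F'" unfolding ey mem_souslin_kernel_iff by blast
  next
    fix z assume "z \<in> souslin_kernel A' F'"
    then obtain e y w where z: "z = (e, y)" "\<And>k. e \<in> A' k w \<and> y \<in> F' k w"
      by (auto simp: souslin_kernel_def)
    have "e \<in> A n k (row w n) \<and> y \<in> F n k (row w n)" for n k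
      using z(2)[of "prod_encode (n, k)"] unfolding A' F' .
    then have "z \<in> D n" for n unfolding D z(1) mem_souslin_kernel_iff by blast
    then show "z \<in> (\<Inter>n. D n)" by blast
  qed
  moreover have "A' k w \<in> sets N" "closed (F' k w)" for k w
    using souslin_schemeD[OF AF] by (simp_all add: A'_def F'_def split: prod.split)
  moreover have "A' k w = A' k w' \<and> F' k w = F' k w'" if w: "\<forall>i<k. w i = w' i" for k w w'
  proof -
    obtain n j where k: "k = prod_encode (n, j)" by (metis prod_decode_inverse surj_pair)
    \<comment> \<open>The pairing increases in its second argument, so the first \<open>j\<close>
      entries of row \<open>n\<close> lie among the entries of \<open>w\<close> that this level may
      read.\<close>
    have mono: "prod_encode (n, i) < prod_encode (n, j)" if "i < j" for i
    proof -
      have "triangle a < triangle b" if "a < b" for a b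
        by (rule less_Suc_induct[OF that]) auto
      with that show ?thesis by (simp add: prod_encode_def)
    qed
    have "\<forall>i<j. row w n i = row w' n i" using w mono unfolding k row_def by blast
    from souslin_schemeD(3)[OF AF this] show ?thesis unfolding k A' F' .
  qed
  ultimately show ?thesis unfolding souslin_projective_def
    by (intro exI[of _ A'] exI[of _ F'] conjI[OF souslin_schemeI])
qed

lemma souslin_projective_empty: "souslin_projective N {}"
  using souslin_projective_rectangle[of "{}" N "{}"] by simp

lemma souslin_projective_Un:
  assumes "souslin_projective N D" "souslin_projective N E"
  shows "souslin_projective N (D \<union> E)"
proof -
  have "D \<union> E = (\<Union>n. if n = (0::nat) then D else E)" by (auto split: if_splits)
  then show ?thesis using souslin_projective_UN[of N "\<lambda>n. if n = 0 then D else E"] assms by metis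
qed

lemma souslin_projective_Int:
  assumes "souslin_projective N D" "souslin_projective N E"
  shows "souslin_projective N (D \<inter> E)"
proof -
  have "D \<inter> E = (\<Inter>n. if n = (0::nat) then D else E)" by (auto split: if_splits)
  then show ?thesis using souslin_projective_INT[of N "\<lambda>n. if n = 0 then D else E"] assms by metis
qed

text \<open>Complements are the obstacle, so the induction runs over sets that have the property
  together with their complement. Closed sets qualify because in a metric space their complement is
  a countable union of closed sets.\<close>

lemma souslin_projective_measurable:
  fixes D :: "('e \<times> 'y::metric_space) set"
  assumes "D \<in> sets (N \<Otimes>\<^sub>M borel)"
  shows "souslin_projective N D"
proof -
  let ?\<Omega> = "space N \<times> (UNIV :: 'y set)"
  define good where "good E \<longleftrightarrow> E \<subseteq> ?\<Omega> \<and> souslin_projective N E \<and> souslin_projective N (?\<Omega> - E)" for E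
  have good_empty: "good {}"
    using souslin_projective_rectangle[of "space N" N "UNIV::'y set"]
    by (simp add: good_def souslin_projective_empty)
  have good_compl: "good (?\<Omega> - E)" if "good E" for E
    using that by (auto simp: good_def double_diff)
  have good_UN: "good (\<Union>n. E n)" if "\<And>n::nat. good (E n)" for E
  proof -
    have "?\<Omega> - (\<Union>n. E n) = (\<Inter>n. ?\<Omega> - E n)" by blast
    then show ?thesis using that unfolding good_def
      by (metis UN_least souslin_projective_UN souslin_projective_INT)
  qed
  have good_Int: "good (E \<inter> F)" if "good E" "good F" for E F
  proof -
    have "?\<Omega> - (E \<inter> F) = (?\<Omega> - E) \<union> (?\<Omega> - F)" by blast
    then show ?thesis using that unfolding good_def
      by (auto intro!: souslin_projective_Un souslin_projective_Int)
  qed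
  have good_left: "good (A \<times> UNIV)" if "A \<in> sets N" for A
  proof -
    have "?\<Omega> - A \<times> UNIV = (space N - A) \<times> UNIV" by blast
    then show ?thesis using that sets.sets_into_space[OF that] unfolding good_def
      by (auto intro!: souslin_projective_rectangle)
  qed
  have good_right: "good (space N \<times> B)" if "B \<in> sets borel" for B
  proof -
    have "B \<in> sigma_sets UNIV (Collect closed)"
      using that by (simp add: borel_eq_closed)
    then show ?thesis
    proof (induction rule: sigma_sets.induct)
      case (Basic F)
      then have "closed F" by blast
      \<comment> \<open>\<open>infdist\<close> to the empty set is 0, so the empty set gets its own
        value.\<close>
      define G where "G n = (if F = {} then UNIV else {x. 1 / real (Suc n) \<le> infdist x F})" for n
      have G: "closed (G n)" for n
        unfolding G_def by (auto intro!: closed_Collect_le continuous_intros)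
      have "x \<in> - F \<longleftrightarrow> (\<exists>n. x \<in> G n)" for x
      proof (cases "F = {}")
        case False
        have "x \<in> - F \<longleftrightarrow> 0 < infdist x F"
          using in_closed_iff_infdist_zero[OF \<open>closed F\<close> False] infdist_nonneg[of x F]
          by (auto simp: less_le)
        also have "\<dots> \<longleftrightarrow> (\<exists>n. 1 / real (Suc n) \<le> infdist x F)"
          using reals_Archimedean[of "infdist x F"]
          by (auto simp: inverse_eq_divide intro: less_imp_le less_le_trans[of 0 "1 / real (Suc n)" for n])
        finally show ?thesis using False by (simp add: G_def)
      qed (simp add: G_def)
      then have GF: "- F = (\<Union>n. G n)" by blast
      have "?\<Omega> - space N \<times> F = (\<Union>n. space N \<times> G n)" using GF by blast
      then show ?case using \<open>closed F\<close> G unfolding good_def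
        by (auto intro!: souslin_projective_UN souslin_projective_rectangle)
    next
      case (Compl B)
      have "space N \<times> (UNIV - B) = ?\<Omega> - space N \<times> B" by blast
      with Compl good_compl show ?case by metis
    next
      case (Union B)
      have "space N \<times> (\<Union>n. B n) = (\<Union>n. space N \<times> B n)" by blast
      with Union good_UN show ?case by metis
    qed (use good_empty in simp)
  qed
  have "D \<in> sigma_sets ?\<Omega> {A \<times> B |A B. A \<in> sets N \<and> B \<in> sets (borel :: 'y measure)}"
    using assms by (simp add: sets_pair_measure)
  then have "good D"
  proof (induction rule: sigma_sets.induct)
    case (Basic E)
    then obtain A B where E: "E = A \<times> B" "A \<in> sets N" "B \<in> sets borel" by blast
    then have "E = (A \<times> UNIV) \<inter> (space N \<times> B)" using sets.sets_into_space[OF E(2)] by blast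
    with E good_Int good_left good_right show ?case by metis
  qed (use good_empty good_compl good_UN in auto)
  then show ?thesis by (simp add: good_def)
qed

text \<open>The quantifier over \<open>y\<close> can be absorbed into the one over sequences if a
  sequence also pins down \<open>y\<close>. It therefore names centres, from a countable dense set,
  of balls of radius \<open>1 / 2 ^ j\<close>. By completeness, nested nonempty closed sets of
  vanishing diameter have a common point, so the existence of \<open>y\<close> becomes a condition
  on each level separately.\<close>

theorem measurable_projection:
  fixes D :: "('e \<times> 'y::polish_space) set"
  assumes "finite_measure N" "D \<in> sets (N \<Otimes>\<^sub>M borel)"
  shows "fst ` D \<in> sets (completion N)"
proof -
  from souslin_projective_measurable[OF assms(2)]
  obtain A F where AF: "souslin_scheme N A F" and D: "D = souslin_kernel A F"
    unfolding souslin_projective_def by blast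
  note A = souslin_schemeD(1)[OF AF] and F = souslin_schemeD(2)[OF AF] and local = souslin_schemeD(3)[OF AF]
  obtain S :: "'y set" where S: "countable S" "\<And>U. open U \<Longrightarrow> U \<noteq> {} \<Longrightarrow> \<exists>d\<in>S. d \<in> U"
    using countable_dense_exists by blast
  have "S \<noteq> {}" using S(2)[of UNIV] by blast
  define d where "d = from_nat_into S"
  \<comment> \<open>Entries code pairs: \<open>l w\<close> is a branch of the scheme,
    \<open>r w\<close> the sequence of indices of ball centres.\<close>
  define l where "l w i = fst (prod_decode (w i))" for w :: "nat \<Rightarrow> nat" and i
  define r where "r w i = snd (prod_decode (w i))" for w :: "nat \<Rightarrow> nat" and i
  define C where "C k w = (\<Inter>j\<le>k. F j (l w)) \<inter> (\<Inter>j<k. cball (d (r w j)) (1 / 2 ^ j))" for k w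
  \<comment> \<open>A level at which no \<open>y\<close> is left contributes nothing; apart from
    that only the first side remains.\<close>
  define R where "R k w = (if C k w = {} then {} else A k (l w))" for k w
  have "fst ` D = {e. \<exists>w. \<forall>k. e \<in> R k w}"
  proof (intro equalityI subsetI)
    fix e assume "e \<in> fst ` D"
    then obtain y where "(e, y) \<in> D" by force
    then obtain w where "\<forall>k. e \<in> A k w \<and> y \<in> F k w"
      unfolding D mem_souslin_kernel_iff by (elim exE)
    then have w: "\<And>k. e \<in> A k w" "\<And>k. y \<in> F k w" by simp_all
    have "\<exists>m. y \<in> cball (d m) (1 / 2 ^ j)" for j
    proof -
      obtain x where "x \<in> S" "x \<in> ball y (1 / 2 ^ j)" using S(2)[of "ball y (1 / 2 ^ j)"] centre_in_ball[of y "1 / 2 ^ j"] by (metis divide_pos_pos empty_iff open_ball zero_less_numeral zero_less_one zero_less_power)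
      moreover then obtain m where "x = d m"
        unfolding d_def using from_nat_into_surj[OF S(1)] by metis
      ultimately show ?thesis by (auto simp: dist_commute intro!: exI[of _ m])
    qed
    then obtain z where z: "\<And>j. y \<in> cball (d (z j)) (1 / 2 ^ j)" by metis
    define W where "W i = prod_encode (w i, z i)" for i
    have lr: "l W = w" "r W = z" by (simp_all add: fun_eq_iff l_def r_def W_def)
    have "y \<in> C k W" for k unfolding C_def lr using w(2) z by blast
    then have "e \<in> R k W" for k unfolding R_def lr using w(1) by auto
    then show "e \<in> {e. \<exists>w. \<forall>k. e \<in> R k w}" by blast
  next
    fix e assume "e \<in> {e. \<exists>w. \<forall>k. e \<in> R k w}"
    then obtain W where W: "\<And>k. e \<in> R k W" by blast
    have ne: "C k W \<noteq> {}" and e: "e \<in> A k (l W)" for k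
      using W[of k] by (simp_all add: R_def split: if_splits)
    obtain y where y: "\<And>k. y \<in> C k W"
    proof (rule decreasing_closed_nest[of "\<lambda>k. C k W"])
      show "closed (C k W)" for k
        unfolding C_def using F by (intro closed_Int closed_INT ballI closed_cball)
      show "C n W \<subseteq> C m W" if "m \<le> n" for m n
        unfolding C_def using that by (intro Int_mono INT_anti_mono) auto
      fix \<epsilon> :: real assume "\<epsilon> > 0"
      then obtain n where n: "(1 / 2) ^ n < \<epsilon> / 2"
        using real_arch_pow_inv[of "\<epsilon> / 2" "1 / 2"] by auto
      have "dist x y < \<epsilon>" if "x \<in> C (Suc n) W" "y \<in> C (Suc n) W" for x y
      proof -
        have "x \<in> cball (d (r W n)) (1 / 2 ^ n)" "y \<in> cball (d (r W n)) (1 / 2 ^ n)"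
          using that unfolding C_def by blast+
        then show ?thesis
          using dist_triangle3[of x y "d (r W n)"] n by (simp add: power_one_over)
      qed
      then show "\<exists>n. \<forall>x\<in>C n W. \<forall>y\<in>C n W. dist x y < \<epsilon>" by blast
    qed (use ne in auto)
    have "y \<in> F k (l W)" for k using y[of k] unfolding C_def by blast
    with e show "e \<in> fst ` D" unfolding D
      by (intro image_eqI[of _ _ "(e, y)"]) (auto simp: mem_souslin_kernel_iff)
  qed
  also have "\<dots> \<in> sets (completion N)"
  proof (rule souslin_operation_measurable[OF assms(1)])
    show "R k w \<in> sets N" for k w using A by (simp add: R_def)
    show "R k w = R k w'" if "\<And>i. i < k \<Longrightarrow> w i = w' i" for k w w'
    proof -
      have l: "\<forall>i<j. l w i = l w' i" if "j \<le> k" for j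
        using \<open>\<And>i. i < k \<Longrightarrow> w i = w' i\<close> that by (simp add: l_def)
      have "F j (l w) = F j (l w')" if "j \<le> k" for j using local[OF l[OF that]] by blast
      moreover have "r w j = r w' j" if "j < k" for j
        using \<open>\<And>i. i < k \<Longrightarrow> w i = w' i\<close> that by (simp add: r_def)
      ultimately have "C k w = C k w'" unfolding C_def by simp
      then show ?thesis using local[OF l[OF order_refl]] unfolding R_def by simp
    qed
  qed
  finally show ?thesis .
qed

section \<open>Exponential averages\<close>

text \<open>This is the integral of \<open>exp (- r)\<close> over those \<open>r \<ge> 0\<close>
  with \<open>t + r \<in> S\<close>. The exponential weight turns a time shift into a factor, so
  that \<open>exp (- t)\<close> times the average is the tail mass of one fixed measure,
  \<open>exp_mass S\<close>.\<close>

definition exp_average :: "real set \<Rightarrow> real \<Rightarrow> real" where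
  "exp_average S t = measure (density lborel (exponential_density 1)) {r. t + r \<in> S}"

lemma sets_borel_translate:
  fixes S :: "real set"
  assumes "S \<in> sets borel"
  shows "{r. t + r \<in> S} \<in> sets borel"
proof -
  have "(\<lambda>r. t + r) -` S \<inter> space borel \<in> sets (borel :: real measure)"
    using assms by (intro measurable_sets[of _ borel borel]) auto
  then show ?thesis by (simp add: vimage_def)
qed

interpretation exp1: prob_space "density lborel (exponential_density 1)"
  by (rule prob_space_exponential_density) simp

lemma exp_average_UNIV: "exp_average UNIV t = 1"
  using exp1.prob_space by (simp add: exp_average_def)

lemma exp_average_Compl:
  assumes "S \<in> sets borel"
  shows "exp_average (- S) t = 1 - exp_average S t"
proof -
  have "{r. t + r \<in> - S} = space (density lborel (exponential_density 1)) - {r. t + r \<in> S}" by auto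
  then show ?thesis unfolding exp_average_def
    using sets_borel_translate[OF assms, of t] by (simp only: exp1.prob_compl sets_density sets_lborel)
qed

definition exp_mass :: "real set \<Rightarrow> real measure" where
  "exp_mass S = density lborel (\<lambda>r. ennreal (exp (- r)) * indicator S r)"

lemma sets_exp_mass [simp]: "sets (exp_mass S) = sets borel"
  by (simp add: exp_mass_def)

lemma emeasure_exp_mass:
  assumes [measurable]: "S \<in> sets borel"
  shows "emeasure (exp_mass S) {t<..} = ennreal (exp (- t) * exp_average S t)"
proof -
  have "{r. t + r \<in> S} \<in> sets borel" by (rule sets_borel_translate) fact
  then have "ennreal (exp_average S t) =
      (\<integral>\<^sup>+ r. ennreal (exponential_density 1 r) * indicator {r. t + r \<in> S} r \<partial>lborel)"
    unfolding exp_average_def by (subst exp1.emeasure_eq_measure[symmetric]) (simp add: emeasure_density)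
  also have "\<dots> = (\<integral>\<^sup>+ r. ennreal (exponential_density 1 r) * indicator S (t + 1 * r) \<partial>lborel)"
    by (intro nn_integral_cong) (auto simp: indicator_def)
  also have "\<dots> = (\<integral>\<^sup>+ r. ennreal (exponential_density 1 (r - t)) * indicator S r \<partial>lborel)"
    by (subst nn_integral_real_affine[of _ 1 t]) auto
  finally have *: "ennreal (exp_average S t) = \<dots>" .
  have "emeasure (exp_mass S) {t<..} = (\<integral>\<^sup>+ r. ennreal (exp (- r)) * indicator S r * indicator {t<..} r \<partial>lborel)"
    by (simp add: exp_mass_def emeasure_density)
  also have "\<dots> = (\<integral>\<^sup>+ r. ennreal (exp (- t)) * (ennreal (exponential_density 1 (r - t)) * indicator S r) \<partial>lborel)"
  proof (rule nn_integral_cong_AE)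
    \<comment> \<open>At \<open>r = t\<close> the exponential density is 1, while the open half-line
      omits the point.\<close>
    have "AE r in lborel. r \<noteq> t" by (rule AE_lborel_singleton)
    then show "AE r in lborel. ennreal (exp (- r)) * indicator S r * indicator {t<..} r =
        ennreal (exp (- t)) * (ennreal (exponential_density 1 (r - t)) * indicator S r)"
      by eventually_elim
        (auto simp: exponential_density_def indicator_def ennreal_mult[symmetric] exp_add[symmetric])
  qed
  also have "\<dots> = ennreal (exp (- t)) * ennreal (exp_average S t)"
    unfolding * by (rule nn_integral_cmult) measurable
  also have "\<dots> = ennreal (exp (- t) * exp_average S t)"
    by (simp add: ennreal_mult exp_average_def)
  finally show ?thesis .
qed

text \<open>The tail mass \<open>J\<close> is decreasing, and it loses over \<open>{a<..b}\<close>
  at most what \<open>exp (- t)\<close> loses there, whatever \<open>S\<close> is.\<close>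

lemma continuous_on_exp_average:
  assumes S: "S \<in> sets borel"
  shows "continuous_on UNIV (exp_average S)"
proof -
  define J where "J t = exp (- t) * exp_average S t" for t
  have J_nonneg: "0 \<le> J t" for t by (simp add: J_def exp_average_def)
  have diff: "J a - J b \<le> exp (- a) - exp (- b) \<and> J b \<le> J a" if "a \<le> b" for a b
  proof -
    have split: "emeasure (exp_mass T) {a<..} = emeasure (exp_mass T) {b<..} + emeasure (exp_mass T) {a<..b}" for T
      using that by (subst plus_emeasure) (auto intro!: arg_cong[of _ _ "emeasure _"])
    have "emeasure (exp_mass S) {a<..b} \<le> emeasure (exp_mass UNIV) {a<..b}"
      unfolding exp_mass_def using S
      by (simp add: emeasure_density) (intro nn_integral_mono, simp add: indicator_def)
    moreover have U: "emeasure (exp_mass UNIV) {t<..} = ennreal (exp (- t))" for t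
      by (simp add: emeasure_exp_mass exp_average_UNIV)
    have "emeasure (exp_mass UNIV) {a<..b} = ennreal (exp (- a) - exp (- b))"
    proof -
      have "emeasure (exp_mass UNIV) {a<..b} = emeasure (exp_mass UNIV) {a<..} - emeasure (exp_mass UNIV) {b<..}"
        unfolding split[of UNIV] by (simp add: U)
      then show ?thesis using that by (simp add: U ennreal_minus)
    qed
    moreover have "ennreal (J a) = ennreal (J b) + emeasure (exp_mass S) {a<..b}"
      using split[of S] S by (simp add: emeasure_exp_mass J_def)
    ultimately have le: "ennreal (J a) \<le> ennreal (J b) + ennreal (exp (- a) - exp (- b))"
      and ge: "ennreal (J b) \<le> ennreal (J a)"
      by (simp_all add: add_left_mono)
    have "ennreal (J b) + ennreal (exp (- a) - exp (- b)) = ennreal (J b + (exp (- a) - exp (- b)))"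
      using J_nonneg that by (intro ennreal_plus[symmetric]) auto
    with le have "ennreal (J a) \<le> ennreal (J b + (exp (- a) - exp (- b)))" by (simp only:)
    then have "J a \<le> J b + (exp (- a) - exp (- b))"
      by (rule ennreal_le_iff[THEN iffD1, rotated]) (use J_nonneg[of b] that in simp)
    with ge J_nonneg show ?thesis by (simp add: ennreal_le_iff)
  qed
  have bound: "\<bar>J s - J t\<bar> \<le> \<bar>exp (- s) - exp (- t)\<bar>" for s t
    using diff[of s t] diff[of t s] by (cases "s \<le> t") auto
  have "continuous_on UNIV J"
    unfolding continuous_on_def
  proof
    fix t :: real
    have "isCont (\<lambda>s. exp (- s)) t" by (intro continuous_intros)
    then have "((\<lambda>s. exp (- s) - exp (- t)) \<longlongrightarrow> 0) (at t)"
      unfolding isCont_def by (rule LIM_zero)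
    then have "((\<lambda>s. \<bar>exp (- s) - exp (- t)\<bar>) \<longlongrightarrow> 0) (at t)" by (rule tendsto_rabs_zero)
    then have "((\<lambda>s. \<bar>J s - J t\<bar>) \<longlongrightarrow> 0) (at t)"
      by (rule tendsto_sandwich[OF _ _ tendsto_const, rotated 2]) (use bound in auto)
    then show "(J \<longlongrightarrow> J t) (at t)"
      by (simp add: tendsto_rabs_zero_iff LIM_zero_iff)
  qed
  then have "continuous_on UNIV (\<lambda>t. exp t * J t)" by (intro continuous_intros)
  also have "(\<lambda>t. exp t * J t) = exp_average S"
    by (simp add: J_def fun_eq_iff mult.assoc[symmetric] exp_add[symmetric])
  finally show ?thesis .
qed

text \<open>If the average is constantly \<open>c\<close>, the tails of \<open>exp_mass S\<close>
  are \<open>c\<close> times those of \<open>exp_mass UNIV\<close>. Tails determine the measures and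
  these determine the densities, so the indicator of \<open>S\<close> equals \<open>c\<close> almost
  everywhere, which leaves only the two alternatives.\<close>

lemma exp_average_const_imp_AE:
  assumes S [measurable]: "S \<in> sets borel" and const: "\<And>t. exp_average S t = c"
  shows "(AE r in lborel. r \<in> S) \<or> (AE r in lborel. r \<notin> S)"
proof -
  have c: "0 \<le> c" using const[of 0, symmetric] by (simp add: exp_average_def)
  let ?N = "density lborel (\<lambda>r. ennreal c * ennreal (exp (- r)))"
  have "exp_mass S = ?N"
  proof (rule measure_eqI_lessThan)
    show "emeasure (exp_mass S) {t<..} = emeasure ?N {t<..}" for t
    proof -
      have "emeasure ?N {t<..} = (\<integral>\<^sup>+ r. ennreal c * (ennreal (exp (- r)) * indicator UNIV r * indicator {t<..} r) \<partial>lborel)"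
        by (simp add: emeasure_density mult.assoc)
      also have "\<dots> = ennreal c * emeasure (exp_mass UNIV) {t<..}"
        unfolding exp_mass_def by (subst nn_integral_cmult) (auto simp: emeasure_density)
      also have "\<dots> = emeasure (exp_mass S) {t<..}"
        using c S by (simp add: emeasure_exp_mass exp_average_UNIV const ennreal_mult' mult.commute)
      finally show ?thesis by simp
    qed
    show "emeasure (exp_mass S) {t<..} < \<infinity>" for t by (simp add: emeasure_exp_mass S)
  qed simp_all
  then have "AE r in lborel. ennreal (exp (- r)) * indicator S r = ennreal c * ennreal (exp (- r))"
    unfolding exp_mass_def by (intro sigma_finite_measure.density_unique[OF sigma_finite_lborel]) measurable
  then have AE: "AE r in lborel. indicator S r = c"
  proof eventually_elim
    case (elim r)
    then have "ennreal (exp (- r) * indicator S r) = ennreal (exp (- r) * c)"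
      using c by (simp add: ennreal_mult' ennreal_indicator mult.commute)
    then have "exp (- r) * indicator S r = exp (- r) * c" using c by (subst (asm) ennreal_inj) auto
    then show ?case by simp
  qed
  show ?thesis
  proof (cases "c = 1")
    case True
    from AE have "AE r in lborel. r \<in> S"
      by eventually_elim (use True in \<open>auto simp: indicator_def split: if_splits\<close>)
    then show ?thesis ..
  next
    case False
    from AE have "AE r in lborel. r \<notin> S"
      by eventually_elim (use False in \<open>auto simp: indicator_def split: if_splits\<close>)
    then show ?thesis ..
  qed
qed

section \<open>Maps into the extended space\<close>

text \<open>The sets are the images of a countable base of the state space; \<open>None\<close> is
  the one point in none of them. Equality of values thus becomes countably many open conditions,
  which serves both measurability and the countable determination of the flow.\<close>

lemma ex_separating_open_sequence:
  "\<exists>B :: nat \<Rightarrow> 'a::{second_countable_topology, t2_space} option set.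
     (\<forall>n. open (B n)) \<and> (\<forall>x y. (\<forall>n. x \<in> B n \<longleftrightarrow> y \<in> B n) \<longrightarrow> x = y)"
proof -
  obtain \<B> :: "'a set set" where \<B>: "countable \<B>" "topological_basis \<B>"
    using ex_countable_basis by blast
  define C where "C = insert {} \<B>"
  have C: "countable C" "C \<noteq> {}" using \<B>(1) by (auto simp: C_def)
  define B where "B n = Some ` from_nat_into C n" for n
  have op: "open U" if "U \<in> C" for U
    using that \<B>(2) by (auto simp: C_def dest: topological_basis_open)
  have "open (B n)" for n
    unfolding B_def open_Some_image_iff by (rule op[OF from_nat_into[OF C(2)]])
  moreover have sep: "\<exists>n. a \<in> B n \<and> y \<notin> B n" if "a \<noteq> y" "a = Some a'" for a y a'
  proof -
    have "\<exists>U. open U \<and> a' \<in> U \<and> y \<notin> Some ` U"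
    proof (cases y)
      case None
      then show ?thesis by (intro exI[of _ UNIV]) auto
    next
      case (Some b)
      with that obtain U where "open U" "a' \<in> U" "b \<notin> U" using separation_t1[of a' b] by auto
      with Some show ?thesis by auto
    qed
    then obtain U where U: "open U" "a' \<in> U" "y \<notin> Some ` U" by blast
    then obtain V where "V \<in> \<B>" "a' \<in> V" "V \<subseteq> U"
      using \<B>(2) by (meson topological_basisE)
    moreover then obtain n where "V = from_nat_into C n"
      using from_nat_into_surj[OF C(1), of V] by (auto simp: C_def)
    ultimately have "a \<in> B n" "y \<notin> B n" using U that(2) by (auto simp: B_def)
    then show ?thesis by blast
  qed
  have "x = y" if "\<forall>n. x \<in> B n \<longleftrightarrow> y \<in> B n" for x y
  proof (rule ccontr)
    assume "x \<noteq> y"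
    then consider a where "x = Some a" | b where "y = Some b" by (cases x; cases y) auto
    then show False
    proof cases
      case 1
      with sep[OF \<open>x \<noteq> y\<close> 1] that show False by blast
    next
      case 2
      with sep[OF \<open>x \<noteq> y\<close>[symmetric] 2] that show False by blast
    qed
  qed
  ultimately show ?thesis by blast
qed

lemma measurable_option_neq:
  fixes f g :: "'n \<Rightarrow> 'a::{second_countable_topology, t2_space} option"
  assumes f: "f \<in> borel_measurable N" and g: "g \<in> borel_measurable N"
  shows "{z \<in> space N. f z \<noteq> g z} \<in> sets N"
proof -
  obtain B :: "nat \<Rightarrow> 'a option set" where B: "\<And>n. open (B n)"
    "\<And>x y. (\<forall>n. x \<in> B n \<longleftrightarrow> y \<in> B n) \<Longrightarrow> x = y"
    using ex_separating_open_sequence by blast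
  have "{z \<in> space N. f z \<noteq> g z} =
      (\<Union>n. ((f -` B n \<inter> space N) - (g -` B n \<inter> space N)) \<union> ((g -` B n \<inter> space N) - (f -` B n \<inter> space N)))"
  proof -
    have "f z \<noteq> g z \<longleftrightarrow> (\<exists>n. (f z \<in> B n) \<noteq> (g z \<in> B n))" for z
      using B(2)[of "f z" "g z"] by auto
    then show ?thesis by auto
  qed
  also have "\<dots> \<in> sets N"
    using measurable_sets[OF f] measurable_sets[OF g] B(1)
    by (intro sets.countable_UN) (auto intro!: sets.Un sets.Diff)
  finally show ?thesis .
qed

lemma measurable_Some [measurable]: "Some \<in> borel_measurable borel"
  by (intro borel_measurable_continuous_onI)
    (auto simp: continuous_on_open_vimage open_option_def)

text \<open>Nonempty open intervals have positive Lebesgue measure. All later choices of a time at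
  which an almost-everywhere statement holds go through this.\<close>

lemma AE_lborel_ex_between:
  fixes a b :: real
  assumes "AE r in lborel. P r" "a < b"
  shows "\<exists>r. a < r \<and> r < b \<and> P r"
proof (rule ccontr)
  assume no: "\<not> ?thesis"
  from assms(1) have "AE r in lborel. r \<notin> {a<..<b}"
    by eventually_elim (use no in auto)
  then have "{a<..<b} \<in> null_sets lborel" by (subst AE_iff_null_sets) auto
  with \<open>a < b\<close> show False by (auto simp: null_sets_def)
qed

lemma AE_lborel_translate:
  fixes c :: real
  assumes "AE r in lborel. P r"
  shows "AE r in lborel. P (c + r)"
proof -
  have "AE r in distr lborel borel ((+) c). P r"
    using assms by (subst lborel_distr_plus)
  then show ?thesis by (rule AE_distrD[rotated]) simp
qed

lemma eq_if_agree_near: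
  fixes f g :: "'r::t2_space \<Rightarrow> 'b::t2_space"
  assumes f: "(f \<longlongrightarrow> f a) (at a within S)" and g: "(g \<longlongrightarrow> g a) (at a within S)"
    and "a islimpt {r \<in> S. f r = g r}"
  shows "f a = g a"
proof -
  let ?T = "{r \<in> S. f r = g r}"
  have "(f \<longlongrightarrow> f a) (at a within ?T)" by (rule tendsto_within_subset[OF f]) auto
  moreover have "(f \<longlongrightarrow> g a) (at a within ?T)"
  proof (rule Lim_transform_eventually)
    show "(g \<longlongrightarrow> g a) (at a within ?T)" by (rule tendsto_within_subset[OF g]) auto
    show "\<forall>\<^sub>F r in at a within ?T. g r = f r" by (auto simp: eventually_at_filter)
  qed
  ultimately show ?thesis
    using assms(3) by (intro tendsto_unique) (auto simp: trivial_limit_within)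
qed

lemma continuous_at_right_shift:
  fixes f :: "real \<Rightarrow> 'b::topological_space"
  assumes "continuous (at_right (a - v)) f"
  shows "continuous (at_right a) (\<lambda>s. f (s - v))"
proof -
  have "filterlim f (nhds (f (a - v))) (filtermap (\<lambda>s. s - v) (at_right a))"
    using assms by (simp only: continuous_within filtermap_at_right_shift)
  then show ?thesis by (simp only: continuous_within filterlim_filtermap)
qed

lemma continuous_at_right_cong:
  fixes f g :: "real \<Rightarrow> 'b::topological_space"
  assumes "continuous (at_right a) f" "a < b" "\<And>s. a \<le> s \<Longrightarrow> s < b \<Longrightarrow> g s = f s"
  shows "continuous (at_right a) g"
proof -
  have "\<forall>\<^sub>F s in at_right a. f s = g s"
    unfolding eventually_at_right_field using assms by (intro exI[of _ b]) auto
  with assms(1) have "(g \<longlongrightarrow> f a) (at_right a)"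
    unfolding continuous_within by (rule Lim_transform_eventually)
  with assms show ?thesis by (simp add: continuous_within)
qed

text \<open>Taking for \<open>K\<close> the counting measure on a single point turns this into a condition on one path.\<close>

definition inherits ::
  "'w measure \<Rightarrow> ('a::t2_space, 'w) two_param_map \<Rightarrow> 'v measure \<Rightarrow> ('a, 'v) two_param_map \<Rightarrow> bool" where
  "inherits M \<phi> K \<psi> \<longleftrightarrow>
     absorbing K \<psi> \<and> flow_property K \<psi> \<and> right_continuous_start K \<psi> \<and> right_continuous_end K \<psi> \<and>
     (identity_on_diagonal M \<phi> \<longrightarrow> identity_on_diagonal K \<psi>) \<and>
     (stays_in_X M \<phi> \<longrightarrow> stays_in_X K \<psi>) \<and>
     (continuous_start M \<phi> \<longrightarrow> continuous_start K \<psi>) \<and>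
     (continuous_end M \<phi> \<longrightarrow> continuous_end K \<psi>) \<and>
     (continuous_start_end M \<phi> \<longrightarrow> continuous_start_end K \<psi>) \<and>
     (\<forall>x0\<in>range Some. continuous_state_at M x0 \<phi> \<longrightarrow> continuous_state_at K x0 \<psi>)"

section \<open>Path properties on the three kinds of orbits\<close>

lemma inherits_pointwise:
  assumes "\<And>\<omega>. \<omega> \<in> space K \<Longrightarrow> inherits M \<phi> (count_space {\<omega>}) \<psi>"
  shows "inherits M \<phi> K \<psi>"
  using assms unfolding inherits_def
  apply (intro conjI impI ballI)
  subgoal by (auto simp: absorbing_def)
  subgoal by (auto simp: flow_property_def)
  subgoal by (auto simp: right_continuous_start_def)
  subgoal by (auto simp: right_continuous_end_def)
  subgoal by (auto simp: identity_on_diagonal_def)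
  subgoal unfolding stays_in_X_def[of "count_space _"] stays_in_X_def[of K] by (simp add: split_beta)
  subgoal by (auto simp: continuous_start_def)
  subgoal by (auto simp: continuous_end_def)
  subgoal by (auto simp: continuous_start_end_def)
  subgoal for x0 unfolding continuous_state_at_def[of "count_space _"] continuous_state_at_def[of K] by (auto simp: split_beta)
  done

lemma continuous_start_end_imp_start:
  "continuous_start M \<phi>" if "continuous_start_end M \<phi>"
  unfolding continuous_start_def
proof (intro allI impI ballI)
  fix t :: real and x \<omega> assume "0 \<le> t" "\<omega> \<in> space M"
  then have "continuous_on Delta (\<lambda>(s, t). \<phi> s t x \<omega>)"
    using that by (auto simp: continuous_start_end_def)
  then have "continuous_on {0..t} (\<lambda>s. (\<lambda>(s, t). \<phi> s t x \<omega>) (s, t))"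
    by (rule continuous_on_compose2) (auto intro!: continuous_intros simp: Delta_def)
  then show "continuous_on {0..t} (\<lambda>s. \<phi> s t x \<omega>)" by simp
qed

text \<open>This serves the exceptional orbits: a flow that never moves has all the properties by
  itself, whatever \<open>\<phi>\<close> does.\<close>

lemma inherits_frozen:
  assumes "\<And>s t x. 0 \<le> s \<Longrightarrow> s \<le> t \<Longrightarrow> \<psi> s t x \<omega> = x"
  shows "inherits M \<phi> (count_space {\<omega>}) \<psi>"
  unfolding inherits_def
proof (intro conjI impI ballI)
  show "right_continuous_start (count_space {\<omega>}) \<psi>"
    unfolding right_continuous_start_def
  proof (intro allI impI ballI)
    fix t s0 :: real and x \<omega>' assume *: "\<omega>' \<in> space (count_space {\<omega>})" "s0 \<in> {0..<t}"
    show "continuous (at_right s0) (\<lambda>s. \<psi> s t x \<omega>')"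
      by (rule continuous_at_right_cong[where a = s0 and b = t and f = "\<lambda>_. x"]) (use * in \<open>auto simp: assms\<close>)
  qed
  show "right_continuous_end (count_space {\<omega>}) \<psi>"
    unfolding right_continuous_end_def
  proof (intro allI impI ballI)
    fix s t0 :: real and x \<omega>' assume *: "\<omega>' \<in> space (count_space {\<omega>})" "0 \<le> s" "t0 \<in> {s..}"
    show "continuous (at_right t0) (\<lambda>t. \<psi> s t x \<omega>')"
      by (rule continuous_at_right_cong[where a = t0 and b = "t0 + 1" and f = "\<lambda>_. x"]) (use * in \<open>auto simp: assms\<close>)
  qed
  show "continuous_start (count_space {\<omega>}) \<psi>"
    unfolding continuous_start_def
  proof (intro allI impI ballI)
    fix t :: real and x \<omega>' assume *: "0 \<le> t" "\<omega>' \<in> space (count_space {\<omega>})"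
    show "continuous_on {0..t} (\<lambda>s. \<psi> s t x \<omega>')"
      by (rule continuous_on_eq[OF continuous_on_const[of _ x]]) (use * in \<open>auto simp: assms\<close>)
  qed
  show "continuous_end (count_space {\<omega>}) \<psi>"
    unfolding continuous_end_def
  proof (intro allI impI ballI)
    fix s :: real and x \<omega>' assume *: "0 \<le> s" "\<omega>' \<in> space (count_space {\<omega>})"
    show "continuous_on {s..} (\<lambda>t. \<psi> s t x \<omega>')"
      by (rule continuous_on_eq[OF continuous_on_const[of _ x]]) (use * in \<open>auto simp: assms\<close>)
  qed
  show "continuous_start_end (count_space {\<omega>}) \<psi>"
    unfolding continuous_start_end_def
  proof (intro allI ballI)
    fix x \<omega>' assume *: "\<omega>' \<in> space (count_space {\<omega>})"
    show "continuous_on Delta (\<lambda>(s, t). \<psi> s t x \<omega>')"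
      by (rule continuous_on_eq[OF continuous_on_const[of _ x]]) (use * in \<open>auto simp: Delta_def assms\<close>)
  qed
qed (auto simp: absorbing_def flow_property_def identity_on_diagonal_def stays_in_X_def
    continuous_state_at_def Delta_def assms)

text \<open>Each start time \<open>s\<close> has its own base point \<open>u s\<close>, and
  properties that concern a single start time come from \<open>\<phi>\<close> at that base.
  Properties that relate several start times use either the constancy of \<open>u\<close> to the
  right of \<open>s\<close> or the agreement of two bases at almost all times.\<close>

lemma inherits_moving_base:
  fixes \<phi> :: "('a::t2_space, 'w) two_param_map" and u :: "real \<Rightarrow> real" and W :: "real \<Rightarrow> 'w"
  assumes \<phi>: "absorbing M \<phi>" "flow_property M \<phi>" "right_continuous_start M \<phi>" "right_continuous_end M \<phi>"
    and W: "\<And>v. W v \<in> space M"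
    and u: "\<And>s. u s < s"
    and const: "\<And>s. \<exists>b>s. \<forall>r\<in>{s..<b}. u r = u s"
    and agree: "\<And>s s'. AE r in lborel. max (u s) (u s') < r \<longrightarrow>
      (\<forall>t\<ge>r. \<forall>x. \<phi> (r - u s) (t - u s) x (W (u s)) = \<phi> (r - u s') (t - u s') x (W (u s')))"
    and \<psi>: "\<And>s t x. 0 \<le> s \<Longrightarrow> s \<le> t \<Longrightarrow> \<psi> s t x \<omega> = \<phi> (s - u s) (t - u s) x (W (u s))"
  shows "inherits M \<phi> (count_space {\<omega>}) \<psi>"
proof -
  have u': "0 \<le> s - u s" "s \<le> t \<Longrightarrow> s - u s \<le> t - u s" for s t using u[of s] by auto
  have flow: "\<phi> r t x (W v) = \<phi> s t (\<phi> r s x (W v)) (W v)" if "0 \<le> r" "r \<le> s" "s \<le> t" for r s t x v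
    using \<phi>(2) W that unfolding flow_property_def by blast
  \<comment> \<open>If \<open>\<phi>\<close> is continuous in the start time, the agreement at
    almost all times before \<open>s\<close> passes to \<open>s\<close> itself. All start times may
    then share the base \<open>u 0\<close>, and two-sided continuity is read off there.\<close>
  have base: "\<psi> s t x \<omega> = \<phi> (s - u 0) (t - u 0) x (W (u 0))"
    if cs: "continuous_start M \<phi>" and st: "0 \<le> s" "s \<le> t" for s t x
  proof -
    define m where "m = max (u 0) (u s)"
    have "m < s" using u[of 0] u[of s] st by (simp add: m_def)
    define f where "f r = \<phi> (r - u 0) (t - u 0) x (W (u 0))" for r
    define g where "g r = \<phi> (r - u s) (t - u s) x (W (u s))" for r
    have cont: "continuous_on {m..t} (\<lambda>r. \<phi> (r - v) (t - v) x (W v))" if "v \<le> m" for v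
    proof -
      have "continuous_on {0..t - v} (\<lambda>r. \<phi> r (t - v) x (W v))"
        using cs W that \<open>m < s\<close> st unfolding continuous_start_def by auto
      then show ?thesis
        by (rule continuous_on_compose2) (use that in \<open>auto intro!: continuous_intros\<close>)
    qed
    have s: "s \<in> {m..t}" using \<open>m < s\<close> st by auto
    have "s islimpt {r \<in> {m..t}. f r = g r}"
      unfolding islimpt_approachable
    proof (intro allI impI)
      fix e :: real assume "e > 0"
      define c where "c = max m (s - e)"
      have "c < s" using \<open>m < s\<close> \<open>e > 0\<close> by (simp add: c_def)
      from AE_lborel_ex_between[OF agree[of 0 s] this] obtain r where
        "c < r" "r < s" "m < r \<longrightarrow> (\<forall>t\<ge>r. \<forall>x. \<phi> (r - u 0) (t - u 0) x (W (u 0)) = \<phi> (r - u s) (t - u s) x (W (u s)))"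
        unfolding m_def by blast
      then show "\<exists>r\<in>{r \<in> {m..t}. f r = g r}. r \<noteq> s \<and> dist r s < e"
        using st by (intro bexI[of _ r]) (auto simp: f_def g_def c_def dist_real_def)
    qed
    moreover have "(f \<longlongrightarrow> f s) (at s within {m..t})" "(g \<longlongrightarrow> g s) (at s within {m..t})"
      using cont[of "u 0"] cont[of "u s"] s unfolding f_def g_def m_def continuous_on_def by auto
    ultimately have "f s = g s" using eq_if_agree_near by metis
    then show ?thesis using \<psi>[OF st] by (simp add: f_def g_def)
  qed
  show ?thesis
    unfolding inherits_def
  proof (intro conjI impI ballI)
    show "absorbing (count_space {\<omega>}) \<psi>"
      using \<phi>(1) W u' by (auto simp: absorbing_def \<psi>)
    show "flow_property (count_space {\<omega>}) \<psi>"
      unfolding flow_property_def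
    proof (intro allI ballI impI)
      fix x \<omega>' and s t r :: real assume "\<omega>' \<in> space (count_space {\<omega>})" and "0 \<le> s \<and> s \<le> t \<and> t \<le> r"
      then have st: "0 \<le> s" "s \<le> t" "t \<le> r" and [simp]: "\<omega>' = \<omega>" by auto
      show "\<psi> s r x \<omega>' = \<psi> t r (\<psi> s t x \<omega>') \<omega>'"
      proof (cases "s = t")
        \<comment> \<open>Both sides use the same base here, and there is no room for an
          intermediate time.\<close>
        case True
        with st u[of s] show ?thesis by (simp add: \<psi>) (rule flow; simp)
      next
        case False
        define v where "v = u s"
        define w where "w = u t"
        have "max s w < t" using False st u[of t] by (simp add: w_def)
        from AE_lborel_ex_between[OF agree[of s t] this] obtain q where q: "s < q" "w < q" "q < t"
          and "v < q \<longrightarrow> (\<forall>t\<ge>q. \<forall>x. \<phi> (q - v) (t - v) x (W v) = \<phi> (q - w) (t - w) x (W w))"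
          unfolding v_def w_def by auto
        then have q': "\<phi> (q - v) (t' - v) x (W v) = \<phi> (q - w) (t' - w) x (W w)" if "q \<le> t'" for t' x
          using u[of s] that by (auto simp: v_def)
        have vs: "v < s" using u by (simp add: v_def)
        \<comment> \<open>From \<open>q\<close> onwards the evolution is switched to base
          \<open>w\<close> and cut at \<open>t\<close>; its piece from \<open>q\<close> to
          \<open>t\<close> is then switched back to base \<open>v\<close>.\<close>
        define x' where "x' = \<phi> (s - v) (q - v) x (W v)"
        have "\<phi> (s - v) (r - v) x (W v) = \<phi> (q - v) (r - v) x' (W v)"
          unfolding x'_def using vs q st by (intro flow) auto
        also have "\<dots> = \<phi> (q - w) (r - w) x' (W w)" using q st by (intro q') auto
        also have "\<dots> = \<phi> (t - w) (r - w) (\<phi> (q - w) (t - w) x' (W w)) (W w)"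
          using q st by (intro flow) auto
        also have "\<phi> (q - w) (t - w) x' (W w) = \<phi> (q - v) (t - v) x' (W v)"
          using q by (intro q'[symmetric]) auto
        also have "\<dots> = \<phi> (s - v) (t - v) x (W v)"
          unfolding x'_def using vs q st by (intro flow[symmetric]) auto
        finally show ?thesis using st by (simp add: \<psi> v_def w_def)
      qed
    qed
    show "right_continuous_start (count_space {\<omega>}) \<psi>"
      unfolding right_continuous_start_def
    proof (intro allI impI ballI)
      fix t s0 :: real and x \<omega>'
      assume *: "\<omega>' \<in> space (count_space {\<omega>})" "s0 \<in> {0..<t}" "x \<in> range Some" "\<psi> s0 t x \<omega>' \<in> range Some"
      from const[of s0] obtain b where b0: "b > s0" "\<forall>r\<in>{s0..<b}. u r = u s0" by (elim exE conjE bexE)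
      have b: "u r = u s0" if "s0 \<le> r" "r < b" for r by (rule bspec[OF b0(2)]) (use that in simp)
      have "\<phi> (s0 - u s0) (t - u s0) x (W (u s0)) \<in> range Some" using * \<psi>[of s0 t] by simp
      moreover have "0 < t - u s0" "s0 - u s0 \<in> {0..<t - u s0}" using * u[of s0] by auto
      ultimately have "continuous (at_right (s0 - u s0)) (\<lambda>s. \<phi> s (t - u s0) x (W (u s0)))"
        using \<phi>(3) W[of "u s0"] *(3) unfolding right_continuous_start_def by blast
      from continuous_at_right_shift[OF this]
      have cont: "continuous (at_right s0) (\<lambda>s. \<phi> (s - u s0) (t - u s0) x (W (u s0)))" .
      \<comment> \<open>\<open>b\<close> bounds the constancy of \<open>u\<close>, and
        \<open>t\<close> keeps the start time before the end time.\<close>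
      have eq: "\<psi> r t x \<omega>' = \<phi> (r - u s0) (t - u s0) x (W (u s0))"
        if "s0 \<le> r" "r < min b t" for r
      proof -
        have "\<psi> r t x \<omega> = \<phi> (r - u r) (t - u r) x (W (u r))"
          by (rule \<psi>) (use that * in auto)
        then show ?thesis using b[of r] that *(1) by simp
      qed
      show "continuous (at_right s0) (\<lambda>s. \<psi> s t x \<omega>')"
        using cont
        by (rule continuous_at_right_cong[where b = "min b t"]) (use * b0(1) eq in auto)
    qed
    show "right_continuous_end (count_space {\<omega>}) \<psi>"
      unfolding right_continuous_end_def
    proof (intro allI impI ballI)
      fix s t0 :: real and x \<omega>' assume *: "\<omega>' \<in> space (count_space {\<omega>})" "0 \<le> s" "t0 \<in> {s..}"
      have "continuous (at_right (t0 - u s)) (\<lambda>t. \<phi> (s - u s) t x (W (u s)))"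
        using \<phi>(4) W * u'(1)[of s] unfolding right_continuous_end_def by auto
      from continuous_at_right_shift[OF this]
      show "continuous (at_right t0) (\<lambda>t. \<psi> s t x \<omega>')"
        by (rule continuous_at_right_cong[where b = "t0 + 1"]) (use * in \<open>auto simp: \<psi>\<close>)
    qed
    show "identity_on_diagonal (count_space {\<omega>}) \<psi>" if "identity_on_diagonal M \<phi>"
      using that W u' by (auto simp: identity_on_diagonal_def \<psi>)
    show "stays_in_X (count_space {\<omega>}) \<psi>" if "stays_in_X M \<phi>"
    proof -
      have "\<phi> s t x \<omega> \<in> range Some" if "0 \<le> s" "s \<le> t" "x \<in> range Some" "\<omega> \<in> space M" for s t x \<omega>
        using \<open>stays_in_X M \<phi>\<close> that unfolding stays_in_X_def Delta_def by blast
      then show ?thesis using W u' unfolding stays_in_X_def Delta_def by (auto simp: \<psi>)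
    qed
    show "continuous_end (count_space {\<omega>}) \<psi>" if ce: "continuous_end M \<phi>"
      unfolding continuous_end_def
    proof (intro allI impI ballI)
      fix s :: real and x \<omega>' assume *: "0 \<le> s" "\<omega>' \<in> space (count_space {\<omega>})"
      have "continuous_on {s - u s..} (\<lambda>t. \<phi> (s - u s) t x (W (u s)))"
        using ce W u'(1)[of s] unfolding continuous_end_def by auto
      then have "continuous_on {s..} (\<lambda>t. \<phi> (s - u s) (t - u s) x (W (u s)))"
        by (rule continuous_on_compose2) (auto intro!: continuous_intros)
      then show "continuous_on {s..} (\<lambda>t. \<psi> s t x \<omega>')"
        by (rule continuous_on_eq) (use * in \<open>auto simp: \<psi>\<close>)
    qed
    show "continuous_start (count_space {\<omega>}) \<psi>" if cs: "continuous_start M \<phi>"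
      unfolding continuous_start_def
    proof (intro allI impI ballI)
      fix t :: real and x \<omega>' assume *: "0 \<le> t" "\<omega>' \<in> space (count_space {\<omega>})"
      have "continuous_on {0..t - u 0} (\<lambda>s. \<phi> s (t - u 0) x (W (u 0)))"
        using cs W * u[of 0] unfolding continuous_start_def by auto
      then have "continuous_on {0..t} (\<lambda>s. \<phi> (s - u 0) (t - u 0) x (W (u 0)))"
        by (rule continuous_on_compose2) (use u[of 0] in \<open>auto intro!: continuous_intros\<close>)
      then show "continuous_on {0..t} (\<lambda>s. \<psi> s t x \<omega>')"
        by (rule continuous_on_eq) (use * base[OF cs] in auto)
    qed
    show "continuous_start_end (count_space {\<omega>}) \<psi>" if cse: "continuous_start_end M \<phi>"
      unfolding continuous_start_end_def
    proof (intro allI ballI)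
      fix x \<omega>' assume *: "\<omega>' \<in> space (count_space {\<omega>})"
      have "continuous_on Delta (\<lambda>(s, t). \<phi> s t x (W (u 0)))"
        using cse W unfolding continuous_start_end_def by auto
      then have "continuous_on Delta (\<lambda>p. (\<lambda>(s, t). \<phi> s t x (W (u 0))) (fst p - u 0, snd p - u 0))"
        by (rule continuous_on_compose2) (use u[of 0] in \<open>auto intro!: continuous_intros simp: Delta_def\<close>)
      then show "continuous_on Delta (\<lambda>(s, t). \<psi> s t x \<omega>')"
        by (rule continuous_on_eq)
          (use * base[OF continuous_start_end_imp_start[OF cse]] in \<open>auto simp: Delta_def\<close>)
    qed
    show "continuous_state_at (count_space {\<omega>}) x0 \<psi>" if "continuous_state_at M x0 \<phi>" for x0
    proof -
      have "isCont (\<lambda>x. \<phi> s t x \<omega>) x0" if "0 \<le> s" "s \<le> t" "\<omega> \<in> space M" for s t \<omega>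
        using \<open>continuous_state_at M x0 \<phi>\<close> that unfolding continuous_state_at_def Delta_def by blast
      then show ?thesis using W u' unfolding continuous_state_at_def Delta_def by (auto simp: \<psi>)
    qed
  qed
qed

text \<open>Each property involves only countably many start times at once, provided that continuity
  in the start time is tested along sequences. One shift \<open>\<sigma>\<close> moves all of them
  to times at which the flow of \<open>\<omega>0\<close> is given by \<open>\<kappa>\<close>, and
  there the property of \<open>\<phi>\<close> applies.\<close>

lemma inherits_stationary:
  fixes \<phi> :: "('a::t2_space, 'w) two_param_map" and \<kappa> :: "real \<Rightarrow> 'a option \<Rightarrow> 'a option"
  assumes \<phi>: "absorbing M \<phi>" "flow_property M \<phi>" "right_continuous_start M \<phi>" "right_continuous_end M \<phi>"
    and \<omega>0: "\<omega>0 \<in> space M"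
    and stat: "AE s in lborel. 0 \<le> s \<longrightarrow> (\<forall>t\<ge>0. \<forall>x. \<phi> s (s + t) x \<omega>0 = \<kappa> t x)"
    and \<psi>: "\<And>s t x. 0 \<le> s \<Longrightarrow> s \<le> t \<Longrightarrow> \<psi> s t x \<omega> = \<kappa> (t - s) x"
  shows "inherits M \<phi> (count_space {\<omega>}) \<psi>"
proof -
  have shift: "\<exists>\<sigma>\<ge>0. \<forall>i. \<forall>t\<ge>S i. \<forall>x. \<psi> (S i) t x \<omega> = \<phi> (S i + \<sigma>) (t + \<sigma>) x \<omega>0"
    if S: "\<And>i::nat. 0 \<le> S i" for S
  proof -
    have "AE \<sigma> in lborel. \<forall>i. 0 \<le> S i + \<sigma> \<longrightarrow> (\<forall>t\<ge>0. \<forall>x. \<phi> (S i + \<sigma>) (S i + \<sigma> + t) x \<omega>0 = \<kappa> t x)"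
      unfolding AE_all_countable by (intro allI AE_lborel_translate[OF stat])
    from AE_lborel_ex_between[OF this, of 0 1] obtain \<sigma> where "0 < \<sigma>"
      and *: "\<And>i t x. 0 \<le> S i + \<sigma> \<Longrightarrow> 0 \<le> t \<Longrightarrow> \<phi> (S i + \<sigma>) (S i + \<sigma> + t) x \<omega>0 = \<kappa> t x" by auto
    have "\<psi> (S i) t x \<omega> = \<phi> (S i + \<sigma>) (t + \<sigma>) x \<omega>0" if "S i \<le> t" for i t x
      using *[of i "t - S i" x] \<psi>[OF S that] S[of i] that \<open>0 < \<sigma>\<close> by (simp add: algebra_simps)
    then show ?thesis using \<open>0 < \<sigma>\<close> by (intro exI[of _ \<sigma>]) auto
  qed
  have shift1: "\<exists>\<sigma>\<ge>0. \<forall>t\<ge>s. \<forall>x. \<psi> s t x \<omega> = \<phi> (s + \<sigma>) (t + \<sigma>) x \<omega>0" if "0 \<le> s" for s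
    using shift[of "\<lambda>_. s"] that by simp
  \<comment> \<open>A limit point and the sequence tending to it must share one shift, so they are
    merged into a single sequence.\<close>
  have shift_seq: "\<exists>\<sigma>\<ge>0. (\<forall>t\<ge>a. \<forall>x. \<psi> a t x \<omega> = \<phi> (a + \<sigma>) (t + \<sigma>) x \<omega>0) \<and>
      (\<forall>i. \<forall>t\<ge>X i. \<forall>x. \<psi> (X i) t x \<omega> = \<phi> (X i + \<sigma>) (t + \<sigma>) x \<omega>0)"
    if "0 \<le> a" "\<And>i::nat. 0 \<le> X i" for a X
  proof -
    have "0 \<le> case_nat a X i" for i using that by (cases i) auto
    from shift[of "case_nat a X", OF this] obtain \<sigma> where \<sigma>: "\<sigma> \<ge> 0"
      "\<forall>i. \<forall>t\<ge>case_nat a X i. \<forall>x. \<psi> (case_nat a X i) t x \<omega> = \<phi> (case_nat a X i + \<sigma>) (t + \<sigma>) x \<omega>0"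
      by blast
    from \<sigma>(2)[rule_format, of 0] \<sigma>(2)[rule_format, of "Suc _"] \<sigma>(1) show ?thesis by auto
  qed
  show ?thesis
    unfolding inherits_def
  proof (intro conjI impI ballI)
    show "absorbing (count_space {\<omega>}) \<psi>"
      unfolding absorbing_def
    proof (intro allI ballI impI)
      fix s t :: real and \<omega>' assume *: "\<omega>' \<in> space (count_space {\<omega>})" "0 \<le> s \<and> s \<le> t"
      from shift1[of s] * obtain \<sigma> where "\<sigma> \<ge> 0" "\<psi> s t None \<omega> = \<phi> (s + \<sigma>) (t + \<sigma>) None \<omega>0" by blast
      then show "\<psi> s t None \<omega>' = None" using * \<phi>(1) \<omega>0 by (auto simp: absorbing_def)
    qed
    show "flow_property (count_space {\<omega>}) \<psi>"
      unfolding flow_property_def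
    proof (intro allI ballI impI)
      fix x \<omega>' and s t r :: real
      assume *: "\<omega>' \<in> space (count_space {\<omega>})" "0 \<le> s \<and> s \<le> t \<and> t \<le> r"
      from shift_seq[of s "\<lambda>_. t"] * obtain \<sigma> where \<sigma>: "\<sigma> \<ge> 0"
        "\<And>r x. r \<ge> s \<Longrightarrow> \<psi> s r x \<omega> = \<phi> (s + \<sigma>) (r + \<sigma>) x \<omega>0"
        "\<And>r x. r \<ge> t \<Longrightarrow> \<psi> t r x \<omega> = \<phi> (t + \<sigma>) (r + \<sigma>) x \<omega>0" by auto
      have "0 \<le> s + \<sigma> \<and> s + \<sigma> \<le> t + \<sigma> \<and> t + \<sigma> \<le> r + \<sigma>" using * \<sigma>(1) by simp
      then have "\<phi> (s + \<sigma>) (r + \<sigma>) x \<omega>0 = \<phi> (t + \<sigma>) (r + \<sigma>) (\<phi> (s + \<sigma>) (t + \<sigma>) x \<omega>0) \<omega>0"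
        using \<phi>(2) \<omega>0 unfolding flow_property_def by blast
      then show "\<psi> s r x \<omega>' = \<psi> t r (\<psi> s t x \<omega>') \<omega>'" using * by (simp add: \<sigma>)
    qed
    show "right_continuous_start (count_space {\<omega>}) \<psi>"
      unfolding right_continuous_start_def
    proof (intro allI impI ballI)
      fix t s0 :: real and x \<omega>'
      assume *: "\<omega>' \<in> space (count_space {\<omega>})" "s0 \<in> {0..<t}" "x \<in> range Some" "\<psi> s0 t x \<omega>' \<in> range Some"
      show "continuous (at_right s0) (\<lambda>s. \<psi> s t x \<omega>')"
        unfolding continuous_within tendsto_at_iff_sequentially comp_def
      proof (intro allI impI)
        fix X :: "nat \<Rightarrow> real" assume X: "\<forall>i. X i \<in> {s0<..} - {s0}" "X \<longlonglongrightarrow> s0"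
        have "0 \<le> s0" "\<And>i. 0 \<le> X i" using * X(1) by (auto intro: less_imp_le less_trans order.strict_trans1)
        from shift_seq[of s0 X, OF this] obtain \<sigma> where \<sigma>: "\<sigma> \<ge> 0"
          "\<And>r x. r \<ge> s0 \<Longrightarrow> \<psi> s0 r x \<omega> = \<phi> (s0 + \<sigma>) (r + \<sigma>) x \<omega>0"
          "\<And>i r x. r \<ge> X i \<Longrightarrow> \<psi> (X i) r x \<omega> = \<phi> (X i + \<sigma>) (r + \<sigma>) x \<omega>0" by auto
        have "0 < t + \<sigma>" "s0 + \<sigma> \<in> {0..<t + \<sigma>}" "\<phi> (s0 + \<sigma>) (t + \<sigma>) x \<omega>0 \<in> range Some"
          using * \<sigma>(1) \<sigma>(2)[of t x] by auto
        then have "continuous (at_right (s0 + \<sigma>)) (\<lambda>s. \<phi> s (t + \<sigma>) x \<omega>0)"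
          using \<phi>(3) \<omega>0 *(3) unfolding right_continuous_start_def by blast
        then have Y: "\<forall>Y. (\<forall>i. Y i \<in> {s0 + \<sigma><..} - {s0 + \<sigma>}) \<longrightarrow> Y \<longlonglongrightarrow> s0 + \<sigma> \<longrightarrow>
            (\<lambda>i. \<phi> (Y i) (t + \<sigma>) x \<omega>0) \<longlonglongrightarrow> \<phi> (s0 + \<sigma>) (t + \<sigma>) x \<omega>0"
          unfolding continuous_within tendsto_at_iff_sequentially comp_def .
        have "\<forall>i. X i + \<sigma> \<in> {s0 + \<sigma><..} - {s0 + \<sigma>}" using X(1) by auto
        moreover have "(\<lambda>i. X i + \<sigma>) \<longlonglongrightarrow> s0 + \<sigma>" using X(2) by (intro tendsto_intros)
        ultimately have "(\<lambda>i. \<phi> (X i + \<sigma>) (t + \<sigma>) x \<omega>0) \<longlonglongrightarrow> \<phi> (s0 + \<sigma>) (t + \<sigma>) x \<omega>0"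
          using Y[THEN spec, of "\<lambda>i. X i + \<sigma>"] by blast
        moreover have "\<forall>\<^sub>F i in sequentially. X i < t"
          using X(2) * by (auto dest: order_tendstoD(2))
        then have "\<forall>\<^sub>F i in sequentially. \<phi> (X i + \<sigma>) (t + \<sigma>) x \<omega>0 = \<psi> (X i) t x \<omega>'"
          by eventually_elim (use * \<sigma>(3) in auto)
        ultimately have "(\<lambda>i. \<psi> (X i) t x \<omega>') \<longlonglongrightarrow> \<phi> (s0 + \<sigma>) (t + \<sigma>) x \<omega>0"
          by (rule Lim_transform_eventually)
        then show "(\<lambda>i. \<psi> (X i) t x \<omega>') \<longlonglongrightarrow> \<psi> s0 t x \<omega>'" using * \<sigma>(2)[of t x] by simp
      qed
    qed
    show "right_continuous_end (count_space {\<omega>}) \<psi>"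
      unfolding right_continuous_end_def
    proof (intro allI impI ballI)
      fix s t0 :: real and x \<omega>' assume *: "0 \<le> s" "\<omega>' \<in> space (count_space {\<omega>})" "t0 \<in> {s..}"
      from shift1[of s] * obtain \<sigma> where \<sigma>: "\<sigma> \<ge> 0"
        "\<And>t x. t \<ge> s \<Longrightarrow> \<psi> s t x \<omega> = \<phi> (s + \<sigma>) (t + \<sigma>) x \<omega>0" by blast
      have "continuous (at_right (t0 - (- \<sigma>))) (\<lambda>t. \<phi> (s + \<sigma>) t x \<omega>0)"
        using \<phi>(4) \<omega>0 * \<sigma>(1) unfolding right_continuous_end_def by auto
      from continuous_at_right_shift[OF this]
      have cont: "continuous (at_right t0) (\<lambda>t. \<phi> (s + \<sigma>) (t + \<sigma>) x \<omega>0)" by simp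
      show "continuous (at_right t0) (\<lambda>t. \<psi> s t x \<omega>')"
        using cont by (rule continuous_at_right_cong[where b = "t0 + 1"]) (use * \<sigma>(2) in auto)
    qed
    show "identity_on_diagonal (count_space {\<omega>}) \<psi>" if id: "identity_on_diagonal M \<phi>"
      unfolding identity_on_diagonal_def
    proof (intro allI ballI impI)
      fix s :: real and x \<omega>' assume *: "0 \<le> s" "\<omega>' \<in> space (count_space {\<omega>})"
      from shift1[of s] * obtain \<sigma> where "\<sigma> \<ge> 0" "\<psi> s s x \<omega> = \<phi> (s + \<sigma>) (s + \<sigma>) x \<omega>0" by blast
      then show "\<psi> s s x \<omega>' = x" using * id \<omega>0 by (auto simp: identity_on_diagonal_def)
    qed
    show "stays_in_X (count_space {\<omega>}) \<psi>" if st: "stays_in_X M \<phi>"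
    proof -
      have "\<psi> s t x \<omega> \<in> range Some" if *: "0 \<le> s" "s \<le> t" "x \<in> range Some" for s t x
      proof -
        from shift1[of s] * obtain \<sigma> where \<sigma>: "\<sigma> \<ge> 0" "\<psi> s t x \<omega> = \<phi> (s + \<sigma>) (t + \<sigma>) x \<omega>0" by blast
        then have "(s + \<sigma>, t + \<sigma>) \<in> Delta" using * by (simp add: Delta_def)
        then show ?thesis using st * \<omega>0 \<sigma>(2) unfolding stays_in_X_def by auto
      qed
      then show ?thesis unfolding stays_in_X_def Delta_def by simp
    qed
    show "continuous_end (count_space {\<omega>}) \<psi>" if ce: "continuous_end M \<phi>"
      unfolding continuous_end_def
    proof (intro allI impI ballI)
      fix s :: real and x \<omega>' assume *: "0 \<le> s" "\<omega>' \<in> space (count_space {\<omega>})"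
      from shift1[of s] * obtain \<sigma> where \<sigma>: "\<sigma> \<ge> 0"
        "\<And>t x. t \<ge> s \<Longrightarrow> \<psi> s t x \<omega> = \<phi> (s + \<sigma>) (t + \<sigma>) x \<omega>0" by blast
      have "continuous_on {s + \<sigma>..} (\<lambda>t. \<phi> (s + \<sigma>) t x \<omega>0)"
        using ce \<omega>0 * \<sigma>(1) unfolding continuous_end_def by auto
      then have "continuous_on {s..} (\<lambda>t. \<phi> (s + \<sigma>) (t + \<sigma>) x \<omega>0)"
        by (rule continuous_on_compose2) (auto intro!: continuous_intros)
      then show "continuous_on {s..} (\<lambda>t. \<psi> s t x \<omega>')"
        by (rule continuous_on_eq) (use * \<sigma>(2) in auto)
    qed
    show "continuous_start (count_space {\<omega>}) \<psi>" if cs: "continuous_start M \<phi>"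
      unfolding continuous_start_def
    proof (intro allI impI ballI)
      fix t :: real and x \<omega>' assume *: "0 \<le> t" "\<omega>' \<in> space (count_space {\<omega>})"
      show "continuous_on {0..t} (\<lambda>s. \<psi> s t x \<omega>')"
      proof (rule continuous_on_sequentiallyI)
        fix X :: "nat \<Rightarrow> real" and a assume X: "\<forall>n. X n \<in> {0..t}" "a \<in> {0..t}" "X \<longlonglongrightarrow> a"
        then have "0 \<le> a" "\<And>i. 0 \<le> X i" by auto
        from shift_seq[of a X, OF this] obtain \<sigma> where \<sigma>: "\<sigma> \<ge> 0"
          "\<And>r x. r \<ge> a \<Longrightarrow> \<psi> a r x \<omega> = \<phi> (a + \<sigma>) (r + \<sigma>) x \<omega>0"
          "\<And>i r x. r \<ge> X i \<Longrightarrow> \<psi> (X i) r x \<omega> = \<phi> (X i + \<sigma>) (r + \<sigma>) x \<omega>0" by auto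
        have "continuous_on {0..t + \<sigma>} (\<lambda>s. \<phi> s (t + \<sigma>) x \<omega>0)"
          using cs \<omega>0 * \<sigma>(1) unfolding continuous_start_def by auto
        moreover have "(\<lambda>i. X i + \<sigma>) \<longlonglongrightarrow> a + \<sigma>" using X(3) by (intro tendsto_intros)
        ultimately have "(\<lambda>i. \<phi> (X i + \<sigma>) (t + \<sigma>) x \<omega>0) \<longlonglongrightarrow> \<phi> (a + \<sigma>) (t + \<sigma>) x \<omega>0"
          by (rule continuous_on_tendsto_compose) (use X \<sigma>(1) in auto)
        then show "(\<lambda>n. \<psi> (X n) t x \<omega>') \<longlonglongrightarrow> \<psi> a t x \<omega>'" using X * by (simp add: \<sigma>)
      qed
    qed
    show "continuous_start_end (count_space {\<omega>}) \<psi>" if cse: "continuous_start_end M \<phi>"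
      unfolding continuous_start_end_def
    proof (intro allI ballI)
      fix x \<omega>' assume *: "\<omega>' \<in> space (count_space {\<omega>})"
      show "continuous_on Delta (\<lambda>(s, t). \<psi> s t x \<omega>')"
      proof (rule continuous_on_sequentiallyI)
        fix X :: "nat \<Rightarrow> real \<times> real" and p assume X: "\<forall>n. X n \<in> Delta" "p \<in> Delta" "X \<longlonglongrightarrow> p"
        then have "0 \<le> fst p" "\<And>i. 0 \<le> fst (X i)" by (auto simp: Delta_def split_beta)
        from shift_seq[of "fst p" "\<lambda>i. fst (X i)", OF this] obtain \<sigma> where \<sigma>: "\<sigma> \<ge> 0"
          "\<And>r x. r \<ge> fst p \<Longrightarrow> \<psi> (fst p) r x \<omega> = \<phi> (fst p + \<sigma>) (r + \<sigma>) x \<omega>0"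
          "\<And>i r x. r \<ge> fst (X i) \<Longrightarrow> \<psi> (fst (X i)) r x \<omega> = \<phi> (fst (X i) + \<sigma>) (r + \<sigma>) x \<omega>0" by auto
        have "continuous_on Delta (\<lambda>(s, t). \<phi> s t x \<omega>0)"
          using cse \<omega>0 unfolding continuous_start_end_def by auto
        moreover have "(\<lambda>i. (fst (X i) + \<sigma>, snd (X i) + \<sigma>)) \<longlonglongrightarrow> (fst p + \<sigma>, snd p + \<sigma>)"
          using X(3) by (intro tendsto_intros)
        ultimately have "(\<lambda>i. (\<lambda>(s, t). \<phi> s t x \<omega>0) (fst (X i) + \<sigma>, snd (X i) + \<sigma>))
            \<longlonglongrightarrow> (\<lambda>(s, t). \<phi> s t x \<omega>0) (fst p + \<sigma>, snd p + \<sigma>)"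
          by (rule continuous_on_tendsto_compose) (use X \<sigma>(1) in \<open>auto simp: Delta_def split_beta\<close>)
        then show "(\<lambda>n. case X n of (s, t) \<Rightarrow> \<psi> s t x \<omega>') \<longlonglongrightarrow> (case p of (s, t) \<Rightarrow> \<psi> s t x \<omega>')"
          using X * by (simp add: \<sigma> Delta_def split_beta)
      qed
    qed
    show "continuous_state_at (count_space {\<omega>}) x0 \<psi>" if cx: "continuous_state_at M x0 \<phi>" for x0
    proof -
      have "isCont (\<lambda>x. \<psi> s t x \<omega>) x0" if *: "0 \<le> s" "s \<le> t" for s t
      proof -
        from shift1[of s] * obtain \<sigma> where \<sigma>: "\<sigma> \<ge> 0" "\<And>x. \<psi> s t x \<omega> = \<phi> (s + \<sigma>) (t + \<sigma>) x \<omega>0" by blast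
        then have "(s + \<sigma>, t + \<sigma>) \<in> Delta" using * by (simp add: Delta_def)
        then show ?thesis using cx \<omega>0 \<sigma>(2) unfolding continuous_state_at_def by auto
      qed
      then show ?thesis unfolding continuous_state_at_def Delta_def by simp
    qed
  qed
qed

section \<open>Orbits\<close>

lemma sets_Collect_AE_lborel:
  fixes P :: "'n \<Rightarrow> real \<Rightarrow> bool"
  assumes "{p \<in> space (N \<Otimes>\<^sub>M lborel). P (fst p) (snd p)} \<in> sets (N \<Otimes>\<^sub>M lborel)"
  shows "{z \<in> space N. AE s in lborel. P z s} \<in> sets N"
proof -
  define Q where "Q = space (N \<Otimes>\<^sub>M lborel) - {p \<in> space (N \<Otimes>\<^sub>M lborel). P (fst p) (snd p)}"
  have Q: "Q \<in> sets (N \<Otimes>\<^sub>M lborel)" unfolding Q_def using assms by blast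
  have "(AE s in lborel. P z s) \<longleftrightarrow> emeasure lborel (Pair z -` Q) = 0" if "z \<in> space N" for z
  proof -
    have "Pair z -` Q = {s \<in> space lborel. \<not> P z s}"
      using that by (auto simp: Q_def space_pair_measure)
    moreover have "Pair z -` Q \<in> sets lborel" using Q by (rule sets_Pair1)
    ultimately show ?thesis by (simp add: AE_iff_measurable[OF _ refl])
  qed
  then have "{z \<in> space N. AE s in lborel. P z s} = {z \<in> space N. emeasure lborel (Pair z -` Q) = 0}"
    by blast
  also have "\<dots> \<in> sets N"
    using lborel.measurable_emeasure_Pair[OF Q] by measurable
  finally show ?thesis .
qed

context metric_dynamical_system
begin

lemma theta_compose_measurable [measurable (raw)]:
  "f \<in> borel_measurable N \<Longrightarrow> g \<in> N \<rightarrow>\<^sub>M M \<Longrightarrow> (\<lambda>z. \<theta> (f z) (g z)) \<in> N \<rightarrow>\<^sub>M M"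
  using measurable_compose[OF measurable_Pair theta_measurable] by simp

lemma theta_measurable1: "\<theta> t \<in> M \<rightarrow>\<^sub>M M"
  by measurable

lemma theta_space: "\<omega> \<in> space M \<Longrightarrow> \<theta> t \<omega> \<in> space M"
  using measurable_space[OF theta_measurable1] .

lemma AE_theta:
  assumes "AE \<omega> in M. P \<omega>"
  shows "AE \<omega> in M. P (\<theta> t \<omega>)"
proof (rule AE_distrD[OF theta_measurable1])
  show "AE \<omega> in distr M M (\<theta> t). P \<omega>" using assms by (subst theta_preserves)
qed

lemma emeasure_theta:
  assumes "A \<in> sets M"
  shows "emeasure M (\<theta> t -` A \<inter> space M) = emeasure M A"
  using emeasure_distr[OF theta_measurable1 assms, of t] by (simp add: theta_preserves)

lemma sets_theta_section:
  assumes "A \<in> sets M" "\<omega> \<in> space M"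
  shows "{r. \<theta> r \<omega> \<in> A} \<in> sets borel"
proof -
  have "(\<lambda>r. \<theta> r \<omega>) \<in> borel \<rightarrow>\<^sub>M M" using assms(2) by measurable
  from measurable_sets[OF this assms(1)] show ?thesis by (simp add: vimage_def)
qed

lemma sets_AE_orbit:
  assumes [measurable]: "A \<in> sets M"
  shows "{\<omega> \<in> space M. AE s in lborel. \<theta> s \<omega> \<in> A} \<in> sets M"
  by (rule sets_Collect_AE_lborel) measurable

lemma pair_sigma_finite_lborel: "pair_sigma_finite lborel M"
  by (intro pair_sigma_finite.intro sigma_finite_lborel sigma_finite_measure_axioms)

text \<open>Invariance of the measure gives the statement at each fixed time, and Fubini exchanges
  the two quantifiers.\<close>

lemma AE_orbit:
  assumes A [measurable]: "A \<in> sets M" and "AE \<omega> in M. \<omega> \<in> A"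
  shows "AE \<omega> in M. AE s in lborel. \<theta> s \<omega> \<in> A"
proof -
  have "{p \<in> space (lborel \<Otimes>\<^sub>M M). \<theta> (fst p) (snd p) \<in> A} \<in> sets (lborel \<Otimes>\<^sub>M M)" by measurable
  from pair_sigma_finite.AE_commute[OF pair_sigma_finite_lborel this] AE_theta[OF assms(2)]
  show ?thesis by simp
qed

text \<open>Fubini provides one time at which the property holds almost surely, and invariance
  carries it back to time 0. Facts that are accessible only at almost all times of an orbit thereby
  become facts about almost every \<open>\<omega>\<close>.\<close>

lemma AE_of_orbit:
  assumes A [measurable]: "A \<in> sets M" and "AE \<omega> in M. AE s in lborel. \<theta> s \<omega> \<in> A"
  shows "AE \<omega> in M. \<omega> \<in> A"
proof -
  have "{p \<in> space (lborel \<Otimes>\<^sub>M M). \<theta> (fst p) (snd p) \<in> A} \<in> sets (lborel \<Otimes>\<^sub>M M)" by measurable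
  from pair_sigma_finite.AE_commute[OF pair_sigma_finite_lborel this] assms(2)
  have "AE s in lborel. AE \<omega> in M. \<theta> s \<omega> \<in> A" by simp
  from AE_lborel_ex_between[OF this, of 0 1] obtain s where "AE \<omega> in M. \<theta> s \<omega> \<in> A" by auto
  from AE_theta[OF this, of "- s"] AE_space show ?thesis
    by eventually_elim (simp add: theta_add[symmetric] theta_zero)
qed

lemma AE_orbit_shift:
  assumes "\<omega> \<in> space M"
  shows "(AE s in lborel. P (\<theta> s (\<theta> t \<omega>))) \<longleftrightarrow> (AE s in lborel. P (\<theta> s \<omega>))"
proof
  have "(\<lambda>s. \<theta> (t + s) \<omega>) = (\<lambda>s. \<theta> s (\<theta> t \<omega>))"
    using theta_add[OF assms] by (metis add.commute)
  moreover assume "AE s in lborel. P (\<theta> s \<omega>)"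
  from AE_lborel_translate[OF this, of t] have "AE s in lborel. P (\<theta> (t + s) \<omega>)" .
  ultimately show "AE s in lborel. P (\<theta> s (\<theta> t \<omega>))" by metis
next
  assume "AE s in lborel. P (\<theta> s (\<theta> t \<omega>))"
  from AE_lborel_translate[OF this, of "- t"] show "AE s in lborel. P (\<theta> s \<omega>)"
    by (simp add: theta_add[OF assms, symmetric])
qed

end

text \<open>The sigma-field of \<open>M\<close> may be large, but a single product-measurable set
  sees only countably many of its members: this holds for rectangles and survives complements and
  countable unions.\<close>

lemma pair_set_determined_by_countable:
  assumes "Q \<in> sets (A \<Otimes>\<^sub>M M)"
  shows "\<exists>C. countable C \<and> C \<subseteq> sets M \<and>
    (\<forall>\<omega>\<in>space M. \<forall>\<omega>'\<in>space M. (\<forall>c\<in>C. \<omega> \<in> c \<longleftrightarrow> \<omega>' \<in> c) \<longrightarrow> (\<forall>a. (a, \<omega>) \<in> Q \<longleftrightarrow> (a, \<omega>') \<in> Q))"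
    (is "\<exists>C. ?det Q C")
proof -
  have "Q \<in> sigma_sets (space A \<times> space M) {a \<times> b |a b. a \<in> sets A \<and> b \<in> sets M}"
    using assms by (simp add: sets_pair_measure)
  then show ?thesis
  proof (induction rule: sigma_sets.induct)
    case (Basic Q)
    then obtain a b where "Q = a \<times> b" "a \<in> sets A" "b \<in> sets M" by blast
    then show ?case by (intro exI[of _ "{b}"]) auto
  next
    case Empty
    show ?case by (intro exI[of _ "{}"]) auto
  next
    case (Compl Q)
    then obtain C where "?det Q C" by blast
    then show ?case by (intro exI[of _ C]) blast
  next
    case (Union Q)
    then have "\<forall>n. \<exists>C. ?det (Q n) C" by (intro allI)
    from choice[OF this] obtain C where "\<forall>n. ?det (Q n) (C n)" by (elim exE)
    then have C: "?det (Q n) (C n)" for n by (rule spec)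
    have "?det (\<Union>n. Q n) (\<Union>n. C n)"
    proof (intro conjI ballI impI allI)
      show "countable (\<Union>n. C n)" "(\<Union>n. C n) \<subseteq> sets M" using C by blast+
      fix \<omega> \<omega>' a assume "\<omega> \<in> space M" "\<omega>' \<in> space M" and *: "\<forall>c\<in>\<Union>n. C n. \<omega> \<in> c \<longleftrightarrow> \<omega>' \<in> c"
      then have "(a, \<omega>) \<in> Q n \<longleftrightarrow> (a, \<omega>') \<in> Q n" for n using C[of n] by blast
      then show "(a, \<omega>) \<in> (\<Union>n. Q n) \<longleftrightarrow> (a, \<omega>') \<in> (\<Union>n. Q n)" by blast
    qed
    then show ?case by (rule exI)
  qed
qed

lemma inner_measure_of_AE:
  assumes "prob_space M" "AE \<omega> in M. P \<omega>"
  shows "inner_measure_of M {\<omega> \<in> space M. P \<omega>} = 1"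
proof -
  interpret prob_space M by fact
  from AE_E[OF assms(2)] obtain N where N: "{\<omega> \<in> space M. \<not> P \<omega>} \<subseteq> N" "emeasure M N = 0" "N \<in> sets M" by blast
  have "emeasure M (space M - N) = 1"
    using N sets.sets_into_space[OF N(3)] by (subst emeasure_Diff) (simp_all add: emeasure_space_1)
  moreover have "space M - N \<in> {B \<in> sets M. B \<subseteq> {\<omega> \<in> space M. P \<omega>}}" using N by auto
  ultimately have "1 \<le> inner_measure_of M {\<omega> \<in> space M. P \<omega>}"
    unfolding inner_measure_of_def by (intro SUP_upper2[of "space M - N"]) auto
  moreover have "inner_measure_of M {\<omega> \<in> space M. P \<omega>} \<le> 1"
    unfolding inner_measure_of_def by (intro SUP_least) (auto intro: emeasure_le_1)
  ultimately show ?thesis by (rule antisym[rotated])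
qed

section \<open>The crude flow: exceptional start times and determining events\<close>

locale crude_flow = metric_dynamical_system M \<theta>
  for M :: "'w measure" and \<theta> :: "real \<Rightarrow> 'w \<Rightarrow> 'w" +
  fixes \<phi> :: "real \<Rightarrow> real \<Rightarrow> 'a::polish_space option \<Rightarrow> 'w \<Rightarrow> 'a option"
  assumes measurable_phi: "jointly_measurable M \<phi>"
    and absorbing_phi: "absorbing M \<phi>"
    and flow_phi: "flow_property M \<phi>"
    and crude_phi: "crude_cocycle M \<theta> \<phi>"
    and start_phi: "right_continuous_start M \<phi>"
    and end_phi: "right_continuous_end M \<phi>"
begin

lemma phi_compose_measurable:
  assumes "f \<in> borel_measurable N" "g \<in> borel_measurable N" "h \<in> borel_measurable N" "k \<in> N \<rightarrow>\<^sub>M M"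
    and "\<And>z. z \<in> space N \<Longrightarrow> 0 \<le> f z \<and> f z \<le> g z"
  shows "(\<lambda>z. \<phi> (f z) (g z) (h z) (k z)) \<in> borel_measurable N"
proof -
  have "(\<lambda>z. (f z, g z)) \<in> N \<rightarrow>\<^sub>M restrict_space borel Delta"
    using assms by (intro measurable_restrict_space2) (auto simp: Delta_def)
  then have "(\<lambda>z. ((f z, g z), h z, k z)) \<in> N \<rightarrow>\<^sub>M restrict_space borel Delta \<Otimes>\<^sub>M (borel \<Otimes>\<^sub>M M)"
    using assms by (intro measurable_Pair)
  from measurable_compose[OF this measurable_phi[unfolded jointly_measurable_def]]
  show ?thesis by simp
qed

text \<open>The points at which the cocycle identity fails for some state form a projection along
  the state space. It is measurable up to a null set, and its sections at fixed times are null by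
  the crude cocycle property. Rational durations suffice by right continuity in the end time, and
  absorption settles the state \<open>None\<close>.\<close>

lemma ex_exceptional_set:
  "\<exists>E\<in>sets (lborel \<Otimes>\<^sub>M M). (AE \<omega> in M. AE s in lborel. (s, \<omega>) \<notin> E) \<and>
     (\<forall>s\<ge>0. \<forall>\<omega>\<in>space M. (s, \<omega>) \<notin> E \<longrightarrow> (\<forall>t\<ge>0. \<forall>x. \<phi> s (s + t) x \<omega> = \<phi> 0 t x (\<theta> s \<omega>)))"
proof -
  \<comment> \<open>A probability with the same null sets as Lebesgue measure, because the
    projection theorem is for finite measures.\<close>
  define \<nu> where "\<nu> = density lborel std_normal_density"
  interpret \<nu>: prob_space \<nu> unfolding \<nu>_def by (rule prob_space_normal_density) simp
  interpret P: pair_prob_space \<nu> M ..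
  have AE_\<nu>: "(AE s in \<nu>. Q s) \<Longrightarrow> (AE s in lborel. Q s)" for Q
    unfolding \<nu>_def by (subst (asm) AE_density) (auto simp: normal_density_pos)
  have [measurable_cong]: "sets \<nu> = sets borel" by (simp add: \<nu>_def)
  let ?N = "\<nu> \<Otimes>\<^sub>M M"
  \<comment> \<open>\<open>max 0\<close> keeps the times inside \<open>Delta\<close>, where
    measurability of \<open>\<phi>\<close> is available; negative times are cut off again in
    \<open>D\<close>.\<close>
  define bad where "bad t = {z \<in> space (?N \<Otimes>\<^sub>M (borel :: 'a measure)).
      \<phi> (max 0 (fst (fst z))) (max 0 (fst (fst z)) + t) (Some (snd z)) (snd (fst z)) \<noteq>
      \<phi> 0 t (Some (snd z)) (\<theta> (max 0 (fst (fst z))) (snd (fst z)))}" for t :: real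
  have bad: "bad t \<in> sets (?N \<Otimes>\<^sub>M borel)" if "0 \<le> t" for t
  proof -
    let ?K = "?N \<Otimes>\<^sub>M (borel :: 'a measure)"
    have 1: "(\<lambda>z. max 0 (fst (fst z))) \<in> borel_measurable ?K" by measurable
    have 2: "(\<lambda>z. max 0 (fst (fst z)) + t) \<in> borel_measurable ?K" by measurable
    have 3: "(\<lambda>z. Some (snd z)) \<in> borel_measurable ?K" by measurable
    have 4: "(\<lambda>z. snd (fst z)) \<in> ?K \<rightarrow>\<^sub>M M" by measurable
    show ?thesis
      unfolding bad_def
      by (intro measurable_option_neq phi_compose_measurable theta_compose_measurable 1 2 3 4)
        (use that in auto)
  qed
  define D where "D = (\<Union>t\<in>\<rat> \<inter> {0..}. bad t) \<inter> ({0..} \<times> space M) \<times> UNIV"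
  have "D \<in> sets (?N \<Otimes>\<^sub>M borel)"
    unfolding D_def using countable_rat bad by (intro sets.Int sets.countable_UN'' pair_measureI) auto
  with P.finite_measure_axioms have "fst ` D \<in> sets (completion ?N)"
    by (rule measurable_projection)
  then obtain S N1 N2 where S: "fst ` D = S \<union> N1" "N1 \<subseteq> N2" "N2 \<in> null_sets ?N" "S \<in> sets ?N"
    by (rule sets_completionE)
  have "emeasure M (Pair s -` S) = 0" for s
  proof (cases "0 \<le> s")
    case True
    with crude_phi have "\<exists>N\<in>null_sets M. \<forall>x. \<forall>\<omega>\<in>space M - N. \<forall>t\<ge>s. \<phi> s t x \<omega> = \<phi> 0 (t - s) x (\<theta> s \<omega>)"
      unfolding crude_cocycle_def by simp
    then obtain N where N: "N \<in> null_sets M"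
      "\<forall>x. \<forall>\<omega>\<in>space M - N. \<forall>t\<ge>s. \<phi> s t x \<omega> = \<phi> 0 (t - s) x (\<theta> s \<omega>)"
      by (elim bexE)
    have "Pair s -` S \<subseteq> N"
    proof
      fix \<omega> assume "\<omega> \<in> Pair s -` S"
      then have "(s, \<omega>) \<in> fst ` D" using S(1) by auto
      then obtain x where "((s, \<omega>), x) \<in> D" by auto
      then obtain t where t: "0 \<le> t" "((s, \<omega>), x) \<in> bad t" by (auto simp: D_def)
      have "\<omega> \<in> space M" using t(2) by (auto simp: bad_def space_pair_measure)
      show "\<omega> \<in> N"
      proof (rule ccontr)
        assume "\<omega> \<notin> N"
        with \<open>\<omega> \<in> space M\<close> have "\<phi> s (s + t) (Some x) \<omega> = \<phi> 0 (s + t - s) (Some x) (\<theta> s \<omega>)"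
          using t(1) by (intro N(2)[rule_format]) auto
        with t(2) True show False by (simp add: bad_def)
      qed
    qed
    with N(1) show ?thesis
      by (metis null_setsD1 null_setsD2 emeasure_mono le_zero_eq)
  next
    case False
    have "Pair s -` S \<subseteq> {}"
    proof
      fix \<omega> assume "\<omega> \<in> Pair s -` S"
      then have "(s, \<omega>) \<in> fst ` D" using S(1) by auto
      with False show "\<omega> \<in> {}" by (auto simp: D_def)
    qed
    then show ?thesis by (metis emeasure_empty subset_empty)
  qed
  then have "S \<in> null_sets ?N" using S(4) by (intro null_setsI) (simp_all add: emeasure_pair_measure_alt)
  then have null: "S \<union> N2 \<in> null_sets ?N" using S(3) by (rule null_sets.Un)
  define E where "E = S \<union> N2"
  have sets_eq: "sets ?N = sets (lborel \<Otimes>\<^sub>M M)" by (intro sets_pair_measure_cong) (simp_all add: \<nu>_def)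
  have E: "E \<in> sets (lborel \<Otimes>\<^sub>M M)" using null unfolding E_def by (auto simp: null_sets_def sets_eq)
  have "AE p in ?N. p \<notin> E" using null unfolding E_def by (rule AE_not_in)
  then have "AE s in \<nu>. AE \<omega> in M. (s, \<omega>) \<notin> E" by (rule P.AE_pair)
  then have "AE s in lborel. AE \<omega> in M. (s, \<omega>) \<notin> E" by (rule AE_\<nu>)
  moreover have "{p \<in> space (lborel \<Otimes>\<^sub>M M). (fst p, snd p) \<notin> E} = space (lborel \<Otimes>\<^sub>M M) - E"
    by auto
  then have "{p \<in> space (lborel \<Otimes>\<^sub>M M). (fst p, snd p) \<notin> E} \<in> sets (lborel \<Otimes>\<^sub>M M)"
    using E by (simp only: sets.compl_sets)
  ultimately have "AE \<omega> in M. AE s in lborel. (s, \<omega>) \<notin> E"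
    using pair_sigma_finite.AE_commute[OF pair_sigma_finite_lborel, of "\<lambda>s \<omega>. (s, \<omega>) \<notin> E"] by simp
  moreover have "\<phi> s (s + t) x \<omega> = \<phi> 0 t x (\<theta> s \<omega>)"
    if *: "0 \<le> s" "\<omega> \<in> space M" "(s, \<omega>) \<notin> E" "0 \<le> t" for s t x \<omega>
  proof (cases x)
    case None
    then show ?thesis using * absorbing_phi theta_space unfolding absorbing_def by auto
  next
    case (Some y)
    have rat: "\<phi> s (s + q) x \<omega> = \<phi> 0 q x (\<theta> s \<omega>)" if "q \<in> \<rat>" "0 \<le> q" for q
    proof (rule ccontr)
      assume "\<not> ?thesis"
      then have "((s, \<omega>), y) \<in> bad q"
        using * Some by (auto simp: bad_def space_pair_measure \<nu>_def)
      then have "((s, \<omega>), y) \<in> D" using * that by (auto simp: D_def)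
      then have "(s, \<omega>) \<in> fst ` D" by force
      then show False using S *(3) by (auto simp: E_def)
    qed
    define f where "f r = \<phi> s (s + r) x \<omega>" for r
    define g where "g r = \<phi> 0 r x (\<theta> s \<omega>)" for r
    have "continuous (at_right (t - (- s))) (\<lambda>r. \<phi> s r x \<omega>)"
      using end_phi * unfolding right_continuous_end_def by auto
    from continuous_at_right_shift[OF this] have "(f \<longlongrightarrow> f t) (at t within {t<..})"
      by (simp add: f_def[abs_def] continuous_within add.commute)
    moreover have "continuous (at_right t) g"
      using end_phi * theta_space[of \<omega> s] unfolding right_continuous_end_def g_def[abs_def] by auto
    then have "(g \<longlongrightarrow> g t) (at t within {t<..})" by (simp add: continuous_within)
    moreover have "t islimpt {r \<in> {t<..}. f r = g r}"
      unfolding islimpt_approachable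
    proof (intro allI impI)
      fix e :: real assume "e > 0"
      then obtain q where "q \<in> \<rat>" "t < q" "q < t + e" using Rats_dense_in_real[of t "t + e"] by auto
      then show "\<exists>q\<in>{r \<in> {t<..}. f r = g r}. q \<noteq> t \<and> dist q t < e"
        using rat[of q] *(4) by (intro bexI[of _ q]) (auto simp: f_def g_def dist_real_def)
    qed
    ultimately have "f t = g t" by (rule eq_if_agree_near)
    then show ?thesis by (simp add: f_def g_def)
  qed
  ultimately show ?thesis using E by blast
qed

text \<open>Countably many open sets separate the values of \<open>\<phi>\<close>, and the preimage
  of each depends on \<open>\<omega>\<close> through countably many events. The closure under
  complements is for later: the absence of upcrossings gives monotonicity in one direction only, and
  the complement supplies the other.\<close>

lemma ex_determining_sets:
  "\<exists>C. countable C \<and> C \<subseteq> sets M \<and> (\<forall>c\<in>C. space M - c \<in> C) \<and>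
     (\<forall>\<omega>\<in>space M. \<forall>\<omega>'\<in>space M. (\<forall>c\<in>C. \<omega> \<in> c \<longleftrightarrow> \<omega>' \<in> c) \<longrightarrow>
       (\<forall>s t x. 0 \<le> s \<longrightarrow> s \<le> t \<longrightarrow> \<phi> s t x \<omega> = \<phi> s t x \<omega>'))"
proof -
  obtain B :: "nat \<Rightarrow> 'a option set" where B: "\<And>n. open (B n)"
    "\<And>x y. (\<forall>n. x \<in> B n \<longleftrightarrow> y \<in> B n) \<Longrightarrow> x = y"
    using ex_separating_open_sequence by blast
  let ?A = "restrict_space borel Delta \<Otimes>\<^sub>M (borel :: 'a option measure)"
  define F where "F = (\<lambda>p. \<phi> (fst (fst (fst p))) (snd (fst (fst p))) (snd (fst p)) (snd p))"
  have "(\<lambda>p. (fst (fst p), snd (fst p), snd p)) \<in> ?A \<Otimes>\<^sub>M M \<rightarrow>\<^sub>M restrict_space borel Delta \<Otimes>\<^sub>M (borel \<Otimes>\<^sub>M M)"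
    by measurable
  from measurable_compose[OF this measurable_phi[unfolded jointly_measurable_def]]
  have F: "F \<in> borel_measurable (?A \<Otimes>\<^sub>M M)" by (simp add: F_def split_beta)
  have "\<exists>C. countable C \<and> C \<subseteq> sets M \<and> (\<forall>\<omega>\<in>space M. \<forall>\<omega>'\<in>space M. (\<forall>c\<in>C. \<omega> \<in> c \<longleftrightarrow> \<omega>' \<in> c) \<longrightarrow>
      (\<forall>a. (a, \<omega>) \<in> F -` B n \<inter> space (?A \<Otimes>\<^sub>M M) \<longleftrightarrow> (a, \<omega>') \<in> F -` B n \<inter> space (?A \<Otimes>\<^sub>M M)))" for n
    by (rule pair_set_determined_by_countable[OF measurable_sets[OF F]]) (use B(1) in auto)
  then obtain C where C: "\<And>n. countable (C n)" "\<And>n. C n \<subseteq> sets M"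
    "\<And>n \<omega> \<omega>' a. \<omega> \<in> space M \<Longrightarrow> \<omega>' \<in> space M \<Longrightarrow> (\<forall>c\<in>C n. \<omega> \<in> c \<longleftrightarrow> \<omega>' \<in> c) \<Longrightarrow>
      (a, \<omega>) \<in> F -` B n \<inter> space (?A \<Otimes>\<^sub>M M) \<longleftrightarrow> (a, \<omega>') \<in> F -` B n \<inter> space (?A \<Otimes>\<^sub>M M)"
    by metis
  define C' where "C' = (\<Union>n. C n) \<union> (\<lambda>c. space M - c) ` (\<Union>n. C n)"
  have sub: "c \<subseteq> space M" if "c \<in> C n" for c n using C(2) that sets.sets_into_space by blast
  have "\<phi> s t x \<omega> = \<phi> s t x \<omega>'"
    if *: "\<omega> \<in> space M" "\<omega>' \<in> space M" "\<forall>c\<in>C'. \<omega> \<in> c \<longleftrightarrow> \<omega>' \<in> c" "0 \<le> s" "s \<le> t" for \<omega> \<omega>' s t x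
  proof (rule B(2), rule allI)
    fix n
    have "\<forall>c\<in>C n. \<omega> \<in> c \<longleftrightarrow> \<omega>' \<in> c" using *(3) by (auto simp: C'_def)
    from C(3)[OF *(1,2) this, of "((s, t), x)"] * show "\<phi> s t x \<omega> \<in> B n \<longleftrightarrow> \<phi> s t x \<omega>' \<in> B n"
      by (simp add: F_def space_pair_measure space_restrict_space Delta_def)
  qed
  moreover have "countable C'" "C' \<subseteq> sets M" using C(1,2) by (auto simp: C'_def)
  moreover have "space M - c \<in> C'" if "c \<in> C'" for c
    using that sub by (fastforce simp: C'_def double_diff)
  ultimately show ?thesis by (intro exI[of _ C']) blast
qed

end

section \<open>Upcrossings\<close>

text \<open>The members are the starting times of upcrossings that are completed by time
  \<open>s\<close>. The non-strict bound at \<open>b\<close> matters: if \<open>k s = b\<close>, the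
  crossing counts at \<open>s\<close> itself and does not first appear immediately after
  \<open>s\<close>.\<close>

definition upcrossings :: "(real \<Rightarrow> real) \<Rightarrow> real \<Rightarrow> real \<Rightarrow> real \<Rightarrow> real set" where
  "upcrossings k a b s = {p. p \<le> s \<and> k p < a \<and> (\<exists>q\<in>{p..s}. b \<le> k q)}"

lemma upcrossings_mono: "s \<le> r \<Longrightarrow> upcrossings k a b s \<subseteq> upcrossings k a b r"
  by (fastforce simp: upcrossings_def)

lemma bdd_above_upcrossings: "bdd_above (upcrossings k a b s)"
  by (auto simp: upcrossings_def bdd_above_def)

lemma upcrossings_shift: "upcrossings (\<lambda>t. k (t + s)) a b 0 = {p. p + s \<in> upcrossings k a b s}"
proof -
  have "(\<exists>q\<in>{p..0}. b \<le> k (q + s)) \<longleftrightarrow> (\<exists>q\<in>{p + s..s}. b \<le> k q)" for p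
  proof
    assume "\<exists>q\<in>{p..0}. b \<le> k (q + s)"
    then obtain q where "q \<in> {p..0}" "b \<le> k (q + s)" by blast
    then show "\<exists>q\<in>{p + s..s}. b \<le> k q" by (intro bexI[of _ "q + s"]) auto
  next
    assume "\<exists>q\<in>{p + s..s}. b \<le> k q"
    then obtain q where "q \<in> {p + s..s}" "b \<le> k q" by blast
    then show "\<exists>q\<in>{p..0}. b \<le> k (q + s)" by (intro bexI[of _ "q - s"]) auto
  qed
  then show ?thesis by (auto simp: upcrossings_def)
qed

text \<open>If \<open>k s < b\<close>, then \<open>k\<close> stays below \<open>b\<close> for a
  while and no crossing gets completed. Otherwise \<open>k\<close> stays above \<open>a\<close> for
  a while, so that no crossing starts, and those begun earlier are already completed at
  \<open>s\<close>.\<close>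

lemma upcrossings_right_constant:
  assumes "continuous_on UNIV k" "a < b"
  shows "\<exists>e>s. \<forall>r\<in>{s..<e}. upcrossings k a b r = upcrossings k a b s"
proof -
  have lim: "(k \<longlongrightarrow> k s) (at_right s)"
    using assms(1) by (auto simp: continuous_on_def intro: tendsto_within_subset)
  have "\<exists>e>s. (\<forall>r\<in>{s..<e}. k r < b) \<or> (b \<le> k s \<and> (\<forall>r\<in>{s..<e}. a < k r))"
  proof (cases "k s < b")
    case True
    then obtain e where "e > s" "\<forall>r>s. r < e \<longrightarrow> k r < b"
      using order_tendstoD(2)[OF lim] unfolding eventually_at_right_field by blast
    with True have "\<forall>r\<in>{s..<e}. k r < b" by (auto simp: order_le_less)
    with \<open>e > s\<close> show ?thesis by blast
  next
    case False
    then have "a < k s" using assms(2) by simp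
    then obtain e where "e > s" "\<forall>r>s. r < e \<longrightarrow> a < k r"
      using order_tendstoD(1)[OF lim] unfolding eventually_at_right_field by blast
    with \<open>a < k s\<close> have "\<forall>r\<in>{s..<e}. a < k r" by (auto simp: order_le_less)
    with \<open>e > s\<close> False show ?thesis by auto
  qed
  then obtain e where e: "s < e" "(\<forall>r\<in>{s..<e}. k r < b) \<or> (b \<le> k s \<and> (\<forall>r\<in>{s..<e}. a < k r))" by blast
  have "upcrossings k a b r \<subseteq> upcrossings k a b s" if r: "r \<in> {s..<e}" for r
  proof
    fix p assume "p \<in> upcrossings k a b r"
    then obtain q where p: "p \<le> r" "k p < a" "p \<le> q" "q \<le> r" "b \<le> k q" by (auto simp: upcrossings_def)
    from e(2) show "p \<in> upcrossings k a b s"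
    proof
      assume below: "\<forall>r\<in>{s..<e}. k r < b"
      have "q < s"
      proof (rule ccontr)
        assume "\<not> q < s"
        with r p(4) have "q \<in> {s..<e}" by simp
        with below have "k q < b" by blast
        with p(5) show False by simp
      qed
      with p show ?thesis by (auto simp: upcrossings_def intro!: bexI[of _ q])
    next
      assume above: "b \<le> k s \<and> (\<forall>r\<in>{s..<e}. a < k r)"
      have "p < s"
      proof (rule ccontr)
        assume "\<not> p < s"
        with r p(1) have "p \<in> {s..<e}" by simp
        with above have "a < k p" by blast
        with p(2) show False by simp
      qed
      with p above show ?thesis by (auto simp: upcrossings_def intro!: bexI[of _ s])
    qed
  qed
  moreover have "upcrossings k a b s \<subseteq> upcrossings k a b r" if "r \<in> {s..<e}" for r
    using that by (intro upcrossings_mono) auto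
  ultimately show ?thesis using e(1) by blast
qed

text \<open>This is what makes crossings measurable. The strict bound at \<open>a\<close> lets
  \<open>p\<close> move to a nearby rational; the non-strict bound at \<open>b\<close> is approached
  through all \<open>b - 1 / Suc n\<close>, and the maximum of \<open>k\<close> on the compact
  interval \<open>{p..0}\<close> attains it.\<close>

lemma ex_upcrossing_iff_rational:
  assumes k: "continuous_on UNIV k" and "a < b"
  shows "(\<exists>p\<in>upcrossings k a b 0. c < p) \<longleftrightarrow>
    (\<exists>p\<in>\<rat>. p \<le> 0 \<and> c < p \<and> k p < a \<and> (\<forall>n. \<exists>q\<in>\<rat>. p \<le> q \<and> q \<le> 0 \<and> b - 1 / Suc n < k q))"
proof
  have lim: "(k \<longlongrightarrow> k x) (at x)" for x
    using k by (simp add: continuous_on_def)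
  assume "\<exists>p\<in>upcrossings k a b 0. c < p"
  then obtain p q where p: "c < p" "k p < a" "p \<le> q" "q \<le> 0" "b \<le> k q" by (auto simp: upcrossings_def)
  then have "p < q" using \<open>a < b\<close> by (cases "p = q") auto
  have "(k \<longlongrightarrow> k p) (at_right p)" by (rule tendsto_within_subset[OF lim]) simp
  from order_tendstoD(2)[OF this p(2)] obtain e where e: "p < e" "\<forall>x>p. x < e \<longrightarrow> k x < a" unfolding eventually_at_right_field by blast
  obtain p' where p': "p' \<in> \<rat>" "p < p'" "p' < min e q"
    using Rats_dense_in_real[of p "min e q"] e(1) \<open>p < q\<close> by auto
  have "\<exists>q'\<in>\<rat>. p' \<le> q' \<and> q' \<le> 0 \<and> b - 1 / Suc n < k q'" for n
  proof -
    have "b - 1 / Suc n < k q" using p(5) by (rule order_less_le_trans[rotated]) simp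
    moreover have "(k \<longlongrightarrow> k q) (at_left q)" by (rule tendsto_within_subset[OF lim]) simp
    ultimately have "\<forall>\<^sub>F x in at_left q. b - 1 / Suc n < k x" by (intro order_tendstoD(1))
    then obtain d where d: "d < q" "\<forall>x>d. x < q \<longrightarrow> b - 1 / Suc n < k x" unfolding eventually_at_left_field by blast
    obtain q' where "q' \<in> \<rat>" "max d p' < q'" "q' < q"
      using Rats_dense_in_real[of "max d p'" q] d(1) p'(3) by auto
    with d(2) p(4) show ?thesis by (intro bexI[of _ q']) auto
  qed
  with p p' e show "\<exists>p\<in>\<rat>. p \<le> 0 \<and> c < p \<and> k p < a \<and> (\<forall>n. \<exists>q\<in>\<rat>. p \<le> q \<and> q \<le> 0 \<and> b - 1 / Suc n < k q)"
    by (intro bexI[of _ p']) auto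
next
  assume "\<exists>p\<in>\<rat>. p \<le> 0 \<and> c < p \<and> k p < a \<and> (\<forall>n. \<exists>q\<in>\<rat>. p \<le> q \<and> q \<le> 0 \<and> b - 1 / Suc n < k q)"
  then obtain p where p: "p \<le> 0" "c < p" "k p < a" "\<And>n. \<exists>q\<in>\<rat>. p \<le> q \<and> q \<le> 0 \<and> b - 1 / Suc n < k q" by blast
  have "continuous_on {p..0} k" by (rule continuous_on_subset[OF k]) simp
  then obtain m where m: "m \<in> {p..0}" "\<And>q. q \<in> {p..0} \<Longrightarrow> k q \<le> k m"
    using continuous_attains_sup[of "{p..0}" k] p(1) by auto
  have "b \<le> k m"
  proof (rule ccontr)
    assume "\<not> b \<le> k m"
    then obtain n where "1 / Suc n < b - k m" using reals_Archimedean[of "b - k m"] by (auto simp: inverse_eq_divide)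
    moreover obtain q where "q \<in> {p..0}" "b - 1 / Suc n < k q" using p(4)[of n] by auto
    ultimately show False using m(2)[of q] by linarith
  qed
  with p m(1) show "\<exists>p\<in>upcrossings k a b 0. c < p"
    by (intro bexI[of _ p]) (auto simp: upcrossings_def intro!: bexI[of _ m])
qed

lemma cSup_translate:
  fixes X :: "real set"
  assumes "X \<noteq> {}" "bdd_above X"
  shows "Sup {p. p + s \<in> X} = Sup X - s"
proof -
  have "{p. p + s \<in> X} = (\<lambda>p. p - s) ` X"
    by (auto simp: image_iff intro!: bexI[of _ "_ + s"])
  moreover have "continuous (at_left (Sup X)) (\<lambda>p. p - s)" by (intro continuous_intros)
  then have "Sup X - s = (SUP p\<in>X. p - s)"
    using assms by (intro continuous_at_Sup_mono) (auto simp: mono_def)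
  ultimately show ?thesis by simp
qed

section \<open>Upcrossings of smoothed indicators along an orbit\<close>

context metric_dynamical_system
begin

text \<open>The smoothed indicator of \<open>C\<close>, the discounted share of future time that the
  orbit spends in \<open>C\<close>. It is continuous along each orbit although the orbit depends
  only measurably on time.\<close>

definition forward_average :: "'w set \<Rightarrow> 'w \<Rightarrow> real" where
  "forward_average C \<omega> = exp_average {r. \<theta> r \<omega> \<in> C} 0"

lemma forward_average_theta:
  assumes "\<omega> \<in> space M"
  shows "forward_average C (\<theta> t \<omega>) = exp_average {r. \<theta> r \<omega> \<in> C} t"
  using theta_add[OF assms, of _ t] by (simp add: forward_average_def exp_average_def add.commute)

lemma continuous_forward_average:
  assumes "\<omega> \<in> space M" "C \<in> sets M"
  shows "continuous_on UNIV (\<lambda>t. forward_average C (\<theta> t \<omega>))"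
  using continuous_on_exp_average[OF sets_theta_section[OF assms(2,1)]]
  by (simp add: forward_average_theta[OF assms(1)])

lemma measurable_forward_average [measurable]:
  assumes [measurable]: "C \<in> sets M"
  shows "forward_average C \<in> borel_measurable M"
proof -
  let ?E = "density lborel (exponential_density 1)"
  have [measurable_cong]: "sets ?E = sets borel" by simp
  define Q where "Q = {p \<in> space (M \<Otimes>\<^sub>M ?E). \<theta> (snd p) (fst p) \<in> C}"
  have "Q \<in> sets (M \<Otimes>\<^sub>M ?E)" unfolding Q_def by measurable
  then have "(\<lambda>\<omega>. enn2real (emeasure ?E (Pair \<omega> -` Q))) \<in> borel_measurable M"
    by (intro borel_measurable_enn2real exp1.measurable_emeasure_Pair)
  moreover have "enn2real (emeasure ?E (Pair \<omega> -` Q)) = forward_average C \<omega>" if "\<omega> \<in> space M" for \<omega>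
  proof -
    have "Pair \<omega> -` Q = {r. 0 + r \<in> {r. \<theta> r \<omega> \<in> C}}" using that by (auto simp: Q_def space_pair_measure)
    then show ?thesis unfolding forward_average_def exp_average_def measure_def by simp
  qed
  ultimately show ?thesis by (simp cong: measurable_cong)
qed

text \<open>A test consists of an event and two levels. Times are relative, with the current point
  at time 0, so that everything derived from the crossings is a function of the point alone.\<close>

definition crossings :: "'w set \<times> real \<times> real \<Rightarrow> 'w \<Rightarrow> real set" where
  "crossings \<tau> \<omega> = upcrossings (\<lambda>t. forward_average (fst \<tau>) (\<theta> t \<omega>)) (fst (snd \<tau>)) (snd (snd \<tau>)) 0"

definition test :: "'w set \<times> real \<times> real \<Rightarrow> bool" where
  "test \<tau> \<longleftrightarrow> fst \<tau> \<in> sets M \<and> fst (snd \<tau>) < snd (snd \<tau>)"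

text \<open>The time elapsed since the supremum of the starting times; 0 is a placeholder in the
  absence of upcrossings.\<close>

definition age :: "'w set \<times> real \<times> real \<Rightarrow> 'w \<Rightarrow> real" where
  "age \<tau> \<omega> = (if crossings \<tau> \<omega> = {} then 0 else - Sup (crossings \<tau> \<omega>))"

lemma crossings_theta:
  assumes "\<omega> \<in> space M"
  shows "crossings \<tau> (\<theta> s \<omega>) =
    {p. p + s \<in> upcrossings (\<lambda>t. forward_average (fst \<tau>) (\<theta> t \<omega>)) (fst (snd \<tau>)) (snd (snd \<tau>)) s}"
  using theta_add[OF assms, of _ s]
  by (simp add: crossings_def upcrossings_shift[of "\<lambda>t. forward_average (fst \<tau>) (\<theta> t \<omega>)", symmetric])

lemma age_nonneg: "0 \<le> age \<tau> \<omega>"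
proof -
  have "Sup (crossings \<tau> \<omega>) \<le> 0" if "crossings \<tau> \<omega> \<noteq> {}"
    using that by (intro cSup_least) (auto simp: crossings_def upcrossings_def)
  then show ?thesis by (simp add: age_def)
qed

text \<open>On the time axis of a fixed \<open>\<omega>\<close>, the present minus the age is a
  quantity read off the path up to crossing time \<open>s\<close>. This is the equivariance on which
  the choice of base points rests.\<close>

lemma age_theta:
  assumes "\<omega> \<in> space M" "crossings \<tau> (\<theta> s \<omega>) \<noteq> {}"
  shows "s - age \<tau> (\<theta> s \<omega>) =
    Sup (upcrossings (\<lambda>t. forward_average (fst \<tau>) (\<theta> t \<omega>)) (fst (snd \<tau>)) (snd (snd \<tau>)) s)"
proof -
  have "upcrossings (\<lambda>t. forward_average (fst \<tau>) (\<theta> t \<omega>)) (fst (snd \<tau>)) (snd (snd \<tau>)) s \<noteq> {}"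
    using assms by (auto simp: crossings_theta)
  from cSup_translate[OF this bdd_above_upcrossings, of s]
  have "Sup (crossings \<tau> (\<theta> s \<omega>)) =
      Sup (upcrossings (\<lambda>t. forward_average (fst \<tau>) (\<theta> t \<omega>)) (fst (snd \<tau>)) (snd (snd \<tau>)) s) - s"
    by (simp only: crossings_theta[OF assms(1)])
  then show ?thesis using assms(2) by (simp add: age_def)
qed

lemma crossings_theta_mono:
  assumes "\<omega> \<in> space M" "s \<le> r" "crossings \<tau> (\<theta> s \<omega>) \<noteq> {}"
  shows "crossings \<tau> (\<theta> r \<omega>) \<noteq> {}"
proof -
  obtain p where "p + s \<in> upcrossings (\<lambda>t. forward_average (fst \<tau>) (\<theta> t \<omega>)) (fst (snd \<tau>)) (snd (snd \<tau>)) s"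
    using assms(3) by (auto simp: crossings_theta[OF assms(1)])
  with upcrossings_mono[OF assms(2)] have
    "(p + s - r) + r \<in> upcrossings (\<lambda>t. forward_average (fst \<tau>) (\<theta> t \<omega>)) (fst (snd \<tau>)) (snd (snd \<tau>)) r" by auto
  then show ?thesis unfolding crossings_theta[OF assms(1)] by blast
qed

lemma age_right_constant:
  assumes "\<omega> \<in> space M" "test \<tau>"
  shows "\<exists>e>s. \<forall>r\<in>{s..<e}. (crossings \<tau> (\<theta> r \<omega>) = {} \<longleftrightarrow> crossings \<tau> (\<theta> s \<omega>) = {}) \<and>
    (crossings \<tau> (\<theta> s \<omega>) \<noteq> {} \<longrightarrow> r - age \<tau> (\<theta> r \<omega>) = s - age \<tau> (\<theta> s \<omega>))"
proof -
  let ?U = "\<lambda>s. upcrossings (\<lambda>t. forward_average (fst \<tau>) (\<theta> t \<omega>)) (fst (snd \<tau>)) (snd (snd \<tau>)) s"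
  obtain e where e: "e > s" "\<forall>r\<in>{s..<e}. ?U r = ?U s"
    using upcrossings_right_constant continuous_forward_average assms unfolding test_def by metis
  have empty: "crossings \<tau> (\<theta> r \<omega>) = {} \<longleftrightarrow> ?U r = {}" for r
  proof
    assume *: "crossings \<tau> (\<theta> r \<omega>) = {}"
    have "p \<notin> ?U r" for p
    proof
      assume "p \<in> ?U r"
      then have "p - r \<in> crossings \<tau> (\<theta> r \<omega>)" unfolding crossings_theta[OF assms(1)] by simp
      with * show False by simp
    qed
    then show "?U r = {}" by blast
  qed (simp add: crossings_theta[OF assms(1)])
  have "(crossings \<tau> (\<theta> r \<omega>) = {} \<longleftrightarrow> crossings \<tau> (\<theta> s \<omega>) = {}) \<and>
    (crossings \<tau> (\<theta> s \<omega>) \<noteq> {} \<longrightarrow> r - age \<tau> (\<theta> r \<omega>) = s - age \<tau> (\<theta> s \<omega>))" if "r \<in> {s..<e}" for r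
  proof -
    have eq: "?U r = ?U s" using e(2) that by (rule bspec)
    then have "crossings \<tau> (\<theta> r \<omega>) = {} \<longleftrightarrow> crossings \<tau> (\<theta> s \<omega>) = {}" by (simp only: empty)
    with eq show ?thesis by (metis age_theta[OF assms(1)])
  qed
  with e(1) show ?thesis by blast
qed

lemma sets_ex_crossing:
  assumes "test \<tau>"
  shows "{\<omega> \<in> space M. \<exists>p\<in>crossings \<tau> \<omega>. c < p} \<in> sets M"
proof -
  let ?k = "\<lambda>t \<omega>. forward_average (fst \<tau>) (\<theta> t \<omega>)"
  have [measurable]: "fst \<tau> \<in> sets M" using assms by (simp add: test_def)
  have k [measurable]: "?k t \<in> borel_measurable M" for t by measurable
  have "{\<omega> \<in> space M. \<exists>p\<in>crossings \<tau> \<omega>. c < p} =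
    {\<omega> \<in> space M. \<exists>p\<in>\<rat>. p \<le> 0 \<and> c < p \<and> ?k p \<omega> < fst (snd \<tau>) \<and>
      (\<forall>n. \<exists>q\<in>\<rat>. p \<le> q \<and> q \<le> 0 \<and> snd (snd \<tau>) - 1 / Suc n < ?k q \<omega>)}"
    unfolding crossings_def using assms
    by (intro Collect_cong conj_cong refl ex_upcrossing_iff_rational continuous_forward_average)
      (auto simp: test_def)
  also have "\<dots> = (\<Union>p\<in>\<rat> \<inter> {c<..0}. {\<omega> \<in> space M. ?k p \<omega> < fst (snd \<tau>)} \<inter>
      (\<Inter>n. \<Union>q\<in>\<rat> \<inter> {p..0}. {\<omega> \<in> space M. snd (snd \<tau>) - 1 / Suc n < ?k q \<omega>}))"
    by (auto simp: Bex_def)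
  also have "\<dots> \<in> sets M"
  proof -
    have 1: "{\<omega> \<in> space M. ?k p \<omega> < a} \<in> sets M" for p a by measurable
    have 2: "{\<omega> \<in> space M. a < ?k q \<omega>} \<in> sets M" for q a by measurable
    have "(\<Inter>n::nat. \<Union>q\<in>\<rat> \<inter> {p..0}. {\<omega> \<in> space M. snd (snd \<tau>) - 1 / Suc n < ?k q \<omega>}) \<in> sets M" for p
      using countable_rat 2 by (intro sets.countable_INT UNIV_not_empty image_subsetI sets.countable_UN'' countable_Int1)
    then show ?thesis
      using countable_rat 1 by (intro sets.countable_UN'' sets.Int countable_Int1)
  qed
  finally show ?thesis .
qed

lemma sets_crossings_nonempty:
  assumes "test \<tau>"
  shows "{\<omega> \<in> space M. crossings \<tau> \<omega> \<noteq> {}} \<in> sets M"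
proof -
  have "{\<omega> \<in> space M. crossings \<tau> \<omega> \<noteq> {}} = (\<Union>n::nat. {\<omega> \<in> space M. \<exists>p\<in>crossings \<tau> \<omega>. - real n < p})"
  proof (intro equalityI subsetI)
    fix \<omega> assume "\<omega> \<in> {\<omega> \<in> space M. crossings \<tau> \<omega> \<noteq> {}}"
    then obtain p where "\<omega> \<in> space M" "p \<in> crossings \<tau> \<omega>" by blast
    moreover obtain n where "- p < real n" using reals_Archimedean2 by blast
    ultimately show "\<omega> \<in> (\<Union>n::nat. {\<omega> \<in> space M. \<exists>p\<in>crossings \<tau> \<omega>. - real n < p})"
      by (auto intro!: exI[of _ n] bexI[of _ p])
  qed auto
  then show ?thesis using sets_ex_crossing[OF assms] by (auto intro!: sets.countable_UN)
qed

lemma measurable_age: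
  assumes "test \<tau>"
  shows "age \<tau> \<in> borel_measurable M"
  unfolding borel_measurable_iff_less
proof
  fix c
  have *: "age \<tau> \<omega> < c \<longleftrightarrow> (\<exists>p\<in>crossings \<tau> \<omega>. - c < p) \<or> (crossings \<tau> \<omega> = {} \<and> 0 < c)" for \<omega>
  proof (cases "crossings \<tau> \<omega> = {}")
    case False
    then have "- c < Sup (crossings \<tau> \<omega>) \<longleftrightarrow> (\<exists>p\<in>crossings \<tau> \<omega>. - c < p)"
      by (intro less_cSup_iff) (auto simp: crossings_def bdd_above_upcrossings)
    with False show ?thesis by (auto simp: age_def)
  qed (simp add: age_def)
  have "{\<omega> \<in> space M. age \<tau> \<omega> < c} = {\<omega> \<in> space M. \<exists>p\<in>crossings \<tau> \<omega>. - c < p} \<union>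
      (if 0 < c then space M - {\<omega> \<in> space M. crossings \<tau> \<omega> \<noteq> {}} else {})"
    unfolding * by auto
  then show "{\<omega> \<in> space M. age \<tau> \<omega> < c} \<in> sets M"
    using sets_ex_crossing[OF assms] sets_crossings_nonempty[OF assms] by auto
qed

text \<open>A past upcrossing remains in the past, so having one already at time \<open>- n\<close>
  is a subevent of having one at time 0. By invariance both have the same probability and differ by
  a null set.\<close>

lemma AE_crossings_recurrent:
  assumes "test \<tau>"
  shows "AE \<omega> in M. (\<exists>s. crossings \<tau> (\<theta> s \<omega>) \<noteq> {}) \<longrightarrow> (\<forall>s. crossings \<tau> (\<theta> s \<omega>) \<noteq> {})"
proof -
  define A where "A = {\<omega> \<in> space M. crossings \<tau> \<omega> \<noteq> {}}"
  have A: "A \<in> sets M" unfolding A_def by (rule sets_crossings_nonempty) fact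
  have "AE \<omega> in M. \<omega> \<in> A \<longrightarrow> \<theta> (- real n) \<omega> \<in> A" for n
  proof -
    define B where "B = \<theta> (- real n) -` A \<inter> space M"
    have B: "B \<in> sets M" unfolding B_def using measurable_sets[OF theta_measurable1 A] .
    have "B \<subseteq> A"
    proof
      fix \<omega> assume "\<omega> \<in> B"
      then have "\<omega> \<in> space M" "crossings \<tau> (\<theta> (- real n) \<omega>) \<noteq> {}" by (auto simp: B_def A_def)
      from crossings_theta_mono[OF this(1) _ this(2), of 0] this(1) show "\<omega> \<in> A"
        by (simp add: A_def theta_zero)
    qed
    then have "emeasure M (A - B) = 0"
      using A B emeasure_theta[OF A, of "- real n"] by (subst emeasure_Diff) (simp_all add: B_def)
    then have "A - B \<in> null_sets M" using A B by auto
    from AE_not_in[OF this] AE_space show ?thesis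
      by eventually_elim (auto simp: B_def)
  qed
  then have "AE \<omega> in M. \<forall>m n. \<theta> (real m) \<omega> \<in> A \<longrightarrow> \<theta> (- real n) (\<theta> (real m) \<omega>) \<in> A"
    unfolding AE_all_countable by (intro allI AE_theta)
  then show ?thesis
    using AE_space
  proof eventually_elim
    case (elim \<omega>)
    show ?case
    proof (intro impI allI)
      fix r assume "\<exists>s. crossings \<tau> (\<theta> s \<omega>) \<noteq> {}"
      then obtain s where s: "crossings \<tau> (\<theta> s \<omega>) \<noteq> {}" ..
      obtain m where "s \<le> real m" using real_arch_simple by blast
      from crossings_theta_mono[OF elim(2) this s] have "\<theta> (real m) \<omega> \<in> A"
        using theta_space[OF elim(2)] by (simp add: A_def)
      obtain n where n: "real m - r \<le> real n" using real_arch_simple by blast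
      have "\<theta> (- real n) (\<theta> (real m) \<omega>) \<in> A" using elim(1) \<open>\<theta> (real m) \<omega> \<in> A\<close> by blast
      then have "crossings \<tau> (\<theta> (- real n + real m) \<omega>) \<noteq> {}"
        unfolding theta_add[OF elim(2)] by (simp add: A_def)
      then show "crossings \<tau> (\<theta> r \<omega>) \<noteq> {}"
        by (rule crossings_theta_mono[OF elim(2), rotated]) (use n in simp)
    qed
  qed
qed

end

section \<open>The perfect version\<close>

context metric_dynamical_system
begin

text \<open>\<open>\<xi> - age \<tau> \<omega>\<close> is the position of the base point relative to
  the present: the supremum of the starting times, displaced by the constant
  \<open>\<xi>\<close>.\<close>

definition anchored :: "real \<Rightarrow> 'w set \<times> real \<times> real \<Rightarrow> 'w set \<Rightarrow> 'w set" where
  "anchored \<xi> \<tau> G = {\<omega> \<in> space M. crossings \<tau> \<omega> \<noteq> {} \<and> \<theta> (\<xi> - age \<tau> \<omega>) \<omega> \<in> G}"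

definition ever_anchored :: "real \<Rightarrow> 'w set \<times> real \<times> real \<Rightarrow> 'w set \<Rightarrow> 'w set" where
  "ever_anchored \<xi> \<tau> G = {\<omega> \<in> space M. \<forall>s. \<theta> s \<omega> \<in> anchored \<xi> \<tau> G}"

lemma sets_anchored:
  assumes [measurable]: "test \<tau>" "G \<in> sets M"
  shows "anchored \<xi> \<tau> G \<in> sets M"
proof -
  have [measurable]: "age \<tau> \<in> borel_measurable M" by (rule measurable_age) fact
  have "{\<omega> \<in> space M. \<theta> (\<xi> - age \<tau> \<omega>) \<omega> \<in> G} \<in> sets M" by measurable
  with sets_crossings_nonempty[OF assms(1)]
  have "{\<omega> \<in> space M. crossings \<tau> \<omega> \<noteq> {}} \<inter> {\<omega> \<in> space M. \<theta> (\<xi> - age \<tau> \<omega>) \<omega> \<in> G} \<in> sets M"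
    by (rule sets.Int)
  also have "{\<omega> \<in> space M. crossings \<tau> \<omega> \<noteq> {}} \<inter> {\<omega> \<in> space M. \<theta> (\<xi> - age \<tau> \<omega>) \<omega> \<in> G} = anchored \<xi> \<tau> G"
    by (auto simp: anchored_def)
  finally show ?thesis .
qed

lemma anchored_right_constant:
  assumes "\<omega> \<in> space M" "test \<tau>"
  shows "\<exists>e>s. \<forall>r\<in>{s..<e}. \<theta> r \<omega> \<in> anchored \<xi> \<tau> G \<longleftrightarrow> \<theta> s \<omega> \<in> anchored \<xi> \<tau> G"
proof -
  obtain e where e: "e > s" "\<forall>r\<in>{s..<e}. (crossings \<tau> (\<theta> r \<omega>) = {} \<longleftrightarrow> crossings \<tau> (\<theta> s \<omega>) = {}) \<and>
    (crossings \<tau> (\<theta> s \<omega>) \<noteq> {} \<longrightarrow> r - age \<tau> (\<theta> r \<omega>) = s - age \<tau> (\<theta> s \<omega>))"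
    using age_right_constant[OF assms] by blast
  have "\<theta> r \<omega> \<in> anchored \<xi> \<tau> G \<longleftrightarrow> \<theta> s \<omega> \<in> anchored \<xi> \<tau> G" if "r \<in> {s..<e}" for r
  proof (cases "crossings \<tau> (\<theta> s \<omega>) = {}")
    case True
    with e(2) that show ?thesis by (simp add: anchored_def)
  next
    case False
    with e(2) that have r: "crossings \<tau> (\<theta> r \<omega>) \<noteq> {}" "r - age \<tau> (\<theta> r \<omega>) = s - age \<tau> (\<theta> s \<omega>)" by blast+
    have "\<xi> - age \<tau> (\<theta> r \<omega>) + r = \<xi> - age \<tau> (\<theta> s \<omega>) + s" using r(2) by simp
    then have "\<theta> (\<xi> - age \<tau> (\<theta> r \<omega>)) (\<theta> r \<omega>) = \<theta> (\<xi> - age \<tau> (\<theta> s \<omega>)) (\<theta> s \<omega>)"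
      by (simp only: theta_add[OF assms(1), symmetric])
    with False r(1) show ?thesis using theta_space[OF assms(1)] by (simp add: anchored_def)
  qed
  with e(1) show ?thesis by blast
qed

text \<open>Being anchored does not change on a short interval to the right of any time, so rational
  times decide. The quantifier over all real times becomes measurable in this way.\<close>

lemma ever_anchored_iff_rational:
  assumes "\<omega> \<in> space M" "test \<tau>"
  shows "\<omega> \<in> ever_anchored \<xi> \<tau> G \<longleftrightarrow> (\<forall>s\<in>\<rat>. \<theta> s \<omega> \<in> anchored \<xi> \<tau> G)"
proof
  assume *: "\<forall>s\<in>\<rat>. \<theta> s \<omega> \<in> anchored \<xi> \<tau> G"
  have "\<theta> s \<omega> \<in> anchored \<xi> \<tau> G" for s
  proof -
    obtain e where e: "e > s" "\<forall>r\<in>{s..<e}. \<theta> r \<omega> \<in> anchored \<xi> \<tau> G \<longleftrightarrow> \<theta> s \<omega> \<in> anchored \<xi> \<tau> G"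
      using anchored_right_constant[OF assms] by blast
    obtain r where "r \<in> \<rat>" "s < r" "r < e" using Rats_dense_in_real[OF e(1)] by blast
    then have "r \<in> {s..<e}" by simp
    with e(2) have "\<theta> r \<omega> \<in> anchored \<xi> \<tau> G \<longleftrightarrow> \<theta> s \<omega> \<in> anchored \<xi> \<tau> G" by (rule bspec)
    moreover have "\<theta> r \<omega> \<in> anchored \<xi> \<tau> G" using * \<open>r \<in> \<rat>\<close> by (rule bspec)
    ultimately show ?thesis by (rule iffD1)
  qed
  with assms(1) show "\<omega> \<in> ever_anchored \<xi> \<tau> G" by (simp add: ever_anchored_def)
qed (simp add: ever_anchored_def)

lemma sets_ever_anchored:
  assumes "test \<tau>" "G \<in> sets M"
  shows "ever_anchored \<xi> \<tau> G \<in> sets M"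
proof -
  have "ever_anchored \<xi> \<tau> G = {\<omega> \<in> space M. \<forall>s\<in>\<rat>. \<theta> s \<omega> \<in> anchored \<xi> \<tau> G}"
    using ever_anchored_iff_rational[OF _ assms(1)] by (auto simp: ever_anchored_def)
  also have "\<dots> \<in> sets M"
  proof (rule sets.sets_Collect_countable_All')
    show "{\<omega> \<in> space M. \<theta> s \<omega> \<in> anchored \<xi> \<tau> G} \<in> sets M" for s
      using measurable_sets[OF theta_measurable1 sets_anchored[OF assms]]
      by (simp add: vimage_def Int_def conj_commute)
  qed (rule countable_rat)
  finally show ?thesis .
qed

lemma ever_anchored_theta_iff:
  assumes "\<omega> \<in> space M"
  shows "\<theta> t \<omega> \<in> ever_anchored \<xi> \<tau> G \<longleftrightarrow> \<omega> \<in> ever_anchored \<xi> \<tau> G"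
proof -
  have "(\<forall>s. \<theta> (s + t) \<omega> \<in> anchored \<xi> \<tau> G) \<longleftrightarrow> (\<forall>s. \<theta> s \<omega> \<in> anchored \<xi> \<tau> G)"
    by (metis diff_add_cancel)
  then show ?thesis using theta_space[OF assms] assms by (simp add: ever_anchored_def theta_add)
qed

text \<open>For fixed \<open>\<omega>\<close>, varying \<open>\<xi>\<close> moves the base point
  along an orbit almost all of whose points lie in \<open>G\<close>. Fubini turns this into almost
  every \<open>\<xi>\<close> being right for almost every \<open>\<omega>\<close>, simultaneously
  for countably many tests and all rational times; recurrence provides the crossings at all
  times.\<close>

lemma AE_ever_anchored:
  assumes G: "G \<in> sets M" "AE \<omega> in M. \<omega> \<in> G" and T: "countable T" "\<And>\<tau>. \<tau> \<in> T \<Longrightarrow> test \<tau>"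
  shows "\<exists>\<xi><0. AE \<omega> in M. \<forall>\<tau>\<in>T. (\<exists>s. crossings \<tau> (\<theta> s \<omega>) \<noteq> {}) \<longrightarrow> \<omega> \<in> ever_anchored \<xi> \<tau> G"
proof -
  have "AE \<xi> in lborel. AE \<omega> in M. \<theta> (\<xi> - age \<tau> (\<theta> s \<omega>)) (\<theta> s \<omega>) \<in> G" if "\<tau> \<in> T" for \<tau> s
  proof -
    have [measurable]: "age \<tau> \<in> borel_measurable M" "G \<in> sets M"
      using measurable_age[OF T(2)[OF that]] G(1) by simp_all
    have "{p \<in> space (lborel \<Otimes>\<^sub>M M). \<theta> (fst p - age \<tau> (\<theta> s (snd p))) (\<theta> s (snd p)) \<in> G} \<in> sets (lborel \<Otimes>\<^sub>M M)"
      by measurable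
    moreover have "AE \<omega> in M. AE \<xi> in lborel. \<theta> (\<xi> - age \<tau> (\<theta> s \<omega>)) (\<theta> s \<omega>) \<in> G"
      using AE_orbit[OF G] AE_space
    proof eventually_elim
      case (elim \<omega>)
      from AE_lborel_translate[OF elim(1), of "s - age \<tau> (\<theta> s \<omega>)"]
      have "AE \<xi> in lborel. \<theta> (\<xi> - age \<tau> (\<theta> s \<omega>) + s) \<omega> \<in> G" by (simp add: algebra_simps)
      then show ?case unfolding theta_add[OF elim(2)] .
    qed
    ultimately show ?thesis
      using pair_sigma_finite.AE_commute[OF pair_sigma_finite_lborel,
          of "\<lambda>\<xi> \<omega>. \<theta> (\<xi> - age \<tau> (\<theta> s \<omega>)) (\<theta> s \<omega>) \<in> G"] by blast
  qed
  then have "AE \<xi> in lborel. \<forall>\<tau>\<in>T. \<forall>s\<in>\<rat>. AE \<omega> in M. \<theta> (\<xi> - age \<tau> (\<theta> s \<omega>)) (\<theta> s \<omega>) \<in> G"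
    by (simp only: AE_ball_countable[OF T(1)] AE_ball_countable[OF countable_rat] ball_simps) blast
  from AE_lborel_ex_between[OF this, of "- 1" 0] obtain \<xi> where "\<xi> < 0"
    and \<xi>: "\<forall>\<tau>\<in>T. \<forall>s\<in>\<rat>. AE \<omega> in M. \<theta> (\<xi> - age \<tau> (\<theta> s \<omega>)) (\<theta> s \<omega>) \<in> G" by auto
  have "AE \<omega> in M. (\<exists>s. crossings \<tau> (\<theta> s \<omega>) \<noteq> {}) \<longrightarrow> \<omega> \<in> ever_anchored \<xi> \<tau> G" if "\<tau> \<in> T" for \<tau>
  proof -
    have "AE \<omega> in M. \<forall>s\<in>\<rat>. \<theta> (\<xi> - age \<tau> (\<theta> s \<omega>)) (\<theta> s \<omega>) \<in> G"
      unfolding AE_ball_countable[OF countable_rat] using \<xi> that by blast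
    then show ?thesis
      using AE_crossings_recurrent[OF T(2)[OF that]] AE_space
    proof eventually_elim
      case (elim \<omega>)
      show ?case
      proof
        assume "\<exists>s. crossings \<tau> (\<theta> s \<omega>) \<noteq> {}"
        with elim(2) have "\<forall>s. crossings \<tau> (\<theta> s \<omega>) \<noteq> {}" by blast
        with elim(1) show "\<omega> \<in> ever_anchored \<xi> \<tau> G"
          using theta_space[OF elim(3)]
          by (simp add: ever_anchored_iff_rational[OF elim(3) T(2)[OF that]] anchored_def)
      qed
    qed
  qed
  then have "AE \<omega> in M. \<forall>\<tau>\<in>T. (\<exists>s. crossings \<tau> (\<theta> s \<omega>) \<noteq> {}) \<longrightarrow> \<omega> \<in> ever_anchored \<xi> \<tau> G"
    unfolding AE_ball_countable[OF T(1)] by blast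
  with \<open>\<xi> < 0\<close> show ?thesis by blast
qed

lemma forward_average_antimono:
  assumes \<omega>: "\<omega> \<in> space M"
    and none: "\<And>a b s. a \<in> \<rat> \<Longrightarrow> b \<in> \<rat> \<Longrightarrow> a < b \<Longrightarrow> crossings (c, a, b) (\<theta> s \<omega>) = {}"
    and "p < q"
  shows "forward_average c (\<theta> q \<omega>) \<le> forward_average c (\<theta> p \<omega>)"
proof (rule ccontr)
  assume "\<not> ?thesis"
  then have "forward_average c (\<theta> p \<omega>) < forward_average c (\<theta> q \<omega>)" by simp
  then obtain a where a: "a \<in> \<rat>" "forward_average c (\<theta> p \<omega>) < a" "a < forward_average c (\<theta> q \<omega>)"
    using Rats_dense_in_real by blast
  then obtain b where b: "b \<in> \<rat>" "a < b" "b < forward_average c (\<theta> q \<omega>)"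
    using Rats_dense_in_real by blast
  have "p \<in> upcrossings (\<lambda>t. forward_average c (\<theta> t \<omega>)) a b q"
    using a b \<open>p < q\<close> by (auto simp: upcrossings_def intro!: bexI[of _ q])
  then have "p - q \<in> crossings (c, a, b) (\<theta> q \<omega>)" unfolding crossings_theta[OF \<omega>] by simp
  with none[OF a(1) b(1,2)] show False by blast
qed

text \<open>Without upcrossings of rational levels, the averages of \<open>c\<close> and of its
  complement are both nonincreasing in time. They add up to 1, hence both are constant.\<close>

lemma AE_const_if_no_crossings:
  assumes \<omega>: "\<omega> \<in> space M" and c: "c \<in> sets M"
    and none: "\<And>d a b s. d \<in> {c, space M - c} \<Longrightarrow> a \<in> \<rat> \<Longrightarrow> b \<in> \<rat> \<Longrightarrow> a < b \<Longrightarrow> crossings (d, a, b) (\<theta> s \<omega>) = {}"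
  shows "(AE v in lborel. \<theta> v \<omega> \<in> c) \<or> (AE v in lborel. \<theta> v \<omega> \<notin> c)"
proof -
  define S where "S = {r. \<theta> r \<omega> \<in> c}"
  have S: "S \<in> sets borel" unfolding S_def by (rule sets_theta_section[OF c \<omega>])
  have "{r. \<theta> r \<omega> \<in> space M - c} = - S" using theta_space[OF \<omega>] by (auto simp: S_def)
  then have avg: "forward_average c (\<theta> t \<omega>) = exp_average S t"
    "forward_average (space M - c) (\<theta> t \<omega>) = 1 - exp_average S t" for t
    using exp_average_Compl[OF S] by (simp_all add: forward_average_theta[OF \<omega>] S_def)
  have "exp_average S q = exp_average S p" if "p < q" for p q
    using forward_average_antimono[OF \<omega> none that, of c] forward_average_antimono[OF \<omega> none that, of "space M - c"]
    by (simp add: avg)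
  then have "exp_average S t = exp_average S 0" for t by (metis linorder_neqE)
  from exp_average_const_imp_AE[OF S this] show ?thesis by (simp add: S_def)
qed

end

section \<open>Construction and verification of the perfect version\<close>

context crude_flow
begin

lemma ex_perfect_version:
  "\<exists>\<psi>. jointly_measurable M \<psi> \<and> inherits M \<phi> M \<psi> \<and> perfect_cocycle M \<theta> \<psi> \<and> indistinguishable M \<psi> \<phi>"
proof -
  obtain E where E: "E \<in> sets (lborel \<Otimes>\<^sub>M M)" "AE \<omega> in M. AE s in lborel. (s, \<omega>) \<notin> E"
    and "\<forall>s\<ge>0. \<forall>\<omega>\<in>space M. (s, \<omega>) \<notin> E \<longrightarrow> (\<forall>t\<ge>0. \<forall>x. \<phi> s (s + t) x \<omega> = \<phi> 0 t x (\<theta> s \<omega>))"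
    using ex_exceptional_set by (elim bexE conjE)
  then have regular: "\<phi> s (s + t) x \<omega> = \<phi> 0 t x (\<theta> s \<omega>)"
    if "0 \<le> s" "\<omega> \<in> space M" "(s, \<omega>) \<notin> E" "0 \<le> t" for s \<omega> t x
    using that by blast
  obtain C where C: "countable C" "C \<subseteq> sets M" and compl: "\<forall>c\<in>C. space M - c \<in> C"
    and determines: "\<forall>\<omega>\<in>space M. \<forall>\<omega>'\<in>space M. (\<forall>c\<in>C. \<omega> \<in> c \<longleftrightarrow> \<omega>' \<in> c) \<longrightarrow>
       (\<forall>s t x. 0 \<le> s \<longrightarrow> s \<le> t \<longrightarrow> \<phi> s t x \<omega> = \<phi> s t x \<omega>')"
    using ex_determining_sets by (elim exE conjE)
  have C_compl: "space M - c \<in> C" if "c \<in> C" for c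
    using compl that by (rule bspec)
  have det: "\<phi> s t x \<omega> = \<phi> s t x \<omega>'"
    if "\<omega> \<in> space M" "\<omega>' \<in> space M" "\<forall>c\<in>C. \<omega> \<in> c \<longleftrightarrow> \<omega>' \<in> c" "0 \<le> s" "s \<le> t" for \<omega> \<omega>' s t x
    using determines[rule_format, OF that(1,2)] that(3-5) by blast
  define G where "G = {\<omega> \<in> space M. AE s in lborel. (s, \<omega>) \<notin> E}"
  have E_swap: "{p \<in> space (M \<Otimes>\<^sub>M lborel). (snd p, fst p) \<notin> E} \<in> sets (M \<Otimes>\<^sub>M lborel)"
    using E(1) by measurable
  have G: "G \<in> sets M" unfolding G_def by (rule sets_Collect_AE_lborel) (rule E_swap)
  have AE_G: "AE \<omega> in M. \<omega> \<in> G" using E(2) AE_space by eventually_elim (simp add: G_def)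
  \<comment> \<open>The additional test keeps \<open>T\<close> nonempty for its enumeration; the
    average of the empty event is never below 0, so this test has no upcrossings.\<close>
  define T where "T = insert ({}, 0, 1) {(c, a, b) |c a b. c \<in> C \<and> a \<in> \<rat> \<and> b \<in> \<rat> \<and> a < (b :: real)}"
  have "T \<subseteq> insert ({}, 0, 1) (C \<times> \<rat> \<times> \<rat>)" by (auto simp: T_def)
  moreover have "countable (insert ({}, 0, 1) (C \<times> (\<rat> \<times> \<rat> :: (real \<times> real) set)))"
    using C(1) countable_rat by (intro countable_insert countable_SIGMA)
  ultimately have T: "countable T" by (rule countable_subset)
  have T_ne: "T \<noteq> {}" by (simp add: T_def)
  have test: "test \<tau>" if "\<tau> \<in> T" for \<tau> using that C(2) by (auto simp: T_def test_def)
  obtain \<xi> where "\<xi> < 0"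
    and \<xi>: "AE \<omega> in M. \<forall>\<tau>\<in>T. (\<exists>s. crossings \<tau> (\<theta> s \<omega>) \<noteq> {}) \<longrightarrow> \<omega> \<in> ever_anchored \<xi> \<tau> G"
    using AE_ever_anchored[OF G AE_G T(1) test] by blast
  define \<tau> where "\<tau> n = from_nat_into T n" for n
  have test\<tau>: "test (\<tau> n)" for n unfolding \<tau>_def by (rule test[OF from_nat_into[OF T_ne]])
  define A where "A n = ever_anchored \<xi> (\<tau> n) G" for n
  have A: "A n \<in> sets M" for n unfolding A_def by (rule sets_ever_anchored[OF test\<tau> G])
  have A_theta: "\<theta> s \<omega> \<in> A n \<longleftrightarrow> \<omega> \<in> A n" if "\<omega> \<in> space M" for s \<omega> n
    unfolding A_def by (rule ever_anchored_theta_iff[OF that])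
  define b where "b n \<omega> = \<xi> - age (\<tau> n) \<omega>" for n \<omega>
  have b_neg: "b n \<omega> < 0" for n \<omega> using age_nonneg[of "\<tau> n" \<omega>] \<open>\<xi> < 0\<close> by (simp add: b_def)
  have b [measurable]: "b n \<in> borel_measurable M" for n
    using measurable_age[OF test\<tau>, of n] unfolding b_def[abs_def] by measurable
  \<comment> \<open>The zero-one orbits: each event of \<open>C\<close> is visited at almost all or
    at almost no times, and almost all orbit points are good.\<close>
  define Z where "Z = {\<omega> \<in> space M. (AE v in lborel. \<theta> v \<omega> \<in> G) \<and>
    (\<forall>c\<in>C. (AE v in lborel. \<theta> v \<omega> \<in> c) \<or> (AE v in lborel. \<theta> v \<omega> \<in> space M - c))}"
  have Z: "Z \<in> sets M"
    unfolding Z_def using C C_compl G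
    by (intro sets.sets_Collect_conj sets.sets_Collect_countable_All' sets.sets_Collect_disj sets_AE_orbit) auto
  have Z_theta: "\<theta> s \<omega> \<in> Z \<longleftrightarrow> \<omega> \<in> Z" if "\<omega> \<in> space M" for s \<omega>
    unfolding Z_def using theta_space[OF that] that
      AE_orbit_shift[OF that, of "\<lambda>\<omega>. \<omega> \<in> G"] AE_orbit_shift[OF that, of "\<lambda>\<omega>. \<omega> \<in> _"]
      AE_orbit_shift[OF that, of "\<lambda>\<omega>. \<omega> \<notin> _"] by simp
  \<comment> \<open>\<open>\<omega>'\<close> belongs to exactly those events of \<open>C\<close>
    that are typical for the orbit of \<open>\<omega>\<close>. Points with the same pattern have the
    same flow by \<open>det\<close>.\<close>
  define pat where "pat \<omega> \<omega>' \<longleftrightarrow> (\<forall>c\<in>C. \<omega>' \<in> c \<longleftrightarrow> (AE v in lborel. \<theta> v \<omega> \<in> c))" for \<omega> \<omega>'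
  have pat_theta: "pat (\<theta> s \<omega>) = pat \<omega>" if "\<omega> \<in> space M" for s \<omega>
    unfolding pat_def[abs_def] using AE_orbit_shift[OF that, of "\<lambda>\<omega>. \<omega> \<in> _"] by simp
  have pat_AE: "AE v in lborel. pat \<omega> (\<theta> v \<omega>)" if "\<omega> \<in> Z" for \<omega>
    unfolding pat_def AE_ball_countable[OF C(1)]
  proof
    fix c assume "c \<in> C"
    show "AE v in lborel. \<theta> v \<omega> \<in> c \<longleftrightarrow> (AE v in lborel. \<theta> v \<omega> \<in> c)"
    proof (cases "AE v in lborel. \<theta> v \<omega> \<in> c")
      case False
      with that \<open>c \<in> C\<close> have "AE v in lborel. \<theta> v \<omega> \<in> space M - c" by (auto simp: Z_def)
      then show ?thesis by eventually_elim (use False in simp)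
    qed simp
  qed
  have pat_det: "\<phi> s t x \<omega>1 = \<phi> s t x \<omega>2"
    if "pat \<omega> \<omega>1" "pat \<omega> \<omega>2" "\<omega>1 \<in> space M" "\<omega>2 \<in> space M" "0 \<le> s" "s \<le> t" for \<omega> \<omega>1 \<omega>2 s t x
    using that by (intro det) (auto simp: pat_def)
  have Z_rep: "\<exists>v. \<theta> v \<omega> \<in> G \<and> pat \<omega> (\<theta> v \<omega>)" if "\<omega> \<in> Z" for \<omega>
  proof -
    have "AE v in lborel. \<theta> v \<omega> \<in> G" using that by (simp add: Z_def)
    with pat_AE[OF that] have "AE v in lborel. \<theta> v \<omega> \<in> G \<and> pat \<omega> (\<theta> v \<omega>)" by eventually_elim simp
    from AE_lborel_ex_between[OF this, of 0 1] show ?thesis by auto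
  qed
  \<comment> \<open>The value taken at almost all points of the orbit. Since no representative point
    enters, membership of this value in a Borel set is an almost-everywhere statement in
    \<open>v\<close>, which is measurable.\<close>
  define lim where "lim r x \<omega> = (SOME y. AE v in lborel. \<phi> 0 r x (\<theta> v \<omega>) = y)" for r x \<omega>
  have lim_AE: "AE v in lborel. \<phi> 0 r x (\<theta> v \<omega>) = \<phi> 0 r x \<omega>0"
    if "\<omega> \<in> Z" "pat \<omega> \<omega>0" "\<omega>0 \<in> space M" "0 \<le> r" for r x \<omega> \<omega>0
    using pat_AE[OF that(1)]
  proof eventually_elim
    case (elim v)
    then show ?case using that theta_space by (intro pat_det) (auto simp: Z_def)
  qed
  have lim_eq: "lim r x \<omega> = \<phi> 0 r x \<omega>0"
    if "\<omega> \<in> Z" "pat \<omega> \<omega>0" "\<omega>0 \<in> space M" "0 \<le> r" for r x \<omega> \<omega>0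
    unfolding lim_def
  proof (rule some_equality)
    show 1: "AE v in lborel. \<phi> 0 r x (\<theta> v \<omega>) = \<phi> 0 r x \<omega>0" by (rule lim_AE[OF that])
    fix y assume "AE v in lborel. \<phi> 0 r x (\<theta> v \<omega>) = y"
    with 1 have "AE v in lborel. \<phi> 0 r x (\<theta> v \<omega>) = \<phi> 0 r x \<omega>0 \<and> \<phi> 0 r x (\<theta> v \<omega>) = y"
      by eventually_elim simp
    from AE_lborel_ex_between[OF this, of 0 1] show "y = \<phi> 0 r x \<omega>0" by auto
  qed
  \<comment> \<open>The sets \<open>A n\<close> consist of whole orbits, so the least index is the
    same at all points of an orbit. \<open>max 0\<close> keeps the times inside
    \<open>Delta\<close>.\<close>
  define \<Psi> where "\<Psi> r x \<omega> = (if \<exists>n. \<omega> \<in> A n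
      then \<phi> (- b (LEAST n. \<omega> \<in> A n) \<omega>) (- b (LEAST n. \<omega> \<in> A n) \<omega> + max 0 r) x
        (\<theta> (b (LEAST n. \<omega> \<in> A n) \<omega>) \<omega>)
      else if \<omega> \<in> Z then lim (max 0 r) x \<omega> else x)" for r x \<omega>
  \<comment> \<open>A flow given from time 0 and transported by \<open>\<theta>\<close> satisfies
    the cocycle identity without exceptions.\<close>
  define \<psi> where "\<psi> s t x \<omega> = \<Psi> (t - s) x (\<theta> s \<omega>)" for s t x \<omega>
  let ?J = "borel \<Otimes>\<^sub>M (borel \<Otimes>\<^sub>M M) :: (real \<times> 'a option \<times> 'w) measure"
  have A_sets: "{p \<in> space ?J. snd (snd p) \<in> A n} \<in> sets ?J" for n
    using A[of n] by measurable
  have Z_sets: "{p \<in> space ?J. snd (snd p) \<in> Z} \<in> sets ?J" using Z by measurable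
  have \<Psi>: "(\<lambda>p. \<Psi> (fst p) (fst (snd p)) (snd (snd p))) \<in> borel_measurable ?J"
  proof -
    have 1: "(\<lambda>p. \<phi> (- b n (snd (snd p))) (- b n (snd (snd p)) + max 0 (fst p)) (fst (snd p))
        (\<theta> (b n (snd (snd p))) (snd (snd p)))) \<in> borel_measurable ?J" for n
    proof (rule phi_compose_measurable)
      show "(\<lambda>p. - b n (snd (snd p))) \<in> borel_measurable ?J" by measurable
      show "(\<lambda>p. - b n (snd (snd p)) + max 0 (fst p)) \<in> borel_measurable ?J" by measurable
      show "(\<lambda>p. fst (snd p)) \<in> borel_measurable ?J" by measurable
      show "(\<lambda>p. \<theta> (b n (snd (snd p))) (snd (snd p))) \<in> ?J \<rightarrow>\<^sub>M M" by measurable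
      show "0 \<le> - b n (snd (snd p)) \<and> - b n (snd (snd p)) \<le> - b n (snd (snd p)) + max 0 (fst p)" for p
        using b_neg[of n "snd (snd p)"] by simp
    qed
    have 2: "(\<lambda>p. LEAST n. snd (snd p) \<in> A n) \<in> ?J \<rightarrow>\<^sub>M count_space UNIV"
      using A_sets by (intro measurable_Least) (simp add: pred_def)
    have 3: "(\<lambda>p. if snd (snd p) \<in> Z then lim (max 0 (fst p)) (fst (snd p)) (snd (snd p)) else fst (snd p))
        \<in> borel_measurable ?J" (is "?f \<in> _")
    proof (rule measurableI)
      fix B :: "'a option set" assume B: "B \<in> sets borel"
      have "(\<lambda>q. \<phi> 0 (max 0 (fst (fst q))) (fst (snd (fst q))) (\<theta> (snd q) (snd (snd (fst q)))))
          \<in> borel_measurable (?J \<Otimes>\<^sub>M lborel)"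
      proof (rule phi_compose_measurable)
        show "(\<lambda>q. max 0 (fst (fst q))) \<in> borel_measurable (?J \<Otimes>\<^sub>M lborel)" by measurable
        show "(\<lambda>q. fst (snd (fst q))) \<in> borel_measurable (?J \<Otimes>\<^sub>M lborel)" by measurable
        show "(\<lambda>q. \<theta> (snd q) (snd (snd (fst q)))) \<in> ?J \<Otimes>\<^sub>M lborel \<rightarrow>\<^sub>M M" by measurable
      qed simp_all
      from measurable_sets[OF this B]
      have AE_sets: "{p \<in> space ?J. AE v in lborel. \<phi> 0 (max 0 (fst p)) (fst (snd p)) (\<theta> v (snd (snd p))) \<in> B} \<in> sets ?J"
        by (intro sets_Collect_AE_lborel) (simp add: vimage_def Int_def conj_commute)
      have "(\<lambda>p. fst (snd p)) \<in> borel_measurable ?J" by measurable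
      from measurable_sets[OF this B]
      have "({p \<in> space ?J. snd (snd p) \<in> Z} \<inter>
          {p \<in> space ?J. AE v in lborel. \<phi> 0 (max 0 (fst p)) (fst (snd p)) (\<theta> v (snd (snd p))) \<in> B}) \<union>
          ((space ?J - {p \<in> space ?J. snd (snd p) \<in> Z}) \<inter> ((\<lambda>p. fst (snd p)) -` B \<inter> space ?J)) \<in> sets ?J"
        by (rule sets.Un[OF sets.Int[OF Z_sets AE_sets] sets.Int[OF sets.compl_sets[OF Z_sets]]])
      also have "({p \<in> space ?J. snd (snd p) \<in> Z} \<inter>
          {p \<in> space ?J. AE v in lborel. \<phi> 0 (max 0 (fst p)) (fst (snd p)) (\<theta> v (snd (snd p))) \<in> B}) \<union>
          ((space ?J - {p \<in> space ?J. snd (snd p) \<in> Z}) \<inter> ((\<lambda>p. fst (snd p)) -` B \<inter> space ?J)) = ?f -` B \<inter> space ?J"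
      proof -
        have "(AE v in lborel. \<phi> 0 (max 0 r) x (\<theta> v \<omega>) \<in> B) \<longleftrightarrow> lim (max 0 r) x \<omega> \<in> B" if "\<omega> \<in> Z" for r x \<omega>
        proof -
          have "\<exists>\<omega>0. \<omega>0 \<in> G \<and> pat \<omega> \<omega>0" using Z_rep[OF that] by blast
          then obtain \<omega>0 where \<omega>0: "\<omega>0 \<in> G" "pat \<omega> \<omega>0" by blast
          then have sp: "\<omega>0 \<in> space M" by (simp add: G_def)
          note AE = lim_AE[OF that \<omega>0(2) sp max.cobounded1, of r x]
          have eq: "lim (max 0 r) x \<omega> = \<phi> 0 (max 0 r) x \<omega>0" by (rule lim_eq[OF that \<omega>0(2) sp max.cobounded1])
          show ?thesis
          proof
            assume "AE v in lborel. \<phi> 0 (max 0 r) x (\<theta> v \<omega>) \<in> B"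
            with AE have "AE v in lborel. \<phi> 0 (max 0 r) x (\<theta> v \<omega>) = \<phi> 0 (max 0 r) x \<omega>0 \<and>
                \<phi> 0 (max 0 r) x (\<theta> v \<omega>) \<in> B" by eventually_elim simp
            from AE_lborel_ex_between[OF this, of 0 1] show "lim (max 0 r) x \<omega> \<in> B" by (auto simp: eq)
          next
            assume "lim (max 0 r) x \<omega> \<in> B"
            then have "\<phi> 0 (max 0 r) x \<omega>0 \<in> B" by (simp add: eq)
            show "AE v in lborel. \<phi> 0 (max 0 r) x (\<theta> v \<omega>) \<in> B"
              using AE by eventually_elim (simp add: \<open>\<phi> 0 (max 0 r) x \<omega>0 \<in> B\<close>)
          qed
        qed
        then show ?thesis by (auto split: if_splits)
      qed
      finally show "?f -` B \<inter> space ?J \<in> sets ?J" .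
    qed simp
    have 4: "{p \<in> space ?J. \<exists>n. snd (snd p) \<in> A n} \<in> sets ?J"
      using A_sets by (rule sets.sets_Collect_countable_Ex)
    show ?thesis
      unfolding \<Psi>_def
      by (rule measurable_If[OF measurable_compose_countable[OF 1 2] 3 4])
  qed
  have meas: "jointly_measurable M \<psi>"
  proof -
    let ?K = "restrict_space borel Delta \<Otimes>\<^sub>M (borel \<Otimes>\<^sub>M M) :: ((real \<times> real) \<times> 'a option \<times> 'w) measure"
    have f: "(\<lambda>q. fst q) \<in> borel_measurable (restrict_space borel Delta)" "(\<lambda>q. snd q) \<in> borel_measurable (restrict_space borel Delta)"
      for Delta :: "(real \<times> real) set"
      by (intro measurable_restrict_space1; simp add: borel_prod[symmetric])+
    have [measurable]: "(\<lambda>p. fst (fst p)) \<in> borel_measurable ?K" "(\<lambda>p. snd (fst p)) \<in> borel_measurable ?K"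
      by (rule measurable_compose[OF measurable_fst]; rule f)+
    have "(\<lambda>p. (snd (fst p) - fst (fst p), fst (snd p), \<theta> (fst (fst p)) (snd (snd p)))) \<in> ?K \<rightarrow>\<^sub>M ?J"
      by measurable
    from measurable_compose[OF this \<Psi>] show ?thesis
      by (simp add: jointly_measurable_def \<psi>_def case_prod_beta')
  qed
  have perf: "perfect_cocycle M \<theta> \<psi>"
    by (simp add: perfect_cocycle_def \<psi>_def theta_zero theta_space)
  have A_\<psi>: "\<psi> s t x \<omega> = \<phi> (s - u) (t - u) x (\<theta> u \<omega>)"
    if "\<omega> \<in> space M" "\<omega> \<in> A n" "n = (LEAST n. \<omega> \<in> A n)" "s \<le> t" "u = s + b n (\<theta> s \<omega>)" for s t x \<omega> n u
  proof -
    have "\<theta> u \<omega> = \<theta> (b n (\<theta> s \<omega>)) (\<theta> s \<omega>)"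
      using that(5) by (simp only: theta_add[OF that(1), symmetric] add.commute)
    moreover have "max 0 (t - s) = t - s" using that(4) by simp
    ultimately show ?thesis
      using that by (auto simp: \<psi>_def \<Psi>_def A_theta[OF that(1)] algebra_simps)
  qed
  have A_anchor: "crossings (\<tau> n) (\<theta> s \<omega>) \<noteq> {}" "\<theta> (s + b n (\<theta> s \<omega>)) \<omega> \<in> G"
    if "\<omega> \<in> A n" for s \<omega> n
  proof -
    have \<omega>: "\<omega> \<in> space M" "\<theta> s \<omega> \<in> anchored \<xi> (\<tau> n) G" using that by (auto simp: A_def ever_anchored_def)
    then show "crossings (\<tau> n) (\<theta> s \<omega>) \<noteq> {}" by (simp add: anchored_def)
    have "\<theta> (b n (\<theta> s \<omega>) + s) \<omega> \<in> G"
      unfolding theta_add[OF \<omega>(1)] using \<omega>(2) by (simp add: anchored_def b_def)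
    then show "\<theta> (s + b n (\<theta> s \<omega>)) \<omega> \<in> G" by (simp add: add.commute)
  qed
  have A_const: "\<exists>e>s. \<forall>r\<in>{s..<e}. r + b n (\<theta> r \<omega>) = s + b n (\<theta> s \<omega>)" if "\<omega> \<in> A n" for s \<omega> n
  proof -
    have "\<omega> \<in> space M" using that by (simp add: A_def ever_anchored_def)
    from age_right_constant[OF this test\<tau>, of s n] A_anchor(1)[OF that, of s]
    obtain e where e: "e > s" "\<forall>r\<in>{s..<e}. r - age (\<tau> n) (\<theta> r \<omega>) = s - age (\<tau> n) (\<theta> s \<omega>)" by blast
    have "r + b n (\<theta> r \<omega>) = s + b n (\<theta> s \<omega>)" if "r \<in> {s..<e}" for r
      using bspec[OF e(2) that] by (simp add: b_def)
    with e(1) show ?thesis by blast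
  qed
  \<comment> \<open>Seen from a good base, the flow from almost every later time \<open>r\<close> is
    \<open>\<phi>\<close> started afresh at \<open>\<theta> r \<omega>\<close>, an expression
    without \<open>v\<close>. Hence two good bases agree at almost all times after both.\<close>
  have G_regular: "AE r in lborel. v < r \<longrightarrow> (\<forall>t\<ge>r. \<forall>x. \<phi> (r - v) (t - v) x (\<theta> v \<omega>) = \<phi> 0 (t - r) x (\<theta> r \<omega>))"
    if "\<omega> \<in> space M" "\<theta> v \<omega> \<in> G" for v \<omega>
  proof -
    have "AE s in lborel. (s, \<theta> v \<omega>) \<notin> E" using that(2) by (simp add: G_def)
    from AE_lborel_translate[OF this, of "- v"]
    have "AE r in lborel. (r - v, \<theta> v \<omega>) \<notin> E" by (simp add: add.commute)
    then show ?thesis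
    proof eventually_elim
      case (elim r)
      show ?case
      proof (intro impI allI)
        fix t x assume "v < r" "r \<le> t"
        then have "\<phi> (r - v) (r - v + (t - r)) x (\<theta> v \<omega>) = \<phi> 0 (t - r) x (\<theta> (r - v) (\<theta> v \<omega>))"
          using elim that(1) by (intro regular) (auto simp: theta_space)
        then show "\<phi> (r - v) (t - v) x (\<theta> v \<omega>) = \<phi> 0 (t - r) x (\<theta> r \<omega>)"
          by (simp add: theta_add[OF that(1), symmetric])
      qed
    qed
  qed
  have inh: "inherits M \<phi> M \<psi>"
  proof (rule inherits_pointwise)
    fix \<omega> assume \<omega>: "\<omega> \<in> space M"
    consider (anchored) "\<exists>n. \<omega> \<in> A n" | (stationary) "\<not> (\<exists>n. \<omega> \<in> A n)" "\<omega> \<in> Z"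
      | (exceptional) "\<not> (\<exists>n. \<omega> \<in> A n)" "\<omega> \<notin> Z" by blast
    then show "inherits M \<phi> (count_space {\<omega>}) \<psi>"
    proof cases
      case anchored
      define n where "n = (LEAST n. \<omega> \<in> A n)"
      have n: "\<omega> \<in> A n" unfolding n_def using anchored by (rule LeastI_ex)
      define u where "u s = s + b n (\<theta> s \<omega>)" for s
      show ?thesis
      proof (rule inherits_moving_base[OF absorbing_phi flow_phi start_phi end_phi, of "\<lambda>v. \<theta> v \<omega>" u])
        show "\<theta> v \<omega> \<in> space M" for v by (rule theta_space[OF \<omega>])
        show "u s < s" for s using b_neg[of n "\<theta> s \<omega>"] by (simp add: u_def)
        show "\<exists>e>s. \<forall>r\<in>{s..<e}. u r = u s" for s unfolding u_def by (rule A_const[OF n])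
        show "AE r in lborel. max (u s) (u s') < r \<longrightarrow>
          (\<forall>t\<ge>r. \<forall>x. \<phi> (r - u s) (t - u s) x (\<theta> (u s) \<omega>) = \<phi> (r - u s') (t - u s') x (\<theta> (u s') \<omega>))" for s s'
          using G_regular[OF \<omega> A_anchor(2)[OF n, of s]] G_regular[OF \<omega> A_anchor(2)[OF n, of s']]
          unfolding u_def[symmetric] by eventually_elim simp
        show "\<psi> s t x \<omega> = \<phi> (s - u s) (t - u s) x (\<theta> (u s) \<omega>)" if "0 \<le> s" "s \<le> t" for s t x
          using A_\<psi>[OF \<omega> n n_def that(2) refl] unfolding u_def .
      qed
    next
      case stationary
      obtain v where "\<theta> v \<omega> \<in> G" "pat \<omega> (\<theta> v \<omega>)" using Z_rep[OF stationary(2)] by blast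
      define \<omega>0 where "\<omega>0 = \<theta> v \<omega>"
      have \<omega>0: "\<omega>0 \<in> G" "pat \<omega> \<omega>0" unfolding \<omega>0_def by fact+
      then have sp: "\<omega>0 \<in> space M" by (simp add: G_def)
      have Z_\<omega>: "\<theta> s \<omega> \<in> Z" for s using stationary(2) Z_theta[OF \<omega>] by simp
      show ?thesis
      proof (rule inherits_stationary[OF absorbing_phi flow_phi start_phi end_phi sp,
            where \<kappa> = "\<lambda>t x. \<phi> 0 t x \<omega>0"])
        show "\<psi> s t x \<omega> = \<phi> 0 (t - s) x \<omega>0" if "0 \<le> s" "s \<le> t" for s t x
          using stationary that lim_eq[OF Z_\<omega>, of s \<omega>0 "t - s" x] \<omega>0(2) sp
          by (simp add: \<psi>_def \<Psi>_def A_theta[OF \<omega>] Z_\<omega> pat_theta[OF \<omega>])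
        show "AE s in lborel. 0 \<le> s \<longrightarrow> (\<forall>t\<ge>0. \<forall>x. \<phi> s (s + t) x \<omega>0 = \<phi> 0 t x \<omega>0)"
        proof -
          have "AE s in lborel. (s, \<omega>0) \<notin> E" using \<omega>0(1) by (simp add: G_def)
          moreover have "AE s in lborel. pat \<omega> (\<theta> s \<omega>0)"
            using pat_AE[OF Z_\<omega>[of v]] unfolding pat_theta[OF \<omega>] \<omega>0_def .
          ultimately show ?thesis
          proof eventually_elim
            case (elim s)
            show ?case
            proof (intro impI allI)
              fix t :: real and x assume st: "0 \<le> s" "0 \<le> t"
              have "\<phi> s (s + t) x \<omega>0 = \<phi> 0 t x (\<theta> s \<omega>0)" by (rule regular[OF st(1) sp elim(1) st(2)])
              also have "\<dots> = \<phi> 0 t x \<omega>0"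
                by (rule pat_det[OF elim(2) \<omega>0(2) theta_space[OF sp] sp]) (use st in simp_all)
              finally show "\<phi> s (s + t) x \<omega>0 = \<phi> 0 t x \<omega>0" .
            qed
          qed
        qed
      qed
    next
      case exceptional
      show ?thesis
        by (rule inherits_frozen) (simp add: \<psi>_def \<Psi>_def A_theta[OF \<omega>] Z_theta[OF \<omega>] exceptional)
    qed
  qed
  \<comment> \<open>If some test in \<open>T\<close> has an upcrossing on the orbit, the choice of
    \<open>\<xi>\<close> anchors it; if none has, every event of \<open>C\<close> obeys the zero-one
    alternative.\<close>
  have cover: "AE \<omega> in M. (\<exists>n. \<omega> \<in> A n) \<or> \<omega> \<in> Z"
    using \<xi> AE_orbit[OF G AE_G] AE_space
  proof eventually_elim
    case (elim \<omega>)
    show ?case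
    proof (cases "\<exists>\<tau>\<in>T. \<exists>s. crossings \<tau> (\<theta> s \<omega>) \<noteq> {}")
      case True
      then obtain \<tau>' where \<tau>': "\<tau>' \<in> T" "\<omega> \<in> ever_anchored \<xi> \<tau>' G" using elim(1) by blast
      then obtain n where "\<tau> n = \<tau>'" unfolding \<tau>_def using from_nat_into_surj[OF T] by blast
      with \<tau>'(2) show ?thesis by (auto simp: A_def)
    next
      case False
      have "(AE v in lborel. \<theta> v \<omega> \<in> c) \<or> (AE v in lborel. \<theta> v \<omega> \<in> space M - c)" if "c \<in> C" for c
      proof -
        have "crossings (d, a, b) (\<theta> s \<omega>) = {}"
          if "d \<in> {c, space M - c}" "a \<in> \<rat>" "b \<in> \<rat>" "a < b" for d a b s
        proof -
          have "d \<in> C" using that(1) \<open>c \<in> C\<close> C_compl by blast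
          then have "(d, a, b) \<in> T" using that by (auto simp: T_def)
          with False show ?thesis by blast
        qed
        from AE_const_if_no_crossings[OF elim(3) _ this] that C(2)
        have "(AE v in lborel. \<theta> v \<omega> \<in> c) \<or> (AE v in lborel. \<theta> v \<omega> \<notin> c)" by blast
        then show ?thesis using theta_space[OF elim(3)] by simp
      qed
      with elim(2,3) show ?thesis by (simp add: Z_def)
    qed
  qed
  \<comment> \<open>On one orbit the base takes only the values \<open>u q\<close> at rational
    \<open>q\<close>, because it is constant to the right of each time. Countably many null sets of
    exceptional times are thus avoided at almost every time, and \<open>AE_of_orbit\<close>
    transfers this to time 0.\<close>
  have anchored_regular: "AE \<omega> in M. \<omega> \<in> A n \<longrightarrow> (- b n \<omega>, \<theta> (b n \<omega>) \<omega>) \<notin> E" for n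
  proof -
    define Q where "Q = (space M - A n) \<union> ((\<lambda>\<omega>. (- b n \<omega>, \<theta> (b n \<omega>) \<omega>)) -` (space (lborel \<Otimes>\<^sub>M M) - E) \<inter> space M)"
    have "(\<lambda>\<omega>. (- b n \<omega>, \<theta> (b n \<omega>) \<omega>)) \<in> M \<rightarrow>\<^sub>M lborel \<Otimes>\<^sub>M M" by measurable
    from measurable_sets[OF this sets.compl_sets[OF E(1)]] have Q: "Q \<in> sets M"
      unfolding Q_def by (rule sets.Un[OF sets.compl_sets[OF A]])
    have Q_iff: "\<omega> \<in> Q \<longleftrightarrow> (\<omega> \<in> A n \<longrightarrow> (- b n \<omega>, \<theta> (b n \<omega>) \<omega>) \<notin> E)" if "\<omega> \<in> space M" for \<omega>
      using that theta_space[OF that] by (auto simp: Q_def space_pair_measure)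
    have "AE s in lborel. \<theta> s \<omega> \<in> Q" if \<omega>: "\<omega> \<in> space M" for \<omega>
    proof (cases "\<omega> \<in> A n")
      case False
      then show ?thesis by (simp add: Q_iff[OF theta_space[OF \<omega>]] A_theta[OF \<omega>])
    next
      case True
      define u where "u s = s + b n (\<theta> s \<omega>)" for s
      have "AE s in lborel. (s - u q, \<theta> (u q) \<omega>) \<notin> E" for q
      proof -
        have "AE s in lborel. (s, \<theta> (u q) \<omega>) \<notin> E"
          using A_anchor(2)[OF True, of q] by (simp add: G_def u_def)
        from AE_lborel_translate[OF this, of "- u q"] show ?thesis by (simp add: add.commute)
      qed
      then have "AE s in lborel. \<forall>q\<in>\<rat>. (s - u q, \<theta> (u q) \<omega>) \<notin> E"
        by (simp add: AE_ball_countable[OF countable_rat])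
      then show ?thesis
      proof eventually_elim
        case (elim s)
        obtain e where e: "e > s" "\<forall>r\<in>{s..<e}. u r = u s" using A_const[OF True, of s] unfolding u_def by blast
        obtain q where q: "q \<in> \<rat>" "s < q" "q < e" using Rats_dense_in_real[OF e(1)] by blast
        then have "u q = u s" by (intro bspec[OF e(2)]) simp
        with elim q(1) have "(s - u s, \<theta> (u s) \<omega>) \<notin> E" by metis
        moreover have "s - u s = - b n (\<theta> s \<omega>)" by (simp add: u_def)
        moreover have "\<theta> (u s) \<omega> = \<theta> (b n (\<theta> s \<omega>)) (\<theta> s \<omega>)"
          by (simp only: u_def theta_add[OF \<omega>, symmetric] add.commute)
        ultimately show ?case by (simp add: Q_iff[OF theta_space[OF \<omega>]])
      qed
    qed
    then have "AE \<omega> in M. AE s in lborel. \<theta> s \<omega> \<in> Q" by (rule AE_I2)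
    from AE_of_orbit[OF Q this] AE_space show ?thesis by eventually_elim (simp add: Q_iff)
  qed
  \<comment> \<open>Almost every point on a zero-one orbit is typical for it; the passage from
    orbits back to points makes almost every \<open>\<omega> \<in> Z\<close> typical for its own
    orbit.\<close>
  have Z_pat: "AE \<omega> in M. \<omega> \<in> Z \<longrightarrow> pat \<omega> \<omega>"
  proof -
    define Q where "Q = {\<omega> \<in> space M. \<omega> \<in> Z \<longrightarrow> pat \<omega> \<omega>}"
    have "{\<omega> \<in> space M. \<omega> \<in> c \<longleftrightarrow> (AE v in lborel. \<theta> v \<omega> \<in> c)} \<in> sets M" if "c \<in> C" for c
    proof -
      have c: "c \<in> sets M" using that C(2) by blast
      then have 1: "{\<omega> \<in> space M. \<omega> \<in> c} \<in> sets M" by measurable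
      have "{\<omega> \<in> space M. (\<omega> \<in> c \<longrightarrow> (AE v in lborel. \<theta> v \<omega> \<in> c)) \<and> ((AE v in lborel. \<theta> v \<omega> \<in> c) \<longrightarrow> \<omega> \<in> c)} \<in> sets M"
        using 1 sets_AE_orbit[OF c] by (intro sets.sets_Collect_conj sets.sets_Collect_imp)
      then show ?thesis by (simp only: iff_conv_conj_imp)
    qed
    then have "{\<omega> \<in> space M. pat \<omega> \<omega>} \<in> sets M"
      unfolding pat_def using C(1) by (intro sets.sets_Collect_countable_All')
    moreover have "{\<omega> \<in> space M. \<omega> \<in> Z} \<in> sets M" using Z by measurable
    ultimately have Q: "Q \<in> sets M" unfolding Q_def by (intro sets.sets_Collect_imp)
    have "AE s in lborel. \<theta> s \<omega> \<in> Q" if \<omega>: "\<omega> \<in> space M" for \<omega>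
    proof (cases "\<omega> \<in> Z")
      case True
      from pat_AE[OF True] show ?thesis
        by eventually_elim (simp add: Q_def theta_space[OF \<omega>] pat_theta[OF \<omega>])
    qed (simp add: Q_def theta_space[OF \<omega>] Z_theta[OF \<omega>])
    then have "AE \<omega> in M. AE s in lborel. \<theta> s \<omega> \<in> Q" by (rule AE_I2)
    from AE_of_orbit[OF Q this] show ?thesis by eventually_elim (simp add: Q_def)
  qed
  have "AE \<omega> in M. \<forall>n. \<omega> \<in> A n \<longrightarrow> (- b n \<omega>, \<theta> (b n \<omega>) \<omega>) \<notin> E"
    using anchored_regular by (simp add: AE_all_countable)
  then have AE_\<Psi>: "AE \<omega> in M. \<forall>r\<ge>0. \<forall>x. \<Psi> r x \<omega> = \<phi> 0 r x \<omega>"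
    using cover Z_pat AE_space
  proof eventually_elim
    case (elim \<omega>)
    show ?case
    proof (intro allI impI)
      fix r :: real and x assume "0 \<le> r"
      show "\<Psi> r x \<omega> = \<phi> 0 r x \<omega>"
      proof (cases "\<exists>n. \<omega> \<in> A n")
        case True
        define n where "n = (LEAST n. \<omega> \<in> A n)"
        have "\<omega> \<in> A n" unfolding n_def using True by (rule LeastI_ex)
        with elim(1) have "(- b n \<omega>, \<theta> (b n \<omega>) \<omega>) \<notin> E" by blast
        then have "\<phi> (- b n \<omega>) (- b n \<omega> + r) x (\<theta> (b n \<omega>) \<omega>) = \<phi> 0 r x (\<theta> (- b n \<omega>) (\<theta> (b n \<omega>) \<omega>))"
          using b_neg[of n \<omega>] \<open>0 \<le> r\<close> theta_space[OF elim(4)] by (intro regular) auto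
        also have "\<theta> (- b n \<omega>) (\<theta> (b n \<omega>) \<omega>) = \<omega>"
          by (simp add: theta_add[OF elim(4), symmetric] theta_zero[OF elim(4)])
        finally show ?thesis using True \<open>0 \<le> r\<close> by (simp add: \<Psi>_def n_def)
      next
        case False
        with elim(2) have "\<omega> \<in> Z" by blast
        with False elim(3,4) \<open>0 \<le> r\<close> show ?thesis by (simp add: \<Psi>_def lim_eq)
      qed
    qed
  qed
  have ind: "indistinguishable M \<psi> \<phi>"
    unfolding indistinguishable_def
  proof (intro allI impI)
    fix s :: real assume "0 \<le> s"
    with crude_phi have "\<exists>N\<in>null_sets M. \<forall>x. \<forall>\<omega>\<in>space M - N. \<forall>t\<ge>s. \<phi> s t x \<omega> = \<phi> 0 (t - s) x (\<theta> s \<omega>)"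
      unfolding crude_cocycle_def by simp
    then obtain N where N: "N \<in> null_sets M"
      "\<forall>x. \<forall>\<omega>\<in>space M - N. \<forall>t\<ge>s. \<phi> s t x \<omega> = \<phi> 0 (t - s) x (\<theta> s \<omega>)"
      by (elim bexE)
    \<comment> \<open>Outside \<open>N\<close> the flow \<open>\<phi>\<close> from time
      \<open>s\<close> equals the flow from time 0 at \<open>\<theta> s \<omega>\<close>, where
      \<open>\<Psi>\<close> coincides with it almost surely by invariance.\<close>
    have "AE \<omega> in M. \<forall>t\<ge>s. \<forall>x. \<psi> s t x \<omega> = \<phi> s t x \<omega>"
      using AE_theta[OF AE_\<Psi>, of s] AE_not_in[OF N(1)] AE_space
      by eventually_elim (use N(2) in \<open>simp add: \<psi>_def\<close>)
    then show "inner_measure_of M {\<omega> \<in> space M. \<forall>t\<ge>s. \<forall>x. \<psi> s t x \<omega> = \<phi> s t x \<omega>} = 1"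
      by (rule inner_measure_of_AE[OF prob_space_axioms])
  qed
  show ?thesis using meas inh perf ind by blast
qed

end

theorem proposition2p5:
  fixes M :: "'w measure" and \<theta> :: "real \<Rightarrow> 'w \<Rightarrow> 'w"
    and \<phi> :: "real \<Rightarrow> real \<Rightarrow> 'a::polish_space option \<Rightarrow> 'w \<Rightarrow> 'a option"
  assumes "metric_dynamical_system M \<theta>"
    and "jointly_measurable M \<phi>"
    and "absorbing M \<phi>"
    and "flow_property M \<phi>"
    and "crude_cocycle M \<theta> \<phi>"
    and "right_continuous_start M \<phi>"
    and "right_continuous_end M \<phi>"
  shows "\<exists>\<psi> :: real \<Rightarrow> real \<Rightarrow> 'a option \<Rightarrow> 'w \<Rightarrow> 'a option.
    jointly_measurable M \<psi> \<and>
    absorbing M \<psi> \<and>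
    flow_property M \<psi> \<and>
    right_continuous_start M \<psi> \<and>
    right_continuous_end M \<psi> \<and>
    perfect_cocycle M \<theta> \<psi> \<and>
    indistinguishable M \<psi> \<phi> \<and>
    (identity_on_diagonal M \<phi> \<longrightarrow> identity_on_diagonal M \<psi>) \<and>
    (stays_in_X M \<phi> \<longrightarrow> stays_in_X M \<psi>) \<and>
    (continuous_start M \<phi> \<longrightarrow> continuous_start M \<psi>) \<and>
    (continuous_end M \<phi> \<longrightarrow> continuous_end M \<psi>) \<and>
    (continuous_start_end M \<phi> \<longrightarrow> continuous_start_end M \<psi>) \<and>
    (\<forall>x0\<in>range Some. continuous_state_at M x0 \<phi> \<longrightarrow> continuous_state_at M x0 \<psi>)"
proof -
  interpret crude_flow M \<theta> \<phi>
    using assms by (simp add: crude_flow_def crude_flow_axioms_def)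
  obtain \<psi> where "jointly_measurable M \<psi>" "inherits M \<phi> M \<psi>" "perfect_cocycle M \<theta> \<psi>" "indistinguishable M \<psi> \<phi>"
    using ex_perfect_version by blast
  then show ?thesis
    unfolding inherits_def by (intro exI[of _ \<psi>] conjI) (elim conjE, assumption)+
qed

end
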